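(* Let $(M^5,g,\xi,\eta,\varphi)$ be a $5$-dimensional almost contact metric manifold. Then the following equivalences hold: $(M^5,g,\xi,\eta,\varphi)$ is of class - $\mathcal{C}_2$ if and only if it is of class $\mathcal{W}_9$; - $\mathcal{C}_4$ if and only if it is of class $\mathcal{W}_6$; - $\mathcal{C}_5$ if and only if it is of class $\mathcal{W}_1$; - $\mathcal{C}_6$ if and only if it is of class $\mathcal{W}_3$; - $\mathcal{C}_7$ if and only if it is of class $\mathcal{W}_5$; - $\mathcal{C}_8$ if and only if it is of class $\mathcal{W}_8$; - $\mathcal{C}_9$ if and only if it is of class $\mathcal{W}_{10}$; - $\mathcal{C}_{10}\oplus\mathcal{C}_{11}$ if and only if it is of class $\mathcal{W}_4\oplus\mathcal{W}_7$; - $\mathcal{C}_4\oplus\mathcal{C}_{12}$ if and only if it is of class $\mathcal{W}_2\oplus\mathcal{W}_6$. Moreover, if $(M^5,g,\xi,\eta,\varphi)$ is not integrable and either of class $\mathcal{C}_{10}$ or of class $\mathcal{C}_{11}$, then $(M^5,g,\xi,\eta,\varphi)$ is of strict class $\mathcal{W}_4\oplus\mathcal{W}_7$. Any non-integrable almost contact metric $5$-manifold of class $\mathcal{C}_{12}$ is of strict class $\mathcal{W}_2\oplus\mathcal{W}_6$.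
   Context: Local model. $\mathbb{R}^5$ is Euclidean space with scalar product $\langle\cdot,\cdot\rangle$, an orientation and an oriented orthonormal basis $(e_1,\dots,e_5)$; vectors and $1$-forms are identified via $\langle\cdot,\cdot\rangle$; $\Lambda^k$ is the space of $k$-forms on $\mathbb{R}^5$, $*$ the Hodge operator, $\lrcorner$ the interior product, and $(e_1\wedge e_2)(e_1,e_2)=1$. Put $\xi=e_5$, $\eta$ its dual $1$-form, $\varphi$ the endomorphism with $\varphi(e_1)=-e_2$, $\varphi(e_2)=e_1$, $\varphi(e_3)=-e_4$, $\varphi(e_4)=e_3$, $\varphi(\xi)=0$, and $\Phi(X,Y)=\langle X,\varphi(Y)\rangle$, so $\Phi=e_1\wedge e_2+e_3\wedge e_4$. $U(2)=\{B\in O(5): B\xi=\xi,\ B\circ\varphi=\varphi\circ B\}$. Subspaces of forms: $\Lambda^1_1=\mathbb{R}\eta$, $\Lambda^1_2=\{\alpha\in\Lambda^1:\xi\lrcorner\alpha=0\}$; $\Lambda^2_1=\mathbb{R}\Phi$, $\Lambda^2_2=\{\alpha\in\Lambda^2:\Phi\wedge\alpha=0,\ *\alpha=\eta\wedge\alpha\}$, $\Lambda^2_3=\{\alpha\in\Lambda^2:*\alpha=-\eta\wedge\alpha\}$, $\Lambda^2_4=\{\alpha\in\Lambda^2:\eta\wedge\alpha=0\}$; $\Lambda^3_i=*\Lambda^2_i$. Identifying $\mathfrak{so}(5)=\Lambda^2$, $\mathfrak{u}(2)=\Lambda^2_1\oplus\Lambda^2_3$ has orthogonal complement $\mathfrak{m}=\Lambda^2_2\oplus\Lambda^2_4$;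 $\operatorname{pr}_{\mathfrak m}:\Lambda^2\to\mathfrak{m}$ is the orthogonal projection. $\mathcal{A}=\Lambda^1\otimes\Lambda^2=\{A\in\otimes^3\Lambda^1: A(X,Y,Z)+A(X,Z,Y)=0\}$, where $(\alpha\otimes\beta)(X,Y,Z)=\alpha(X)\beta(Y,Z)$; $\mathcal{A}_3=\{A\in\mathcal{A}: A(X,Y,Z)+A(Y,Z,X)+A(Z,X,Y)=0,\ \sum_iA(e_i,e_i,X)=0\}$; $\mathcal{W}=\Lambda^1\otimes\mathfrak{m}$ and $\operatorname{pr}_{\mathcal W}:\mathcal{A}\to\mathcal{W}$, $\operatorname{pr}_{\mathcal W}(\alpha\otimes\beta)=\alpha\otimes\operatorname{pr}_{\mathfrak m}(\beta)$. Put $\theta_1(\alpha)(X,Y,Z)=\alpha(Z)\langle X,Y\rangle-\alpha(Y)\langle X,Z\rangle$ for $\alpha\in\Lambda^1$; $\theta_2(\alpha)=\sum_ie_i\otimes(e_i\lrcorner\alpha)$ for $\alpha\in\Lambda^3$; $\theta_3(\alpha)=3\,\eta\otimes\alpha-\theta_2(\eta\wedge\alpha)$ for $\alpha\in\Lambda^2_1\oplus\Lambda^2_2\oplus\Lambda^2_3$. Then $\mathcal{W}=\mathcal{W}_1\oplus\dots\oplus\mathcal{W}_{10}$ ($U(2)$-irreducible summands) with $\mathcal{W}_1=\theta_1(\Lambda^1_1)$, $\mathcal{W}_2=\operatorname{pr}_{\mathcal W}(\theta_1(\Lambda^1_2))$, $\mathcal{W}_3=\operatorname{pr}_{\mathcal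 W}(\theta_2(\Lambda^3_1))$, $\mathcal{W}_4=\theta_2(\Lambda^3_2)$, $\mathcal{W}_5=\operatorname{pr}_{\mathcal W}(\theta_2(\Lambda^3_3))$, $\mathcal{W}_6=\operatorname{pr}_{\mathcal W}(\theta_2(\Lambda^3_4))$, $\mathcal{W}_7=\theta_3(\Lambda^2_2)$, $\mathcal{W}_8=\{A\in\mathcal{A}_3:A(X,Y,Z)=A(\varphi X,Y,\varphi Z)+A(\varphi X,\varphi Y,Z)\}$, $\mathcal{W}_9=\{A\in\mathcal{A}_3:A(X,Y,Z)=-A(X,\varphi Y,\varphi Z)\}$, $\mathcal{W}_{10}=\{A\in\mathcal{A}_3:A(X,Y,Z)=-A(\varphi X,Y,\varphi Z)-A(\varphi X,\varphi Y,Z)\}$. Manifolds. An almost contact metric $5$-manifold $(M^5,g,\xi,\eta,\varphi)$ is a Riemannian $5$-manifold with a unit vector field $\xi$, its dual $1$-form $\eta$ and an endomorphism $\varphi$ of $TM^5$ with $\varphi(\xi)=0$, $\varphi^2=-\mathrm{Id}+\eta\otimes\xi$, $g(\varphi X,\varphi Y)=g(X,Y)-\eta(X)\eta(Y)$. Its fundamental form is $\Phi(X,Y)=g(X,\varphi(Y))$. Locally there are adapted frames: oriented orthonormal frames $(e_1,\dots,e_5)$ with $\xi=e_5$, $\Phi=e_1\wedge e_2+e_3\wedge e_4$, which identify each tangent space with the local model (all subspaces above are $U(2)$-invariant, hence define subbundles). With $\nabla^g$ the Levi-Civita connection and $\omega^g_{ij}=g(\nabla^ge_i,e_j)$, put $\Omega^g=(\omega^g_{ij})$,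 i.e. $\Omega^g(X)=\sum_{i<j}\omega^g_{ij}(X)\,e_i\wedge e_j$. The intrinsic torsion is $\Gamma=\operatorname{pr}_{\mathfrak m}(\Omega^g)$, a section of $\mathcal{W}$, with components $\Gamma=\Gamma_1+\dots+\Gamma_{10}$, $\Gamma_i\in\mathcal{W}_i$. The manifold is of class $\mathcal{W}_{i_1}\oplus\dots\oplus\mathcal{W}_{i_k}$ if $\Gamma\in\mathcal{W}_{i_1}\oplus\dots\oplus\mathcal{W}_{i_k}$; of strict class if moreover $\Gamma_{i_j}\neq0$ for all $j$; integrable if $\Gamma=0$. Chinea–Gonzalez classes (dimension 5). $\mathcal{C}=\{A\in\Lambda^1\otimes\Lambda^2: A(X,Y,Z)=-A(X,\varphi Y,\varphi Z)+\eta(Y)A(X,\xi,Z)+\eta(Z)A(X,Y,\xi)\}=\mathcal{C}_2\oplus\mathcal{C}_4\oplus\mathcal{C}_5\oplus\dots\oplus\mathcal{C}_{12}$, where, with $c(A)(X)=\sum_iA(e_i,e_i,X)$ and $\bar c(A)(X)=\sum_iA(e_i,\varphi e_i,X)$, each $\mathcal{C}_i$ consists of the $A\in\mathcal{C}$ satisfying: $\mathcal{C}_2$: $A(X,Y,Z)+A(Y,Z,X)+A(Z,X,Y)=0$ and $A(X,Y,\xi)=0$; $\mathcal{C}_4$: $A(X,Y,Z)=\frac12\big[(g(X,Y)-\eta(X)\eta(Y))c(A)(Z)-(g(X,Z)-\eta(X)\eta(Z))c(A)(Y)-g(X,\varphi Y)c(A)(\varphi Z)+g(X,\varphi Z)c(A)(\varphi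 Y)\big]$ and $c(A)(\xi)=0$; $\mathcal{C}_5$: $A(X,Y,Z)=\frac14\,\bar c(A)(\xi)\,[g(X,\varphi Z)\eta(Y)-g(X,\varphi Y)\eta(Z)]$; $\mathcal{C}_6$: $A(X,Y,Z)=\frac14\,c(A)(\xi)\,[g(X,Y)\eta(Z)-g(X,Z)\eta(Y)]$; $\mathcal{C}_7$: $A(X,Y,Z)=\eta(Z)A(Y,X,\xi)-\eta(Y)A(\varphi X,\varphi Z,\xi)$ and $c(A)(\xi)=0$; $\mathcal{C}_8$: $A(X,Y,Z)=-\eta(Z)A(Y,X,\xi)-\eta(Y)A(\varphi X,\varphi Z,\xi)$ and $\bar c(A)(\xi)=0$; $\mathcal{C}_9$: $A(X,Y,Z)=\eta(Z)A(Y,X,\xi)+\eta(Y)A(\varphi X,\varphi Z,\xi)$; $\mathcal{C}_{10}$: $A(X,Y,Z)=-\eta(Z)A(Y,X,\xi)+\eta(Y)A(\varphi X,\varphi Z,\xi)$; $\mathcal{C}_{11}$: $A(X,Y,Z)=-\eta(X)A(\xi,\varphi Y,\varphi Z)$; $\mathcal{C}_{12}$: $A(X,Y,Z)=\eta(X)\eta(Y)A(\xi,\xi,Z)+\eta(X)\eta(Z)A(\xi,Y,\xi)$. The manifold is of class $\mathcal{C}_{i_1}\oplus\dots\oplus\mathcal{C}_{i_k}$ if $\nabla^g\Phi\in\mathcal{C}_{i_1}\oplus\dots\oplus\mathcal{C}_{i_k}$, where $(\nabla^g\Phi)(X,Y,Z)=(\nabla^g_X\Phi)(Y,Z)$. 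*)

theory Defs
  imports "HOL-Analysis.Analysis" "HOL-Library.Function_Algebras"
begin

text \<open>
  Forms and tensors are curried real functions; addition, subtraction and zero of such functions
  are pointwise (\<open>Function_Algebras\<close>), and \<open>+\<close>, \<open>sum\<close> of sets of tensors are
  Minkowski sums (\<open>Set_Algebras\<close>), so \<open>sum V I\<close> is the sum of the subspaces
  \<open>V i\<close>, \<open>i \<in> I\<close>, for finite \<open>I\<close>.
\<close>

section \<open>The local model\<close>

type_synonym vec5 = "real ^ 5"
type_synonym form1 = "vec5 \<Rightarrow> real"
type_synonym form2 = "vec5 \<Rightarrow> vec5 \<Rightarrow> real"
type_synonym form3 = "vec5 \<Rightarrow> vec5 \<Rightarrow> vec5 \<Rightarrow> real"
type_synonym form4 = "vec5 \<Rightarrow> vec5 \<Rightarrow> vec5 \<Rightarrow> vec5 \<Rightarrow> real"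

text \<open>In the index type \<open>5\<close> the element \<open>5\<close> equals \<open>0\<close>; the five
  elements are \<open>1, 2, 3, 4, 5\<close>.\<close>

definition bas :: "5 \<Rightarrow> vec5" where
  "bas i = axis i 1"

definition xi0 :: vec5 where
  "xi0 = bas 5"

definition eta0 :: form1 where
  "eta0 X = xi0 \<bullet> X"

definition phi0 :: "vec5 \<Rightarrow> vec5" where
  "phi0 X = X$1 *\<^sub>R (- bas 2) + X$2 *\<^sub>R bas 1 + X$3 *\<^sub>R (- bas 4) + X$4 *\<^sub>R bas 3"

definition Phi0 :: form2 where
  "Phi0 X Y = X \<bullet> phi0 Y"

definition wedge11 :: "form1 \<Rightarrow> form1 \<Rightarrow> form2" where
  "wedge11 \<alpha> \<beta> X Y = \<alpha> X * \<beta> Y - \<alpha> Y * \<beta> X"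

definition wedge12 :: "form1 \<Rightarrow> form2 \<Rightarrow> form3" where
  "wedge12 \<alpha> \<beta> X Y Z = \<alpha> X * \<beta> Y Z + \<alpha> Y * \<beta> Z X + \<alpha> Z * \<beta> X Y"

definition wedge22 :: "form2 \<Rightarrow> form2 \<Rightarrow> form4" where
  "wedge22 \<alpha> \<beta> X Y Z T =
     \<alpha> X Y * \<beta> Z T - \<alpha> X Z * \<beta> Y T + \<alpha> X T * \<beta> Y Z
   + \<alpha> Y Z * \<beta> X T - \<alpha> Y T * \<beta> X Z + \<alpha> Z T * \<beta> X Y"

text \<open>Hodge operator from 2-forms to 3-forms, the volume form being the determinant; e.g. it
  sends \<open>e1 \<and> e2\<close> to \<open>e3 \<and> e4 \<and> e5\<close>.\<close>

definition hodge2 :: "form2 \<Rightarrow> form3" where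
  "hodge2 \<alpha> X Y Z =
     1/2 * (\<Sum>i\<in>UNIV. \<Sum>j\<in>UNIV. \<alpha> (bas i) (bas j) *
              det (vector [bas i, bas j, X, Y, Z] :: real^5^5))"

definition interior :: "vec5 \<Rightarrow> form3 \<Rightarrow> form2" where
  "interior X \<alpha> = (\<lambda>Y Z. \<alpha> X Y Z)"

definition Lam1 :: "form1 set" where
  "Lam1 = {\<alpha>. linear \<alpha>}"

definition Lam2 :: "form2 set" where
  "Lam2 = {\<alpha>. bilinear \<alpha> \<and> (\<forall>X Y. \<alpha> X Y = - \<alpha> Y X)}"

definition Lam1_1 :: "form1 set" where
  "Lam1_1 = {\<alpha>. \<exists>t. \<alpha> = (\<lambda>X. t * eta0 X)}"

definition Lam1_2 :: "form1 set" where
  "Lam1_2 = {\<alpha> \<in> Lam1. \<alpha> xi0 = 0}"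

definition Lam2_1 :: "form2 set" where
  "Lam2_1 = {\<alpha>. \<exists>t. \<alpha> = (\<lambda>X Y. t * Phi0 X Y)}"

definition Lam2_2 :: "form2 set" where
  "Lam2_2 = {\<alpha> \<in> Lam2. wedge22 Phi0 \<alpha> = 0 \<and> hodge2 \<alpha> = wedge12 eta0 \<alpha>}"

definition Lam2_3 :: "form2 set" where
  "Lam2_3 = {\<alpha> \<in> Lam2. hodge2 \<alpha> = - wedge12 eta0 \<alpha>}"

definition Lam2_4 :: "form2 set" where
  "Lam2_4 = {\<alpha> \<in> Lam2. wedge12 eta0 \<alpha> = 0}"

definition Lam3_1 :: "form3 set" where "Lam3_1 = hodge2 ` Lam2_1"
definition Lam3_2 :: "form3 set" where "Lam3_2 = hodge2 ` Lam2_2"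
definition Lam3_3 :: "form3 set" where "Lam3_3 = hodge2 ` Lam2_3"
definition Lam3_4 :: "form3 set" where "Lam3_4 = hodge2 ` Lam2_4"

definition inner2 :: "form2 \<Rightarrow> form2 \<Rightarrow> real" where
  "inner2 \<alpha> \<beta> = 1/2 * (\<Sum>i\<in>UNIV. \<Sum>j\<in>UNIV. \<alpha> (bas i) (bas j) * \<beta> (bas i) (bas j))"

definition mm :: "form2 set" where
  "mm = Lam2_2 + Lam2_4"

definition pr_m :: "form2 \<Rightarrow> form2" where
  "pr_m \<alpha> = (THE \<beta>. \<beta> \<in> mm \<and> (\<forall>\<gamma>\<in>mm. inner2 (\<alpha> - \<beta>) \<gamma> = 0))"

definition AA :: "form3 set" where
  "AA = {A. (\<forall>Y Z. linear (\<lambda>X. A X Y Z)) \<and> (\<forall>X. bilinear (A X)) \<and>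
            (\<forall>X Y Z. A X Y Z + A X Z Y = 0)}"

definition contr :: "form3 \<Rightarrow> form1" where
  "contr A X = (\<Sum>i\<in>UNIV. A (bas i) (bas i) X)"

definition contr_phi :: "form3 \<Rightarrow> form1" where
  "contr_phi A X = (\<Sum>i\<in>UNIV. A (bas i) (phi0 (bas i)) X)"

definition AA3 :: "form3 set" where
  "AA3 = {A \<in> AA. (\<forall>X Y Z. A X Y Z + A Y Z X + A Z X Y = 0) \<and> (\<forall>X. contr A X = 0)}"

text \<open>The linear map that sends \<open>\<alpha> \<otimes> \<beta>\<close> to
  \<open>\<alpha> \<otimes> pr_m \<beta>\<close>: the first slot is a parameter.\<close>

definition pr_W :: "form3 \<Rightarrow> form3" where
  "pr_W A = (\<lambda>X. pr_m (A X))"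

definition theta1 :: "form1 \<Rightarrow> form3" where
  "theta1 \<alpha> X Y Z = \<alpha> Z * (X \<bullet> Y) - \<alpha> Y * (X \<bullet> Z)"

definition theta2 :: "form3 \<Rightarrow> form3" where
  "theta2 \<alpha> X Y Z = (\<Sum>i\<in>UNIV. (bas i \<bullet> X) * interior (bas i) \<alpha> Y Z)"

definition theta3 :: "form2 \<Rightarrow> form3" where
  "theta3 \<alpha> X Y Z = 3 * eta0 X * \<alpha> Y Z - theta2 (wedge12 eta0 \<alpha>) X Y Z"

definition WW :: "nat \<Rightarrow> form3 set" where
  "WW i =
    (if i = 1 then theta1 ` Lam1_1
     else if i = 2 then pr_W ` theta1 ` Lam1_2
     else if i = 3 then pr_W ` theta2 ` Lam3_1
     else if i = 4 then theta2 ` Lam3_2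
     else if i = 5 then pr_W ` theta2 ` Lam3_3
     else if i = 6 then pr_W ` theta2 ` Lam3_4
     else if i = 7 then theta3 ` Lam2_2
     else if i = 8 then
       {A \<in> AA3. \<forall>X Y Z. A X Y Z = A (phi0 X) Y (phi0 Z) + A (phi0 X) (phi0 Y) Z}
     else if i = 9 then
       {A \<in> AA3. \<forall>X Y Z. A X Y Z = - A X (phi0 Y) (phi0 Z)}
     else if i = 10 then
       {A \<in> AA3. \<forall>X Y Z. A X Y Z = - A (phi0 X) Y (phi0 Z) - A (phi0 X) (phi0 Y) Z}
     else {0})"

text \<open>Component of \<open>A\<close> in \<open>WW i\<close> with respect to the direct sum
  decomposition \<open>WW 1 \<oplus> \<dots> \<oplus> WW 10\<close>.\<close>

definition W_comp :: "nat \<Rightarrow> form3 \<Rightarrow> form3" where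
  "W_comp i A = (THE B. \<exists>F. (\<forall>j\<in>{1..10}. F j \<in> WW j) \<and> A = (\<Sum>j=1..10. F j) \<and> B = F i)"

definition CC_all :: "form3 set" where
  "CC_all = {A \<in> AA. \<forall>X Y Z.
     A X Y Z = - A X (phi0 Y) (phi0 Z) + eta0 Y * A X xi0 Z + eta0 Z * A X Y xi0}"

text \<open>The Chinea-Gonzalez classes; \<open>CC 1\<close> and \<open>CC 3\<close> do not occur in dimension
  five.\<close>

definition CC :: "nat \<Rightarrow> form3 set" where
  "CC i =
    (if i = 2 then {A \<in> CC_all.
       (\<forall>X Y Z. A X Y Z + A Y Z X + A Z X Y = 0) \<and> (\<forall>X Y. A X Y xi0 = 0)}
     else if i = 4 then {A \<in> CC_all.
       (\<forall>X Y Z. A X Y Z = 1/2 *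
          ((X \<bullet> Y - eta0 X * eta0 Y) * contr A Z - (X \<bullet> Z - eta0 X * eta0 Z) * contr A Y
           - (X \<bullet> phi0 Y) * contr A (phi0 Z) + (X \<bullet> phi0 Z) * contr A (phi0 Y))) \<and>
       contr A xi0 = 0}
     else if i = 5 then {A \<in> CC_all. \<forall>X Y Z.
       A X Y Z = 1/4 * contr_phi A xi0 * ((X \<bullet> phi0 Z) * eta0 Y - (X \<bullet> phi0 Y) * eta0 Z)}
     else if i = 6 then {A \<in> CC_all. \<forall>X Y Z.
       A X Y Z = 1/4 * contr A xi0 * ((X \<bullet> Y) * eta0 Z - (X \<bullet> Z) * eta0 Y)}
     else if i = 7 then {A \<in> CC_all.
       (\<forall>X Y Z. A X Y Z = eta0 Z * A Y X xi0 - eta0 Y * A (phi0 X) (phi0 Z) xi0) \<and>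
       contr A xi0 = 0}
     else if i = 8 then {A \<in> CC_all.
       (\<forall>X Y Z. A X Y Z = - eta0 Z * A Y X xi0 - eta0 Y * A (phi0 X) (phi0 Z) xi0) \<and>
       contr_phi A xi0 = 0}
     else if i = 9 then {A \<in> CC_all. \<forall>X Y Z.
       A X Y Z = eta0 Z * A Y X xi0 + eta0 Y * A (phi0 X) (phi0 Z) xi0}
     else if i = 10 then {A \<in> CC_all. \<forall>X Y Z.
       A X Y Z = - eta0 Z * A Y X xi0 + eta0 Y * A (phi0 X) (phi0 Z) xi0}
     else if i = 11 then {A \<in> CC_all. \<forall>X Y Z.
       A X Y Z = - eta0 X * A xi0 (phi0 Y) (phi0 Z)}
     else if i = 12 then {A \<in> CC_all. \<forall>X Y Z.
       A X Y Z = eta0 X * eta0 Y * A xi0 xi0 Z + eta0 X * eta0 Z * A xi0 Y xi0}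
     else {0})"

section \<open>Smooth manifolds, tensor fields and the Levi-Civita connection\<close>

primrec Ck_on :: "nat \<Rightarrow> ('a::real_normed_vector \<Rightarrow> 'b::real_normed_vector) \<Rightarrow> 'a set \<Rightarrow> bool"
where
  "Ck_on 0 f S = continuous_on S f"
| "Ck_on (Suc k) f S =
     ((\<forall>x\<in>S. f differentiable (at x)) \<and>
      (\<forall>v. Ck_on k (\<lambda>x. frechet_derivative f (at x) v) S))"

text \<open>Only used on open sets.\<close>

definition smooth_on :: "('a::real_normed_vector \<Rightarrow> 'b::real_normed_vector) \<Rightarrow> 'a set \<Rightarrow> bool"
where
  "smooth_on f S \<longleftrightarrow> (\<forall>k. Ck_on k f S)"

text \<open>A chart is its domain together with its coordinate map.\<close>

type_synonym ('a, 'n) chart = "'a set \<times> ('a \<Rightarrow> real ^ 'n)"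

definition chart_inv :: "('a, 'n) chart \<Rightarrow> real ^ 'n \<Rightarrow> 'a" where
  "chart_inv c = inv_into (fst c) (snd c)"

definition is_chart :: "('a::topological_space, 'n::finite) chart \<Rightarrow> bool" where
  "is_chart c \<longleftrightarrow> open (fst c) \<and> open (snd c ` fst c) \<and>
     homeomorphism (fst c) (snd c ` fst c) (snd c) (chart_inv c)"

text \<open>The manifold defined by an atlas is the union of the chart domains.\<close>

definition smooth_atlas :: "('a::topological_space, 'n::finite) chart set \<Rightarrow> bool" where
  "smooth_atlas A \<longleftrightarrow> (\<forall>c\<in>A. is_chart c) \<and>
     (\<forall>c\<in>A. \<forall>d\<in>A. smooth_on (snd d \<circ> chart_inv c) (snd c ` (fst c \<inter> fst d)))"

definition manifold :: "('a, 'n) chart set \<Rightarrow> 'a set" where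
  "manifold A = (\<Union>c\<in>A. fst c)"

text \<open>Directional derivative at \<open>p\<close> of a function of the points, along the vector with
  components \<open>u\<close> in the chart \<open>c\<close>.\<close>

definition chart_deriv ::
  "('a, 'n::finite) chart \<Rightarrow> ('a \<Rightarrow> 'b::real_normed_vector) \<Rightarrow> 'a \<Rightarrow> real ^ 'n \<Rightarrow> 'b" where
  "chart_deriv c f p u = frechet_derivative (f \<circ> chart_inv c) (at (snd c p)) u"

definition jacobian ::
  "('a, 'n::finite) chart \<Rightarrow> ('a, 'n) chart \<Rightarrow> 'a \<Rightarrow> real ^ 'n ^ 'n" where
  "jacobian c d p = matrix (chart_deriv c (snd d) p)"

text \<open>
  Tensor fields are given by their components in every chart of the atlas, subject to the
  transformation law: vectors \<open>v\<close> by column vectors, 1-forms by row vectors acting as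
  \<open>v \<mapsto> a \<bullet> v\<close>, bilinear forms by matrices acting as
  \<open>(v, w) \<mapsto> v \<bullet> (B *v w)\<close>, endomorphisms by matrices acting as
  \<open>v \<mapsto> F *v v\<close>.
\<close>

type_synonym ('a, 'n) vec_comps = "('a, 'n) chart \<Rightarrow> 'a \<Rightarrow> real ^ 'n"
type_synonym ('a, 'n) mat_comps = "('a, 'n) chart \<Rightarrow> 'a \<Rightarrow> real ^ 'n ^ 'n"

definition smooth_comps ::
  "('a, 'n::finite) chart set \<Rightarrow> 'a set \<Rightarrow>
   (('a, 'n) chart \<Rightarrow> 'a \<Rightarrow> 'b::real_normed_vector) \<Rightarrow> bool" where
  "smooth_comps A W T \<longleftrightarrow> (\<forall>c\<in>A. smooth_on (T c \<circ> chart_inv c) (snd c ` (fst c \<inter> W)))"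

definition vector_field ::
  "('a, 'n::finite) chart set \<Rightarrow> 'a set \<Rightarrow> ('a, 'n) vec_comps \<Rightarrow> bool" where
  "vector_field A W X \<longleftrightarrow> smooth_comps A W X \<and>
     (\<forall>c\<in>A. \<forall>d\<in>A. \<forall>p\<in>W \<inter> fst c \<inter> fst d. X d p = jacobian c d p *v X c p)"

definition covector_field ::
  "('a, 'n::finite) chart set \<Rightarrow> 'a set \<Rightarrow> ('a, 'n) vec_comps \<Rightarrow> bool" where
  "covector_field A W a \<longleftrightarrow> smooth_comps A W a \<and>
     (\<forall>c\<in>A. \<forall>d\<in>A. \<forall>p\<in>W \<inter> fst c \<inter> fst d. a c p = transpose (jacobian c d p) *v a d p)"

definition bilinear_form_field ::
  "('a, 'n::finite) chart set \<Rightarrow> 'a set \<Rightarrow> ('a, 'n) mat_comps \<Rightarrow> bool" where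
  "bilinear_form_field A W B \<longleftrightarrow> smooth_comps A W B \<and>
     (\<forall>c\<in>A. \<forall>d\<in>A. \<forall>p\<in>W \<inter> fst c \<inter> fst d.
        B c p = transpose (jacobian c d p) ** B d p ** jacobian c d p)"

definition endomorphism_field ::
  "('a, 'n::finite) chart set \<Rightarrow> 'a set \<Rightarrow> ('a, 'n) mat_comps \<Rightarrow> bool" where
  "endomorphism_field A W F \<longleftrightarrow> smooth_comps A W F \<and>
     (\<forall>c\<in>A. \<forall>d\<in>A. \<forall>p\<in>W \<inter> fst c \<inter> fst d.
        F d p ** jacobian c d p = jacobian c d p ** F c p)"

definition riemannian_metric ::
  "('a, 'n::finite) chart set \<Rightarrow> ('a, 'n) mat_comps \<Rightarrow> bool" where
  "riemannian_metric A g \<longleftrightarrow> bilinear_form_field A (manifold A) g \<and>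
     (\<forall>c\<in>A. \<forall>p\<in>fst c. transpose (g c p) = g c p \<and>
        (\<forall>v. v \<noteq> 0 \<longrightarrow> v \<bullet> (g c p *v v) > 0))"

text \<open>Christoffel symbols \<open>\<Gamma>^k_ij\<close> of the Levi-Civita connection in the chart
  \<open>c\<close>.\<close>

definition christoffel ::
  "('a, 'n::finite) mat_comps \<Rightarrow> ('a, 'n) chart \<Rightarrow> 'a \<Rightarrow> 'n \<Rightarrow> 'n \<Rightarrow> 'n \<Rightarrow> real" where
  "christoffel g c p k i j = 1/2 * (\<Sum>l\<in>UNIV. matrix_inv (g c p) $ k $ l *
     (chart_deriv c (\<lambda>q. g c q $ j $ l) p (axis i 1)
    + chart_deriv c (\<lambda>q. g c q $ i $ l) p (axis j 1)
    - chart_deriv c (\<lambda>q. g c q $ i $ j) p (axis l 1)))"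

definition christoffel_map ::
  "('a, 'n::finite) mat_comps \<Rightarrow> ('a, 'n) chart \<Rightarrow> 'a \<Rightarrow> real ^ 'n \<Rightarrow> real ^ 'n \<Rightarrow> real ^ 'n" where
  "christoffel_map g c p u v = (\<chi> k. \<Sum>i\<in>UNIV. \<Sum>j\<in>UNIV. christoffel g c p k i j * u$i * v$j)"

text \<open>Levi-Civita covariant derivatives, in the chart \<open>c\<close> at \<open>p\<close>, of a vector
  field \<open>Y\<close> and of a field \<open>B\<close> of bilinear forms.\<close>

definition nabla_vec ::
  "('a, 'n::finite) mat_comps \<Rightarrow> ('a, 'n) chart \<Rightarrow> 'a \<Rightarrow> real ^ 'n \<Rightarrow> ('a, 'n) vec_comps \<Rightarrow> real ^ 'n"
where
  "nabla_vec g c p u Y = chart_deriv c (Y c) p u + christoffel_map g c p u (Y c p)"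

definition nabla_form ::
  "('a, 'n::finite) mat_comps \<Rightarrow> ('a, 'n) chart \<Rightarrow> 'a \<Rightarrow> ('a, 'n) mat_comps \<Rightarrow>
   real ^ 'n \<Rightarrow> real ^ 'n \<Rightarrow> real ^ 'n \<Rightarrow> real" where
  "nabla_form g c p B u v w =
     v \<bullet> (chart_deriv c (B c) p u *v w)
   - christoffel_map g c p u v \<bullet> (B c p *v w)
   - v \<bullet> (B c p *v christoffel_map g c p u w)"

section \<open>Almost contact metric 5-manifolds\<close>

record 'a acm_structure =
  charts :: "('a, 5) chart set"
  met :: "('a, 5) mat_comps"
  reeb :: "('a, 5) vec_comps"
  eta :: "('a, 5) vec_comps"
  phi :: "('a, 5) mat_comps"

definition almost_contact_metric :: "'a::topological_space acm_structure \<Rightarrow> bool" where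
  "almost_contact_metric M \<longleftrightarrow>
     smooth_atlas (charts M) \<and>
     riemannian_metric (charts M) (met M) \<and>
     vector_field (charts M) (manifold (charts M)) (reeb M) \<and>
     covector_field (charts M) (manifold (charts M)) (eta M) \<and>
     endomorphism_field (charts M) (manifold (charts M)) (phi M) \<and>
     (\<forall>c\<in>charts M. \<forall>p\<in>fst c.
        let g = (\<lambda>v w. v \<bullet> (met M c p *v w)); \<xi> = reeb M c p;
            \<eta> = (\<lambda>v. eta M c p \<bullet> v); \<phi> = (\<lambda>v. phi M c p *v v)
        in g \<xi> \<xi> = 1 \<and> (\<forall>v. \<eta> v = g v \<xi>) \<and> \<phi> \<xi> = 0 \<and>
           (\<forall>v. \<phi> (\<phi> v) = - v + \<eta> v *\<^sub>R \<xi>) \<and>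
           (\<forall>v w. g (\<phi> v) (\<phi> w) = g v w - \<eta> v * \<eta> w))"

definition fund_form :: "'a acm_structure \<Rightarrow> ('a, 5) mat_comps" where
  "fund_form M c p = met M c p ** phi M c p"

text \<open>
  Adapted local frames on an open set \<open>W\<close>. The manifold carries the orientation induced by
  its almost contact metric structure; the last two conditions on \<open>e\<close> then already force the
  frame to be oriented.
\<close>

definition adapted_frame ::
  "'a::topological_space acm_structure \<Rightarrow> 'a set \<Rightarrow> (5 \<Rightarrow> ('a, 5) vec_comps) \<Rightarrow> bool" where
  "adapted_frame M W e \<longleftrightarrow>
     open W \<and> W \<subseteq> manifold (charts M) \<and> (\<forall>i. vector_field (charts M) W (e i)) \<and>
     (\<forall>c\<in>charts M. \<forall>p\<in>W \<inter> fst c.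
        (\<forall>i j. e i c p \<bullet> (met M c p *v e j c p) = (if i = j then 1 else 0)) \<and>
        e 5 c p = reeb M c p \<and>
        (\<forall>i j. e i c p \<bullet> (fund_form M c p *v e j c p) =
           (wedge11 (\<lambda>X. X$1) (\<lambda>X. X$2) + wedge11 (\<lambda>X. X$3) (\<lambda>X. X$4)) (bas i) (bas j)))"

text \<open>The identification of the local model with the tangent space at \<open>p\<close>.\<close>

definition frame_map ::
  "(5 \<Rightarrow> ('a, 5) vec_comps) \<Rightarrow> ('a, 5) chart \<Rightarrow> 'a \<Rightarrow> vec5 \<Rightarrow> vec5" where
  "frame_map e c p X = (\<Sum>i\<in>UNIV. X$i *\<^sub>R e i c p)"

definition conn_form ::
  "'a acm_structure \<Rightarrow> (5 \<Rightarrow> ('a, 5) vec_comps) \<Rightarrow> ('a, 5) chart \<Rightarrow> 'a \<Rightarrow> 5 \<Rightarrow> 5 \<Rightarrow> form1" where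
  "conn_form M e c p i j X =
     nabla_vec (met M) c p (frame_map e c p X) (e i) \<bullet> (met M c p *v e j c p)"

text \<open>Half the sum over all pairs \<open>(i, j)\<close>, i.e. the sum over \<open>i < j\<close>, as the
  summand is symmetric in \<open>i\<close> and \<open>j\<close>.\<close>

definition conn_Omega ::
  "'a acm_structure \<Rightarrow> (5 \<Rightarrow> ('a, 5) vec_comps) \<Rightarrow> ('a, 5) chart \<Rightarrow> 'a \<Rightarrow> form3" where
  "conn_Omega M e c p X Y Z =
     1/2 * (\<Sum>i\<in>UNIV. \<Sum>j\<in>UNIV. conn_form M e c p i j X *
              wedge11 (\<lambda>V. bas i \<bullet> V) (\<lambda>V. bas j \<bullet> V) Y Z)"

definition intrinsic_torsion ::
  "'a acm_structure \<Rightarrow> (5 \<Rightarrow> ('a, 5) vec_comps) \<Rightarrow> ('a, 5) chart \<Rightarrow> 'a \<Rightarrow> form3" where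
  "intrinsic_torsion M e c p = (\<lambda>X. pr_m (conn_Omega M e c p X))"

definition nabla_Phi ::
  "'a acm_structure \<Rightarrow> (5 \<Rightarrow> ('a, 5) vec_comps) \<Rightarrow> ('a, 5) chart \<Rightarrow> 'a \<Rightarrow> form3" where
  "nabla_Phi M e c p X Y Z =
     nabla_form (met M) c p (fund_form M)
       (frame_map e c p X) (frame_map e c p Y) (frame_map e c p Z)"

text \<open>
  A pointwise condition on a section is read off in the adapted local frames. These exist around
  every point, and the subspaces involved are \<open>U(2)\<close>-invariant, so the choice of frame does
  not matter.
\<close>

definition everywhere ::
  "'a::topological_space acm_structure \<Rightarrow>
   ((5 \<Rightarrow> ('a, 5) vec_comps) \<Rightarrow> ('a, 5) chart \<Rightarrow> 'a \<Rightarrow> bool) \<Rightarrow> bool" where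
  "everywhere M Q \<longleftrightarrow>
     (\<forall>W e. adapted_frame M W e \<longrightarrow> (\<forall>c\<in>charts M. \<forall>p\<in>W \<inter> fst c. Q e c p))"

definition of_class_W :: "'a::topological_space acm_structure \<Rightarrow> nat set \<Rightarrow> bool" where
  "of_class_W M I \<longleftrightarrow> everywhere M (\<lambda>e c p. intrinsic_torsion M e c p \<in> sum WW I)"

text \<open>Strictness: no component is the zero section.\<close>

definition of_strict_class_W :: "'a::topological_space acm_structure \<Rightarrow> nat set \<Rightarrow> bool" where
  "of_strict_class_W M I \<longleftrightarrow> of_class_W M I \<and>
     (\<forall>i\<in>I. \<not> everywhere M (\<lambda>e c p. W_comp i (intrinsic_torsion M e c p) = 0))"

definition integrable_acm :: "'a::topological_space acm_structure \<Rightarrow> bool" where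
  "integrable_acm M \<longleftrightarrow> everywhere M (\<lambda>e c p. intrinsic_torsion M e c p = 0)"

definition of_class_C :: "'a::topological_space acm_structure \<Rightarrow> nat set \<Rightarrow> bool" where
  "of_class_C M I \<longleftrightarrow> everywhere M (\<lambda>e c p. nabla_Phi M e c p \<in> sum CC I)"

end

theory Submission
  imports Defs
begin

text \<open>
  The space \<open>\<W> = \<Lambda>\<^sup>1 \<otimes> \<m>\<close> of intrinsic torsions and the Chinea-Gonzalez space
  \<open>\<C>\<close> of possible \<open>\<nabla>\<Phi>\<close> coincide as subspaces of \<open>\<Lambda>\<^sup>1 \<otimes> \<Lambda>\<^sup>2\<close>. In an adapted
  frame \<open>\<Phi>\<close> has constant coefficients, so
  \<open>(\<nabla>\<Phi>)(X, Y, Z) = - (\<Omega>(X, Y, \<phi> Z) + \<Omega>(X, \<phi> Y, Z))\<close> with \<open>\<Omega>\<close> the connection form; the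
  right-hand side vanishes on \<open>\<u>(2)\<close> in the last two slots and hence depends on the
  torsion \<open>\<Gamma> = pr(\<Omega>)\<close> only. An element of \<open>\<W>\<close> is given by six vectors \<open>a, b, c, d, p, q\<close>, its
  coefficients with respect to \<open>e\<^sub>i \<and> e\<^sub>5\<close> for \<open>i = 1, \<dots>, 4\<close>, \<open>e\<^sub>1 \<and> e\<^sub>3 - e\<^sub>2 \<and> e\<^sub>4\<close> and
  \<open>e\<^sub>1 \<and> e\<^sub>4 + e\<^sub>2 \<and> e\<^sub>3\<close>, and in these terms \<open>\<Gamma> \<mapsto> \<nabla>\<Phi>\<close> is the automorphism
  \<open>(a, b, c, d, p, q) \<mapsto> (b, -a, d, -c, 2q, -2p)\<close>. Each class is cut out by linear equations
  between the entries of the six vectors, and the equivalences are comparisons of such systems. For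
  the strict classes, the components of \<open>\<Gamma>\<close> in \<open>\<W>\<^sub>4, \<W>\<^sub>7\<close> (or \<open>\<W>\<^sub>2, \<W>\<^sub>6\<close>) are read off by linear
  functionals that vanish on the other summands.
\<close>

section \<open>Coordinates on the local model\<close>

text \<open>The horizontal entries of \<open>a, b, c, d\<close> form the 4 x 4 matrix of (X, Y)
  \<mapsto> A(X, Y, \<xi>). Up to sign the automorphism inserts \<phi> in the slot Y, which
  exchanges symmetric and skew matrices among the \<phi>-invariant ones. Hence the crossing in the
  list of equivalences: as subspaces \<open>WW 1 = CC 6\<close>, \<open>WW 3 = CC 5\<close>,
  \<open>WW 5 = CC 8\<close> and \<open>WW 8 = CC 7\<close>, but \<open>CC 6\<close> is matched with
  \<open>WW 3\<close> and \<open>CC 7\<close> with \<open>WW 5\<close>. The subspaces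
  \<open>WW 6 = CC 4\<close>, \<open>WW 9 = CC 2\<close> and \<open>WW 10 = CC 9\<close> are mapped
  to themselves. The classes compared in pairs are two splittings of one space. \<open>CC 10\<close>
  and \<open>CC 11\<close> separate the blocks \<open>(a, b, c, d)\<close> and
  \<open>(p, q)\<close>, while \<open>WW 4\<close> and \<open>WW 7\<close> couple the blocks, with
  the ratios -1 and 1/2. A nonzero tensor of the sum with one block zero therefore lies in neither
  \<open>WW 4\<close> nor \<open>WW 7\<close>, so both of its components are nonzero. The same
  argument applies in \<open>WW 2 + WW 6\<close> to tensors with \<open>p = q = 0\<close>.\<close>

lemma exhaust_5: fixes x :: 5 shows "x = 1 \<or> x = 2 \<or> x = 3 \<or> x = 4 \<or> x = 5"
proof (induct x)
  case (of_int z)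
  then have "0 \<le> z" and "z < 5" by simp_all
  then have "z = 0 \<or> z = 1 \<or> z = 2 \<or> z = 3 \<or> z = 4" by presburger
  \<comment> \<open>The index \<open>5\<close> is \<open>0\<close> in this type, so
    \<open>z = 0\<close> yields the disjunct \<open>x = 5\<close>.\<close>
  then show ?case by auto
qed

lemma forall_5: "(\<forall>i::5. P i) \<longleftrightarrow> P 1 \<and> P 2 \<and> P 3 \<and> P 4 \<and> P 5"
  by (metis exhaust_5)

lemma UNIV_5: "UNIV = {1, 2, 3, 4, 5::5}"
  using exhaust_5 by auto

lemma sum_5: "sum f (UNIV::5 set) = f 1 + f 2 + f 3 + f 4 + f 5"
  unfolding UNIV_5 by (simp add: ac_simps)

lemma inner_5: "(x::vec5) \<bullet> y = x$1 * y$1 + x$2 * y$2 + x$3 * y$3 + x$4 * y$4 + x$5 * y$5"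
  by (simp add: inner_vec_def sum_5)

lemma vector_5:
  "(vector [v, w, x, y, z] :: 'a::zero^5) $ 1 = v"
  "(vector [v, w, x, y, z] :: 'a::zero^5) $ 2 = w"
  "(vector [v, w, x, y, z] :: 'a::zero^5) $ 3 = x"
  "(vector [v, w, x, y, z] :: 'a::zero^5) $ 4 = y"
  "(vector [v, w, x, y, z] :: 'a::zero^5) $ 5 = z"
  by (simp_all add: vector_def)

lemma bas_nth [simp]: "bas i $ j = (if j = i then 1 else 0)"
  by (simp add: bas_def axis_def)

lemma inner_bas [simp]: "x \<bullet> bas i = x $ i" "bas i \<bullet> x = x $ i"
  by (simp_all add: bas_def inner_axis inner_axis')

lemma vec5_expand: "(X::vec5) = (\<Sum>i\<in>UNIV. X$i *\<^sub>R bas i)"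
  by (simp add: vec_eq_iff forall_5 sum_5)

lemma xi0_nth [simp]: "xi0 $ i = (if i = 5 then 1 else 0)"
  by (simp add: xi0_def)

lemma eta0_nth: "eta0 X = X $ 5"
  by (simp add: eta0_def xi0_def)

lemma phi0_nth [simp]:
  "phi0 X $ 1 = X $ 2" "phi0 X $ 2 = - X $ 1" "phi0 X $ 3 = X $ 4" "phi0 X $ 4 = - X $ 3"
  "phi0 X $ 5 = 0"
  by (simp_all add: phi0_def)

lemma Lam2D:
  assumes "\<alpha> \<in> Lam2"
  shows "\<And>Y. linear (\<alpha> Y)" "\<And>Z. linear (\<lambda>Y. \<alpha> Y Z)" "\<And>Y Z. \<alpha> Y Z = - \<alpha> Z Y" "\<And>Y. \<alpha> Y Y = 0"
proof -
  show a: "\<And>Y Z. \<alpha> Y Z = - \<alpha> Z Y" using assms unfolding Lam2_def by blast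
  show "\<And>Y. linear (\<alpha> Y)" "\<And>Z. linear (\<lambda>Y. \<alpha> Y Z)"
    using assms unfolding Lam2_def bilinear_def by blast+
  show "\<alpha> Y Y = 0" for Y using a[of Y Y] by simp
qed

lemma linear_expand:
  fixes f :: "vec5 \<Rightarrow> real"
  assumes "linear f"
  shows "f X = X$1 * f (bas 1) + X$2 * f (bas 2) + X$3 * f (bas 3) + X$4 * f (bas 4) + X$5 * f (bas 5)"
proof -
  have "f X = f (\<Sum>i\<in>UNIV. X$i *\<^sub>R bas i)" by (rule arg_cong[OF vec5_expand])
  also have "\<dots> = (\<Sum>i\<in>UNIV. X$i * f (bas i))"
    using assms by (simp add: linear_sum linear_cmul)
  finally show ?thesis by (simp add: sum_5)
qed

lemma Lam2_expand:
  assumes "\<alpha> \<in> Lam2"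
  shows "\<alpha> Y Z = \<alpha> (bas 1) (bas 2) * (Y$1 * Z$2 - Y$2 * Z$1) + \<alpha> (bas 1) (bas 3) * (Y$1 * Z$3 - Y$3 * Z$1)
    + \<alpha> (bas 1) (bas 4) * (Y$1 * Z$4 - Y$4 * Z$1) + \<alpha> (bas 1) (bas 5) * (Y$1 * Z$5 - Y$5 * Z$1)
    + \<alpha> (bas 2) (bas 3) * (Y$2 * Z$3 - Y$3 * Z$2) + \<alpha> (bas 2) (bas 4) * (Y$2 * Z$4 - Y$4 * Z$2)
    + \<alpha> (bas 2) (bas 5) * (Y$2 * Z$5 - Y$5 * Z$2) + \<alpha> (bas 3) (bas 4) * (Y$3 * Z$4 - Y$4 * Z$3)
    + \<alpha> (bas 3) (bas 5) * (Y$3 * Z$5 - Y$5 * Z$3) + \<alpha> (bas 4) (bas 5) * (Y$4 * Z$5 - Y$5 * Z$4)"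
proof -
  note a = Lam2D[OF assms]
  have s: "\<alpha> (bas 2) (bas 1) = - \<alpha> (bas 1) (bas 2)" "\<alpha> (bas 3) (bas 1) = - \<alpha> (bas 1) (bas 3)"
    "\<alpha> (bas 4) (bas 1) = - \<alpha> (bas 1) (bas 4)" "\<alpha> (bas 5) (bas 1) = - \<alpha> (bas 1) (bas 5)"
    "\<alpha> (bas 3) (bas 2) = - \<alpha> (bas 2) (bas 3)" "\<alpha> (bas 4) (bas 2) = - \<alpha> (bas 2) (bas 4)"
    "\<alpha> (bas 5) (bas 2) = - \<alpha> (bas 2) (bas 5)" "\<alpha> (bas 4) (bas 3) = - \<alpha> (bas 3) (bas 4)"
    "\<alpha> (bas 5) (bas 3) = - \<alpha> (bas 3) (bas 5)" "\<alpha> (bas 5) (bas 4) = - \<alpha> (bas 4) (bas 5)"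
    by (rule a(3))+
  have "\<alpha> Y Z = Y$1 * \<alpha> (bas 1) Z + Y$2 * \<alpha> (bas 2) Z + Y$3 * \<alpha> (bas 3) Z + Y$4 * \<alpha> (bas 4) Z + Y$5 * \<alpha> (bas 5) Z"
    using linear_expand[OF a(2)[of Z], of Y] .
  moreover have "\<alpha> (bas i) Z = Z$1 * \<alpha> (bas i) (bas 1) + Z$2 * \<alpha> (bas i) (bas 2) + Z$3 * \<alpha> (bas i) (bas 3)
      + Z$4 * \<alpha> (bas i) (bas 4) + Z$5 * \<alpha> (bas i) (bas 5)" for i
    using linear_expand[OF a(1)[of "bas i"], of Z] .
  ultimately have "\<alpha> Y Z =
      Y$1 * (Z$1 * 0 + Z$2 * \<alpha> (bas 1) (bas 2) + Z$3 * \<alpha> (bas 1) (bas 3) + Z$4 * \<alpha> (bas 1) (bas 4) + Z$5 * \<alpha> (bas 1) (bas 5))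
    + Y$2 * (Z$1 * - \<alpha> (bas 1) (bas 2) + Z$2 * 0 + Z$3 * \<alpha> (bas 2) (bas 3) + Z$4 * \<alpha> (bas 2) (bas 4) + Z$5 * \<alpha> (bas 2) (bas 5))
    + Y$3 * (Z$1 * - \<alpha> (bas 1) (bas 3) + Z$2 * - \<alpha> (bas 2) (bas 3) + Z$3 * 0 + Z$4 * \<alpha> (bas 3) (bas 4) + Z$5 * \<alpha> (bas 3) (bas 5))
    + Y$4 * (Z$1 * - \<alpha> (bas 1) (bas 4) + Z$2 * - \<alpha> (bas 2) (bas 4) + Z$3 * - \<alpha> (bas 3) (bas 4) + Z$4 * 0 + Z$5 * \<alpha> (bas 4) (bas 5))
    + Y$5 * (Z$1 * - \<alpha> (bas 1) (bas 5) + Z$2 * - \<alpha> (bas 2) (bas 5) + Z$3 * - \<alpha> (bas 3) (bas 5) + Z$4 * - \<alpha> (bas 4) (bas 5) + Z$5 * 0)"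
    by (simp only: s a(4))
  then show ?thesis
    by (rule trans) (simp add: algebra_simps)
qed

lemma Lam2_eqI:
  assumes "\<alpha> \<in> Lam2" "\<beta> \<in> Lam2"
    "\<alpha> (bas 1) (bas 2) = \<beta> (bas 1) (bas 2)" "\<alpha> (bas 1) (bas 3) = \<beta> (bas 1) (bas 3)"
    "\<alpha> (bas 1) (bas 4) = \<beta> (bas 1) (bas 4)" "\<alpha> (bas 1) (bas 5) = \<beta> (bas 1) (bas 5)"
    "\<alpha> (bas 2) (bas 3) = \<beta> (bas 2) (bas 3)" "\<alpha> (bas 2) (bas 4) = \<beta> (bas 2) (bas 4)"
    "\<alpha> (bas 2) (bas 5) = \<beta> (bas 2) (bas 5)" "\<alpha> (bas 3) (bas 4) = \<beta> (bas 3) (bas 4)"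
    "\<alpha> (bas 3) (bas 5) = \<beta> (bas 3) (bas 5)" "\<alpha> (bas 4) (bas 5) = \<beta> (bas 4) (bas 5)"
  shows "\<alpha> = \<beta>"
proof (intro ext)
  fix Y Z
  show "\<alpha> Y Z = \<beta> Y Z"
    unfolding Lam2_expand[OF assms(1), of Y Z] Lam2_expand[OF assms(2), of Y Z] assms(3-) by (rule refl)
qed

text \<open>The terms in \<open>a, b, c, d\<close> span \<open>Lam2_4\<close>, those in
  \<open>p, q\<close> span \<open>Lam2_2\<close>.\<close>

definition m_form :: "real \<Rightarrow> real \<Rightarrow> real \<Rightarrow> real \<Rightarrow> real \<Rightarrow> real \<Rightarrow> form2" where
  "m_form a b c d p q Y Z =
     a * (Y$1 * Z$5 - Y$5 * Z$1) + b * (Y$2 * Z$5 - Y$5 * Z$2) + c * (Y$3 * Z$5 - Y$5 * Z$3)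
   + d * (Y$4 * Z$5 - Y$5 * Z$4) + p * (Y$1 * Z$3 - Y$3 * Z$1 - Y$2 * Z$4 + Y$4 * Z$2)
   + q * (Y$1 * Z$4 - Y$4 * Z$1 + Y$2 * Z$3 - Y$3 * Z$2)"

text \<open>For \<open>A = W_form a b c d p q\<close> the entries with index i of the six vectors
  are the values of A(e_i, ., .) at the pairs (e1, e5), (e2, e5), (e3, e5), (e4, e5), (e1, e3), (e1,
  e4). All linear systems below are to be read this way.\<close>

definition W_form :: "vec5 \<Rightarrow> vec5 \<Rightarrow> vec5 \<Rightarrow> vec5 \<Rightarrow> vec5 \<Rightarrow> vec5 \<Rightarrow> form3" where
  "W_form a b c d p q X = m_form (a \<bullet> X) (b \<bullet> X) (c \<bullet> X) (d \<bullet> X) (p \<bullet> X) (q \<bullet> X)"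

lemma Lam2I:
  assumes "\<And>Y Y' Z. \<alpha> (Y + Y') Z = \<alpha> Y Z + \<alpha> Y' Z" "\<And>r Y Z. \<alpha> (r *\<^sub>R Y) Z = r * \<alpha> Y Z"
    "\<And>Y Z. \<alpha> Y Z = - \<alpha> Z Y"
  shows "\<alpha> \<in> Lam2"
proof -
  have l: "linear (\<lambda>Y. \<alpha> Y Z)" for Z
    by (rule linearI) (simp_all add: assms(1,2))
  have "linear (\<lambda>Z. \<alpha> Y Z)" for Y
  proof (rule linearI)
    fix Z Z' r
    show "\<alpha> Y (Z + Z') = \<alpha> Y Z + \<alpha> Y Z'"
      using assms(1)[of Z Z' Y] assms(3)[of Y "Z + Z'"] assms(3)[of Y Z] assms(3)[of Y Z'] by linarith
    show "\<alpha> Y (r *\<^sub>R Z) = r *\<^sub>R \<alpha> Y Z"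
      using assms(2)[of r Z Y] assms(3)[of Y "r *\<^sub>R Z"] assms(3)[of Y Z] by simp
  qed
  then show ?thesis
    unfolding Lam2_def bilinear_def using l assms(3) by blast
qed

lemma m_form_Lam2: "m_form a b c d p q \<in> Lam2"
  by (rule Lam2I) (simp_all add: m_form_def algebra_simps)

lemma Lam2_diff:
  assumes "\<alpha> \<in> Lam2" "\<beta> \<in> Lam2"
  shows "\<alpha> - \<beta> \<in> Lam2"
proof (rule Lam2I)
  show "(\<alpha> - \<beta>) Y Z = - (\<alpha> - \<beta>) Z Y" for Y Z
    using Lam2D(3)[OF assms(1), of Y Z] Lam2D(3)[OF assms(2), of Y Z] by simp
qed (simp_all add: linear_add[OF Lam2D(2)] linear_cmul[OF Lam2D(2)] assms algebra_simps)

lemma AA_Lam2: "A \<in> AA \<Longrightarrow> A X \<in> Lam2"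
  unfolding AA_def Lam2_def eq_neg_iff_add_eq_0 by blast

lemma AA_linear: "A \<in> AA \<Longrightarrow> linear (\<lambda>X. A X Y Z)"
  unfolding AA_def by auto

lemma AAI: "(\<And>Y Z. linear (\<lambda>X. A X Y Z)) \<Longrightarrow> (\<And>X. A X \<in> Lam2) \<Longrightarrow> A \<in> AA"
  unfolding AA_def Lam2_def eq_neg_iff_add_eq_0 by blast

lemma W_form_AA: "W_form a b c d p q \<in> AA"
proof (rule AAI)
  show "W_form a b c d p q X \<in> Lam2" for X by (simp add: W_form_def m_form_Lam2)
  show "linear (\<lambda>X. W_form a b c d p q X Y Z)" for Y Z
    by (rule linearI) (simp_all add: W_form_def m_form_def algebra_simps)
qed

section \<open>The Hodge operator\<close>

text \<open>The determinant is used as an alternating form through \<open>vol5_swap\<close>,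
  \<open>vol5_linear\<close> and \<open>vol5_bas\<close>; its 120 permutations are never
  enumerated.\<close>

definition vol5 :: "vec5 \<Rightarrow> vec5 \<Rightarrow> vec5 \<Rightarrow> vec5 \<Rightarrow> vec5 \<Rightarrow> real" where
  "vol5 u v X Y Z = det (vector [u, v, X, Y, Z] :: real^5^5)"

lemma vol5_permute:
  assumes "\<forall>i. (vector [u', v', X', Y', Z'] :: real^5^5) $ i = vector [u, v, X, Y, Z] $ Transposition.transpose m n i"
    and "m \<noteq> n"
  shows "vol5 u' v' X' Y' Z' = - vol5 u v X Y Z"
proof -
  have "(vector [u', v', X', Y', Z'] :: real^5^5) = (\<chi> i. vector [u, v, X, Y, Z] $ Transposition.transpose m n i)"
    using assms(1) by (simp add: vec_eq_iff)
  moreover have "Transposition.transpose m n permutes (UNIV :: 5 set)" by (simp add: permutes_swap_id)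
  ultimately show ?thesis
    using assms(2) by (simp add: vol5_def det_permute_rows sign_swap_id)
qed

lemma vol5_swap:
  "vol5 v u X Y Z = - vol5 u v X Y Z" "vol5 u X v Y Z = - vol5 u v X Y Z"
  "vol5 u v Y X Z = - vol5 u v X Y Z" "vol5 u v X Z Y = - vol5 u v X Y Z"
proof -
  show "vol5 v u X Y Z = - vol5 u v X Y Z"
    by (rule vol5_permute[where m = 1 and n = 2], unfold forall_5)
      (simp_all add: Transposition.transpose_def vector_5)
  show "vol5 u X v Y Z = - vol5 u v X Y Z"
    by (rule vol5_permute[where m = 2 and n = 3], unfold forall_5)
      (simp_all add: Transposition.transpose_def vector_5)
  show "vol5 u v Y X Z = - vol5 u v X Y Z"
    by (rule vol5_permute[where m = 3 and n = 4], unfold forall_5)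
      (simp_all add: Transposition.transpose_def vector_5)
  show "vol5 u v X Z Y = - vol5 u v X Y Z"
    by (rule vol5_permute[where m = 4 and n = 5], unfold forall_5)
      (simp_all add: Transposition.transpose_def vector_5)
qed

lemma vol5_linear: "linear (\<lambda>X. vol5 u v X Y Z)"
proof -
  have UNIV_prod: "prod f (UNIV::5 set) = f 1 * f 2 * f 3 * f 4 * f 5" for f :: "5 \<Rightarrow> real"
    unfolding UNIV_5 by (simp add: ac_simps)
  show ?thesis
    by (rule linearI) (simp_all add: vol5_def det_def UNIV_prod vector_5 algebra_simps sum.distrib sum_distrib_left)
qed

lemma vol5_bas: "vol5 (bas 1) (bas 2) (bas 3) (bas 4) (bas 5) = 1"
proof -
  have "(vector [bas 1, bas 2, bas 3, bas 4, bas 5] :: real^5^5) = mat 1"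
    by (simp add: vec_eq_iff forall_5 vector_5 mat_def)
  then show ?thesis by (simp add: vol5_def)
qed

lemma hodge2_vol5:
  "hodge2 \<alpha> X Y Z = 1/2 * (\<Sum>i\<in>UNIV. \<Sum>j\<in>UNIV. \<alpha> (bas i) (bas j) * vol5 (bas i) (bas j) X Y Z)"
  by (simp add: hodge2_def vol5_def)

lemma hodge2_swap:
  "hodge2 \<alpha> Y X Z = - hodge2 \<alpha> X Y Z" "hodge2 \<alpha> X Z Y = - hodge2 \<alpha> X Y Z"
  unfolding hodge2_vol5 vol5_swap(3)[of _ _ Y X Z] vol5_swap(4)[of _ _ X Z Y]
  by (simp_all add: sum_negf)

lemma hodge2_linear: "linear (\<lambda>X. hodge2 \<alpha> X Y Z)"
  unfolding hodge2_vol5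
  by (rule linearI)
    (simp_all add: linear_add[OF vol5_linear] linear_cmul[OF vol5_linear] distrib_left sum.distrib
      sum_distrib_left mult.left_commute)

text \<open>Skew symmetry under exchange of neighbours carries linearity from the first slot to the
  others.\<close>

lemma alternating3_AA:
  assumes "\<And>Y Z. linear (\<lambda>X. \<omega> X Y Z)"
    and "\<And>X Y Z. \<omega> Y X Z = - \<omega> X Y Z" "\<And>X Y Z. \<omega> X Z Y = - \<omega> X Y Z"
  shows "\<omega> \<in> AA"
proof (rule AAI)
  show "\<omega> X \<in> Lam2" for X
  proof (rule Lam2I)
    show "\<omega> X (Y + Y') Z = \<omega> X Y Z + \<omega> X Y' Z" for Y Y' Z
      using linear_add[OF assms(1), of Y Y' X Z] assms(2)[of "Y + Y'" X Z] assms(2)[of Y X Z]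
        assms(2)[of Y' X Z] by linarith
    show "\<omega> X (r *\<^sub>R Y) Z = r * \<omega> X Y Z" for r Y Z
      using linear_cmul[OF assms(1), of r Y X Z] assms(2)[of "r *\<^sub>R Y" X Z] assms(2)[of Y X Z] by simp
    show "\<omega> X Y Z = - \<omega> X Z Y" for Y Z by (rule assms(3))
  qed
qed (rule assms(1))

lemma hodge2_AA: "hodge2 \<alpha> \<in> AA"
  by (rule alternating3_AA) (rule hodge2_linear hodge2_swap)+

text \<open>\<open>D X Y Z i j k\<close> is the 3 x 3 minor of the rows X, Y, Z in the columns i, j,
  k. The first slot is expanded by linearity, the remaining 2-forms by
  \<open>Lam2_expand\<close>.\<close>

lemma alternating3_expand:
  assumes "\<And>Y Z. linear (\<lambda>X. \<omega> X Y Z)"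
    and swap: "\<And>X Y Z. \<omega> Y X Z = - \<omega> X Y Z" "\<And>X Y Z. \<omega> X Z Y = - \<omega> X Y Z"
  defines "D \<equiv> \<lambda>X Y Z i j k. X$i * (Y$j * Z$k - Y$k * Z$j) - X$j * (Y$i * Z$k - Y$k * Z$i)
    + X$k * (Y$i * Z$j - Y$j * (Z$i :: real))"
  shows "\<omega> X Y Z = \<omega> (bas 1) (bas 2) (bas 3) * D X Y Z 1 2 3 + \<omega> (bas 1) (bas 2) (bas 4) * D X Y Z 1 2 4
    + \<omega> (bas 1) (bas 2) (bas 5) * D X Y Z 1 2 5 + \<omega> (bas 1) (bas 3) (bas 4) * D X Y Z 1 3 4
    + \<omega> (bas 1) (bas 3) (bas 5) * D X Y Z 1 3 5 + \<omega> (bas 1) (bas 4) (bas 5) * D X Y Z 1 4 5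
    + \<omega> (bas 2) (bas 3) (bas 4) * D X Y Z 2 3 4 + \<omega> (bas 2) (bas 3) (bas 5) * D X Y Z 2 3 5
    + \<omega> (bas 2) (bas 4) (bas 5) * D X Y Z 2 4 5 + \<omega> (bas 3) (bas 4) (bas 5) * D X Y Z 3 4 5"
proof -
  have "\<omega> \<in> AA" by (rule alternating3_AA) (rule assms)+
  then have L: "\<omega> X \<in> Lam2" for X by (rule AA_Lam2)
  have 0: "\<omega> X X Z = 0" "\<omega> X Z X = 0" for X Z
    using swap(1)[of X X Z] swap(1)[of Z X X] swap(2)[of X X Z] by auto
  have s: "\<omega> (bas j) (bas i) Z = - \<omega> (bas i) (bas j) Z"
    "\<omega> (bas i) (bas k) (bas j) = - \<omega> (bas i) (bas j) (bas k)" for i j k Z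
    by (rule swap)+
  have X: "\<omega> X Y Z = X$1 * \<omega> (bas 1) Y Z + X$2 * \<omega> (bas 2) Y Z + X$3 * \<omega> (bas 3) Y Z
      + X$4 * \<omega> (bas 4) Y Z + X$5 * \<omega> (bas 5) Y Z"
    using linear_expand[OF assms(1), of X Y Z] .
  show ?thesis
    unfolding X Lam2_expand[OF L, of "bas 1" Y Z] Lam2_expand[OF L, of "bas 2" Y Z]
      Lam2_expand[OF L, of "bas 3" Y Z] Lam2_expand[OF L, of "bas 4" Y Z] Lam2_expand[OF L, of "bas 5" Y Z]
      0 s(1)[of 2 1] s(1)[of 3 1] s(1)[of 4 1] s(1)[of 5 1] s(1)[of 3 2] s(1)[of 4 2] s(1)[of 5 2]
      s(1)[of 4 3] s(1)[of 5 3] s(1)[of 5 4]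
      s(2)[of 1 3 2] s(2)[of 1 4 2] s(2)[of 1 5 2] s(2)[of 1 4 3] s(2)[of 1 5 3] s(2)[of 1 5 4]
      s(2)[of 2 4 3] s(2)[of 2 5 3] s(2)[of 2 5 4] s(2)[of 3 5 4] D_def
    by algebra
qed

text \<open>In the double sum only the two orders of the pair complementary to the three arguments
  survive. They contribute equally, which absorbs the factor 1/2.\<close>

lemma hodge2_bas:
  assumes "\<alpha> \<in> Lam2"
  shows "hodge2 \<alpha> (bas 1) (bas 2) (bas 3) = \<alpha> (bas 4) (bas 5)"
    "hodge2 \<alpha> (bas 1) (bas 2) (bas 4) = - \<alpha> (bas 3) (bas 5)"
    "hodge2 \<alpha> (bas 1) (bas 2) (bas 5) = \<alpha> (bas 3) (bas 4)"
    "hodge2 \<alpha> (bas 1) (bas 3) (bas 4) = \<alpha> (bas 2) (bas 5)"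
    "hodge2 \<alpha> (bas 1) (bas 3) (bas 5) = - \<alpha> (bas 2) (bas 4)"
    "hodge2 \<alpha> (bas 1) (bas 4) (bas 5) = \<alpha> (bas 2) (bas 3)"
    "hodge2 \<alpha> (bas 2) (bas 3) (bas 4) = - \<alpha> (bas 1) (bas 5)"
    "hodge2 \<alpha> (bas 2) (bas 3) (bas 5) = \<alpha> (bas 1) (bas 4)"
    "hodge2 \<alpha> (bas 2) (bas 4) (bas 5) = - \<alpha> (bas 1) (bas 3)"
    "hodge2 \<alpha> (bas 3) (bas 4) (bas 5) = \<alpha> (bas 1) (bas 2)"
proof -
  \<comment> \<open>As \<open>5\<close> is \<open>0\<close> in the index type, \<open>pos\<close>
    supplies the order 1 < 2 < 3 < 4 < 5 by which the rules \<open>sort\<close> decide on a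
    swap.\<close>
  define pos :: "5 \<Rightarrow> nat" where
    "pos i = (if i = 1 then 1 else if i = 2 then 2 else if i = 3 then 3 else if i = 4 then 4 else 5)" for i
  have p: "pos 1 = 1" "pos 2 = 2" "pos 3 = 3" "pos 4 = 4" "pos 5 = 5" by (simp_all add: pos_def)
  define V where "V i j k l m = vol5 (bas i) (bas j) (bas k) (bas l) (bas m)" for i j k l m
  \<comment> \<open>Conditional rewriting with \<open>sort\<close> is a bubble sort of the five arguments.\<close>
  have sort: "pos i < pos j \<Longrightarrow> V j i k l m = - V i j k l m" "pos j < pos k \<Longrightarrow> V i k j l m = - V i j k l m"
    "pos k < pos l \<Longrightarrow> V i j l k m = - V i j k l m" "pos l < pos m \<Longrightarrow> V i j k m l = - V i j k l m" for i j k l m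
    unfolding V_def by (rule vol5_swap)+
  have zero: "V i i k l m = 0" "V i j j l m = 0" "V i j k k m = 0" "V i j k l l = 0" for i j k l m
    using vol5_swap(1)[of "bas i" "bas i"] vol5_swap(2)[of _ "bas j" "bas j"]
      vol5_swap(3)[of _ _ "bas k" "bas k"] vol5_swap(4)[of _ _ _ "bas l" "bas l"]
    by (simp_all add: V_def)
  have one: "V 1 2 3 4 5 = 1" by (simp add: V_def vol5_bas)
  note a = Lam2D(3)[OF assms]
  have s: "\<alpha> (bas 2) (bas 1) = - \<alpha> (bas 1) (bas 2)" "\<alpha> (bas 3) (bas 1) = - \<alpha> (bas 1) (bas 3)"
    "\<alpha> (bas 4) (bas 1) = - \<alpha> (bas 1) (bas 4)" "\<alpha> (bas 5) (bas 1) = - \<alpha> (bas 1) (bas 5)"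
    "\<alpha> (bas 3) (bas 2) = - \<alpha> (bas 2) (bas 3)" "\<alpha> (bas 4) (bas 2) = - \<alpha> (bas 2) (bas 4)"
    "\<alpha> (bas 5) (bas 2) = - \<alpha> (bas 2) (bas 5)" "\<alpha> (bas 4) (bas 3) = - \<alpha> (bas 3) (bas 4)"
    "\<alpha> (bas 5) (bas 3) = - \<alpha> (bas 3) (bas 5)" "\<alpha> (bas 5) (bas 4) = - \<alpha> (bas 4) (bas 5)"
    by (rule a)+
  have h: "hodge2 \<alpha> (bas k) (bas l) (bas m) = 1/2 * (\<Sum>i\<in>UNIV. \<Sum>j\<in>UNIV. \<alpha> (bas i) (bas j) * V i j k l m)" for k l m
    by (simp add: hodge2_vol5 V_def)
  show "hodge2 \<alpha> (bas 1) (bas 2) (bas 3) = \<alpha> (bas 4) (bas 5)"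
    "hodge2 \<alpha> (bas 1) (bas 2) (bas 4) = - \<alpha> (bas 3) (bas 5)"
    "hodge2 \<alpha> (bas 1) (bas 2) (bas 5) = \<alpha> (bas 3) (bas 4)"
    "hodge2 \<alpha> (bas 1) (bas 3) (bas 4) = \<alpha> (bas 2) (bas 5)"
    "hodge2 \<alpha> (bas 1) (bas 3) (bas 5) = - \<alpha> (bas 2) (bas 4)"
    "hodge2 \<alpha> (bas 1) (bas 4) (bas 5) = \<alpha> (bas 2) (bas 3)"
    "hodge2 \<alpha> (bas 2) (bas 3) (bas 4) = - \<alpha> (bas 1) (bas 5)"
    "hodge2 \<alpha> (bas 2) (bas 3) (bas 5) = \<alpha> (bas 1) (bas 4)"
    "hodge2 \<alpha> (bas 2) (bas 4) (bas 5) = - \<alpha> (bas 1) (bas 3)"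
    "hodge2 \<alpha> (bas 3) (bas 4) (bas 5) = \<alpha> (bas 1) (bas 2)"
    by (simp_all add: h sum_5 s sort zero one p)
qed

lemma alternating3_eqI:
  fixes \<omega> \<tau> :: form3
  assumes "\<And>Y Z. linear (\<lambda>X. \<omega> X Y Z)" "\<And>X Y Z. \<omega> Y X Z = - \<omega> X Y Z" "\<And>X Y Z. \<omega> X Z Y = - \<omega> X Y Z"
    "\<And>Y Z. linear (\<lambda>X. \<tau> X Y Z)" "\<And>X Y Z. \<tau> Y X Z = - \<tau> X Y Z" "\<And>X Y Z. \<tau> X Z Y = - \<tau> X Y Z"
    "\<omega> (bas 1) (bas 2) (bas 3) = \<tau> (bas 1) (bas 2) (bas 3)" "\<omega> (bas 1) (bas 2) (bas 4) = \<tau> (bas 1) (bas 2) (bas 4)"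
    "\<omega> (bas 1) (bas 2) (bas 5) = \<tau> (bas 1) (bas 2) (bas 5)" "\<omega> (bas 1) (bas 3) (bas 4) = \<tau> (bas 1) (bas 3) (bas 4)"
    "\<omega> (bas 1) (bas 3) (bas 5) = \<tau> (bas 1) (bas 3) (bas 5)" "\<omega> (bas 1) (bas 4) (bas 5) = \<tau> (bas 1) (bas 4) (bas 5)"
    "\<omega> (bas 2) (bas 3) (bas 4) = \<tau> (bas 2) (bas 3) (bas 4)" "\<omega> (bas 2) (bas 3) (bas 5) = \<tau> (bas 2) (bas 3) (bas 5)"
    "\<omega> (bas 2) (bas 4) (bas 5) = \<tau> (bas 2) (bas 4) (bas 5)" "\<omega> (bas 3) (bas 4) (bas 5) = \<tau> (bas 3) (bas 4) (bas 5)"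
  shows "\<omega> = \<tau>"
proof (intro ext)
  fix X Y Z
  show "\<omega> X Y Z = \<tau> X Y Z"
    unfolding alternating3_expand[OF assms(1-3), of X Y Z] alternating3_expand[OF assms(4-6), of X Y Z] assms(7-)
    by (rule refl)
qed

section \<open>The projection to the orthogonal complement of u(2)\<close>

lemma wedge12_linear: "\<beta> \<in> Lam2 \<Longrightarrow> linear (\<lambda>X. wedge12 eta0 \<beta> X Y Z)"
  using Lam2D(1,2)[of \<beta>]
  by (intro linearI) (simp_all add: wedge12_def eta0_nth linear_add[OF Lam2D(2)] linear_cmul[OF Lam2D(2)]
    linear_add[OF Lam2D(1)] linear_cmul[OF Lam2D(1)] algebra_simps)

lemma wedge12_swap:
  assumes "\<beta> \<in> Lam2"
  shows "wedge12 \<eta> \<beta> Y X Z = - wedge12 \<eta> \<beta> X Y Z" "wedge12 \<eta> \<beta> X Z Y = - wedge12 \<eta> \<beta> X Y Z"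
  unfolding wedge12_def Lam2D(3)[OF assms, of X Z] Lam2D(3)[OF assms, of Z Y] Lam2D(3)[OF assms, of Y X]
  by simp_all

lemma wedge12_bas:
  assumes "\<alpha> \<in> Lam2"
  shows "i \<noteq> 5 \<Longrightarrow> j \<noteq> 5 \<Longrightarrow> k \<noteq> 5 \<Longrightarrow> wedge12 eta0 \<alpha> (bas i) (bas j) (bas k) = 0"
    "i \<noteq> 5 \<Longrightarrow> j \<noteq> 5 \<Longrightarrow> wedge12 eta0 \<alpha> (bas i) (bas j) (bas 5) = \<alpha> (bas i) (bas j)"
  by (simp_all add: wedge12_def eta0_nth)

lemma m_form_bas [simp]:
  "m_form a b c d p q (bas 1) (bas 2) = 0" "m_form a b c d p q (bas 1) (bas 3) = p"
  "m_form a b c d p q (bas 1) (bas 4) = q" "m_form a b c d p q (bas 1) (bas 5) = a"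
  "m_form a b c d p q (bas 2) (bas 3) = q" "m_form a b c d p q (bas 2) (bas 4) = - p"
  "m_form a b c d p q (bas 2) (bas 5) = b" "m_form a b c d p q (bas 3) (bas 4) = 0"
  "m_form a b c d p q (bas 3) (bas 5) = c" "m_form a b c d p q (bas 4) (bas 5) = d"
  by (simp_all add: m_form_def)

text \<open>The Hodge condition kills the components along \<xi>, couples the others to e1 \<and> e3
  - e2 \<and> e4 and e1 \<and> e4 + e2 \<and> e3, and makes the coefficients of e1 \<and> e2 and e3
  \<and> e4 equal. The condition \<Phi> \<and> \<alpha> = 0 makes these two opposite, so they
  vanish.\<close>

lemma Lam2_2_eq: "Lam2_2 = {m_form 0 0 0 0 p q |p q. True}"
proof (intro set_eqI iffI)
  fix \<alpha> assume *: "\<alpha> \<in> Lam2_2"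
  then have a: "\<alpha> \<in> Lam2" and w: "wedge22 Phi0 \<alpha> = 0" and h: "hodge2 \<alpha> = wedge12 eta0 \<alpha>"
    by (auto simp: Lam2_2_def)
  have "wedge22 Phi0 \<alpha> (bas 1) (bas 2) (bas 3) (bas 4) = 0" by (simp add: w)
  then have w': "\<alpha> (bas 3) (bas 4) + \<alpha> (bas 1) (bas 2) = 0"
    by (simp add: wedge22_def Phi0_def inner_5)
  have h': "hodge2 \<alpha> (bas i) (bas j) (bas k) = wedge12 eta0 \<alpha> (bas i) (bas j) (bas k)" for i j k
    by (simp add: h)
  have "\<alpha> = m_form 0 0 0 0 (\<alpha> (bas 1) (bas 3)) (\<alpha> (bas 1) (bas 4))"
    by (rule Lam2_eqI[OF a m_form_Lam2])
      (use w' h'[of 1 2 3] h'[of 1 2 4] h'[of 1 2 5] h'[of 1 3 4] h'[of 1 3 5] h'[of 1 4 5] h'[of 2 3 4]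
        in \<open>simp_all add: hodge2_bas[OF a] wedge12_bas[OF a]\<close>)
  then show "\<alpha> \<in> {m_form 0 0 0 0 p q |p q. True}" by blast
next
  fix \<alpha> assume "\<alpha> \<in> {m_form 0 0 0 0 p q |p q. True}"
  then obtain p q where \<alpha>: "\<alpha> = m_form 0 0 0 0 p q" by blast
  have a: "\<alpha> \<in> Lam2" by (simp add: \<alpha> m_form_Lam2)
  have "hodge2 \<alpha> = wedge12 eta0 \<alpha>"
    by (rule alternating3_eqI, (rule hodge2_linear hodge2_swap wedge12_linear[OF a] wedge12_swap[OF a])+)
      (simp_all add: hodge2_bas[OF a] wedge12_bas[OF a], simp_all add: \<alpha>)
  moreover have "wedge22 Phi0 \<alpha> = 0"
    by (intro ext) (simp add: \<alpha> wedge22_def Phi0_def inner_5 m_form_def algebra_simps)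
  ultimately show "\<alpha> \<in> Lam2_2" using a by (simp add: Lam2_2_def)
qed

lemma Lam2_4_eq: "Lam2_4 = {m_form a b c d 0 0 |a b c d. True}"
proof (intro set_eqI iffI)
  fix \<alpha> assume *: "\<alpha> \<in> Lam2_4"
  then have a: "\<alpha> \<in> Lam2" and h: "wedge12 eta0 \<alpha> = 0"
    by (auto simp: Lam2_4_def)
  have h': "\<alpha> (bas i) (bas j) = 0" if "i \<noteq> 5" "j \<noteq> 5" for i j
    using wedge12_bas(2)[OF a that] by (simp add: h)
  have "\<alpha> = m_form (\<alpha> (bas 1) (bas 5)) (\<alpha> (bas 2) (bas 5)) (\<alpha> (bas 3) (bas 5)) (\<alpha> (bas 4) (bas 5)) 0 0"
    by (rule Lam2_eqI[OF a m_form_Lam2]) (simp_all add: h')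
  then show "\<alpha> \<in> {m_form a b c d 0 0 |a b c d. True}" by blast
next
  fix \<alpha> assume "\<alpha> \<in> {m_form a b c d 0 0 |a b c d. True}"
  then obtain a b c d where \<alpha>: "\<alpha> = m_form a b c d 0 0" by blast
  have "wedge12 eta0 \<alpha> = 0"
    by (intro ext) (simp add: \<alpha> wedge12_def eta0_nth m_form_def algebra_simps)
  then show "\<alpha> \<in> Lam2_4" by (simp add: Lam2_4_def \<alpha> m_form_Lam2)
qed

lemma m_form_add: "m_form a b c d p q + m_form a' b' c' d' p' q' = m_form (a + a') (b + b') (c + c') (d + d') (p + p') (q + q')"
  by (intro ext) (simp add: m_form_def algebra_simps)

lemma mm_eq: "mm = {m_form a b c d p q |a b c d p q. True}"
proof (intro set_eqI iffI)
  fix \<alpha> assume "\<alpha> \<in> mm"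
  then show "\<alpha> \<in> {m_form a b c d p q |a b c d p q. True}"
    by (auto simp: mm_def Lam2_2_eq Lam2_4_eq elim!: set_plus_elim) (metis m_form_add)
next
  fix \<alpha> assume "\<alpha> \<in> {m_form a b c d p q |a b c d p q. True}"
  then obtain a b c d p q where "\<alpha> = m_form a b c d p q" by blast
  then have "\<alpha> = m_form 0 0 0 0 p q + m_form a b c d 0 0" by (simp add: m_form_add)
  moreover have "m_form 0 0 0 0 p q \<in> Lam2_2" "m_form a b c d 0 0 \<in> Lam2_4"
    by (auto simp: Lam2_2_eq Lam2_4_eq)
  ultimately show "\<alpha> \<in> mm" unfolding mm_def by blast
qed

lemma inner2_m_form:
  assumes "\<alpha> \<in> Lam2"
  shows "inner2 \<alpha> (m_form a b c d p q) = a * \<alpha> (bas 1) (bas 5) + b * \<alpha> (bas 2) (bas 5)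
    + c * \<alpha> (bas 3) (bas 5) + d * \<alpha> (bas 4) (bas 5)
    + p * (\<alpha> (bas 1) (bas 3) - \<alpha> (bas 2) (bas 4)) + q * (\<alpha> (bas 1) (bas 4) + \<alpha> (bas 2) (bas 3))"
proof -
  have s: "\<beta> (bas 2) (bas 1) = - \<beta> (bas 1) (bas 2)" "\<beta> (bas 3) (bas 1) = - \<beta> (bas 1) (bas 3)"
    "\<beta> (bas 4) (bas 1) = - \<beta> (bas 1) (bas 4)" "\<beta> (bas 5) (bas 1) = - \<beta> (bas 1) (bas 5)"
    "\<beta> (bas 3) (bas 2) = - \<beta> (bas 2) (bas 3)" "\<beta> (bas 4) (bas 2) = - \<beta> (bas 2) (bas 4)"
    "\<beta> (bas 5) (bas 2) = - \<beta> (bas 2) (bas 5)" "\<beta> (bas 4) (bas 3) = - \<beta> (bas 3) (bas 4)"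
    "\<beta> (bas 5) (bas 3) = - \<beta> (bas 3) (bas 5)" "\<beta> (bas 5) (bas 4) = - \<beta> (bas 4) (bas 5)"
    if "\<beta> \<in> Lam2" for \<beta>
    using that by (rule Lam2D(3))+
  show ?thesis
    by (simp add: inner2_def sum_5 s[OF assms] s[OF m_form_Lam2] Lam2D(4)[OF assms] algebra_simps)
qed

text \<open>The halves arise because e1 \<and> e3 - e2 \<and> e4 and e1 \<and> e4 + e2 \<and> e3
  have squared length 2, the other four basis elements of \<open>mm\<close> length 1.\<close>

lemma pr_m_eq:
  assumes "\<alpha> \<in> Lam2"
  shows "pr_m \<alpha> = m_form (\<alpha> (bas 1) (bas 5)) (\<alpha> (bas 2) (bas 5)) (\<alpha> (bas 3) (bas 5)) (\<alpha> (bas 4) (bas 5))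
    ((\<alpha> (bas 1) (bas 3) - \<alpha> (bas 2) (bas 4)) / 2) ((\<alpha> (bas 1) (bas 4) + \<alpha> (bas 2) (bas 3)) / 2)"
    (is "_ = ?\<beta>")
  unfolding pr_m_def
proof (rule the_equality)
  show "?\<beta> \<in> mm \<and> (\<forall>\<gamma>\<in>mm. inner2 (\<alpha> - ?\<beta>) \<gamma> = 0)"
  proof
    show "?\<beta> \<in> mm" unfolding mm_eq by blast
    show "\<forall>\<gamma>\<in>mm. inner2 (\<alpha> - ?\<beta>) \<gamma> = 0"
      by (auto simp: mm_eq inner2_m_form[OF Lam2_diff[OF assms m_form_Lam2]])
  qed
next
  fix \<beta> assume b: "\<beta> \<in> mm \<and> (\<forall>\<gamma>\<in>mm. inner2 (\<alpha> - \<beta>) \<gamma> = 0)"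
  then obtain a b c d p q where \<beta>: "\<beta> = m_form a b c d p q" by (auto simp: mm_eq)
  have "inner2 (\<alpha> - \<beta>) (m_form a' b' c' d' p' q') = 0" for a' b' c' d' p' q'
    using b unfolding mm_eq by blast
  then have i: "a' * (\<alpha> (bas 1) (bas 5) - a) + b' * (\<alpha> (bas 2) (bas 5) - b)
    + c' * (\<alpha> (bas 3) (bas 5) - c) + d' * (\<alpha> (bas 4) (bas 5) - d)
    + p' * (\<alpha> (bas 1) (bas 3) - \<alpha> (bas 2) (bas 4) - 2 * p) + q' * (\<alpha> (bas 1) (bas 4) + \<alpha> (bas 2) (bas 3) - 2 * q) = 0"
    for a' b' c' d' p' q'
    by (simp add: \<beta> inner2_m_form[OF Lam2_diff[OF assms m_form_Lam2]] algebra_simps)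
  \<comment> \<open>Orthogonality to each of the six basis elements of \<open>mm\<close> determines
    the six coefficients.\<close>
  show "\<beta> = ?\<beta>"
    using i[of 1 0 0 0 0 0] i[of 0 1 0 0 0 0] i[of 0 0 1 0 0 0] i[of 0 0 0 1 0 0] i[of 0 0 0 0 1 0] i[of 0 0 0 0 0 1]
    by (simp add: \<beta>)
qed

lemma AA_vec:
  assumes "A \<in> AA"
  shows "A X (bas j) (bas k) = (\<chi> i. A (bas i) (bas j) (bas k)) \<bullet> X"
  using linear_expand[OF AA_linear[OF assms], of X "bas j" "bas k"] by (simp add: inner_5 mult.commute)

lemma pr_W_eq:
  assumes "A \<in> AA"
  shows "pr_W A = W_form (\<chi> i. A (bas i) (bas 1) (bas 5)) (\<chi> i. A (bas i) (bas 2) (bas 5))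
    (\<chi> i. A (bas i) (bas 3) (bas 5)) (\<chi> i. A (bas i) (bas 4) (bas 5))
    (\<chi> i. (A (bas i) (bas 1) (bas 3) - A (bas i) (bas 2) (bas 4)) / 2)
    (\<chi> i. (A (bas i) (bas 1) (bas 4) + A (bas i) (bas 2) (bas 3)) / 2)"
proof -
  have "pr_m (A X) = W_form (\<chi> i. A (bas i) (bas 1) (bas 5)) (\<chi> i. A (bas i) (bas 2) (bas 5))
    (\<chi> i. A (bas i) (bas 3) (bas 5)) (\<chi> i. A (bas i) (bas 4) (bas 5))
    (\<chi> i. (A (bas i) (bas 1) (bas 3) - A (bas i) (bas 2) (bas 4)) / 2)
    (\<chi> i. (A (bas i) (bas 1) (bas 4) + A (bas i) (bas 2) (bas 3)) / 2) X" for X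
    unfolding pr_m_eq[OF AA_Lam2[OF assms]] W_form_def AA_vec[OF assms, of X]
    by (simp add: inner_5 add_divide_distrib diff_divide_distrib algebra_simps)
  then show ?thesis unfolding pr_W_def by (rule ext)
qed

lemma W_form_eq_iff:
  "W_form a b c d p q = W_form a' b' c' d' p' q' \<longleftrightarrow> a = a' \<and> b = b' \<and> c = c' \<and> d = d' \<and> p = p' \<and> q = q'"
proof
  assume "W_form a b c d p q = W_form a' b' c' d' p' q'"
  then have e: "W_form a b c d p q (bas i) (bas j) (bas k) = W_form a' b' c' d' p' q' (bas i) (bas j) (bas k)" for i j k
    by simp
  show "a = a' \<and> b = b' \<and> c = c' \<and> d = d' \<and> p = p' \<and> q = q'"
    using e[of _ 1 5] e[of _ 2 5] e[of _ 3 5] e[of _ 4 5] e[of _ 1 3] e[of _ 1 4]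
    by (simp add: W_form_def vec_eq_iff)
qed auto

lemma W_form_add:
  "W_form a b c d p q + W_form a' b' c' d' p' q' = W_form (a + a') (b + b') (c + c') (d + d') (p + p') (q + q')"
  by (intro ext) (simp add: W_form_def m_form_def algebra_simps)

lemma W_form_0: "W_form 0 0 0 0 0 0 = 0"
  by (intro ext) (simp add: W_form_def m_form_def)

lemma contr_W_form:
  "contr (W_form a b c d p q) X = (a$1 + b$2 + c$3 + d$4) * X$5 - a$5 * X$1 - b$5 * X$2 - c$5 * X$3 - d$5 * X$4
    + p$1 * X$3 - p$3 * X$1 - p$2 * X$4 + p$4 * X$2 + q$1 * X$4 - q$4 * X$1 + q$2 * X$3 - q$3 * X$2"
  by (simp add: contr_def sum_5 W_form_def m_form_def algebra_simps)

lemma contr_phi_W_form_xi0: "contr_phi (W_form a b c d p q) xi0 = a$2 - b$1 + c$4 - d$3"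
  by (simp add: contr_phi_def sum_5 W_form_def m_form_def)

lemma phi0_bas [simp]:
  "phi0 (bas 1) = - bas 2" "phi0 (bas 2) = bas 1" "phi0 (bas 3) = - bas 4" "phi0 (bas 4) = bas 3" "phi0 (bas 5) = 0"
  by (simp_all add: vec_eq_iff forall_5)

lemma W_form_CC_all: "W_form a b c d p q \<in> CC_all"
  unfolding CC_all_def using W_form_AA
  by (auto simp: W_form_def m_form_def eta0_nth algebra_simps)

section \<open>Equations for the classes\<close>

text \<open>The predicate variable allows a tensor identity to be instantiated by indices alone, as
  in \<open>e[of 1 2 3]\<close>.\<close>

lemma basis_instance2: "\<forall>X Y. P X Y \<Longrightarrow> P (bas i) (bas j)" by blast

lemma basis_instance3: "\<forall>X Y Z. P X Y Z \<Longrightarrow> P (bas i) (bas j) (bas k)" by blast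

lemmas W_form_eval = W_form_def m_form_def eta0_nth xi0_def contr_W_form contr_phi_W_form_xi0[unfolded xi0_def]

text \<open>Only the numeral comparisons are evaluated, so the selected branch keeps the form on
  which the later conjunct selections rely.\<close>

lemmas CC_2 = CC_def[of 2, simplified rel_simps if_True if_False]
lemmas CC_4 = CC_def[of 4, simplified rel_simps if_True if_False]
lemmas CC_5 = CC_def[of 5, simplified rel_simps if_True if_False]
lemmas CC_6 = CC_def[of 6, simplified rel_simps if_True if_False]
lemmas CC_7 = CC_def[of 7, simplified rel_simps if_True if_False]
lemmas CC_8 = CC_def[of 8, simplified rel_simps if_True if_False]
lemmas CC_9 = CC_def[of 9, simplified rel_simps if_True if_False]
lemmas CC_10 = CC_def[of 10, simplified rel_simps if_True if_False]
lemmas CC_11 = CC_def[of 11, simplified rel_simps if_True if_False]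
lemmas CC_12 = CC_def[of 12, simplified rel_simps if_True if_False]
lemmas WW_1 = WW_def[of 1, simplified rel_simps if_True if_False refl]
lemmas WW_2 = WW_def[of 2, simplified rel_simps if_True if_False refl]
lemmas WW_3 = WW_def[of 3, simplified rel_simps if_True if_False refl]
lemmas WW_4 = WW_def[of 4, simplified rel_simps if_True if_False refl]
lemmas WW_5 = WW_def[of 5, simplified rel_simps if_True if_False refl]
lemmas WW_6 = WW_def[of 6, simplified rel_simps if_True if_False refl]
lemmas WW_7 = WW_def[of 7, simplified rel_simps if_True if_False refl]
lemmas WW_8 = WW_def[of 8, simplified rel_simps if_True if_False refl]
lemmas WW_9 = WW_def[of 9, simplified rel_simps if_True if_False refl]
lemmas WW_10 = WW_def[of 10, simplified rel_simps if_True if_False refl]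

section \<open>Linear systems for the Chinea-Gonzalez classes\<close>

lemma W_form_CC_2:
  "W_form a b c d p q \<in> CC 2 \<longleftrightarrow>
    a = 0 \<and> b = 0 \<and> c = 0 \<and> d = 0 \<and> p$5 = 0 \<and> q$5 = 0 \<and> p$1 = - q$2 \<and>
    p$2 = q$1 \<and> p$3 = - q$4 \<and> p$4 = q$3"
    (is "_ \<longleftrightarrow> ?E")
proof
  assume m: "W_form a b c d p q \<in> CC 2"
  note e = basis_instance3[OF m[unfolded CC_2 mem_Collect_eq, THEN conjunct2, THEN conjunct1]]
  note f = basis_instance2[OF m[unfolded CC_2 mem_Collect_eq, THEN conjunct2, THEN conjunct2]]
  note [simp] = W_form_eval
  \<comment> \<open>The instances of \<open>f\<close> are the entries of \<open>a, b, c, d\<close>.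
    The cyclic sums over three horizontal indices give the four relations between \<open>p\<close>
    and \<open>q\<close>; those over (1, 3, 5) and (1, 4, 5) then leave \<open>p$5 = 0\<close> and
    \<open>q$5 = 0\<close>. The lists in the following proofs are likewise selections of basis
    triples that imply the whole system.\<close>
  note eqs = f[of 1 1] f[of 1 2] f[of 1 3] f[of 1 4] f[of 2 1] f[of 2 2] f[of 2 3] f[of 2 4] f[of 3 1] f[of 3 2]
    f[of 3 3] f[of 3 4] f[of 4 1] f[of 4 2] f[of 4 3] f[of 4 4] f[of 5 1] f[of 5 2] f[of 5 3] f[of 5 4]
    e[of 1 2 3] e[of 1 2 4] e[of 1 3 4] e[of 2 3 4] e[of 1 3 5] e[of 1 4 5]
  note eqs' = eqs[simplified]
  show ?E
    unfolding vec_eq_iff forall_5 zero_index by (intro conjI; use eqs' in linarith)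
next
  assume E: ?E
  show "W_form a b c d p q \<in> CC 2"
    unfolding CC_2
    by (intro CollectI conjI allI; (rule W_form_CC_all | simp add: E W_form_eval inner_5; algebra?))
qed

text \<open>The right-hand side of the defining identity depends on A through the horizontal
  covector \<open>contr A\<close> alone, which leaves four free parameters. The system is that of
  \<open>W_form_WW_6\<close>.\<close>

lemma W_form_CC_4:
  "W_form a b c d p q \<in> CC 4 \<longleftrightarrow>
    a = 0 \<and> b = 0 \<and> c = 0 \<and> d = 0 \<and> p$5 = 0 \<and> q$5 = 0 \<and> p$1 = q$2 \<and>
    p$2 = - q$1 \<and> p$3 = q$4 \<and> p$4 = - q$3"
    (is "_ \<longleftrightarrow> ?E")
proof
  assume m: "W_form a b c d p q \<in> CC 4"
  note e = basis_instance3[OF m[unfolded CC_4 mem_Collect_eq, THEN conjunct2, THEN conjunct1]]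
  note f = m[unfolded CC_4 mem_Collect_eq, THEN conjunct2, THEN conjunct2]
  note [simp] = W_form_eval
  note eqs = e[of 1 2 5] e[of 1 3 5] e[of 1 4 5] e[of 2 1 5] e[of 2 3 5] e[of 2 4 5] e[of 3 1 5] e[of 3 2 5]
    e[of 3 4 5] e[of 4 1 5] e[of 4 2 5] e[of 4 3 5] e[of 5 1 3] e[of 5 1 4] e[of 5 1 5] e[of 5 2 5]
    e[of 5 3 5] e[of 5 4 5] e[of 1 1 3] e[of 1 1 4] e[of 3 1 3] e[of 3 1 4] f e[of 1 1 5] e[of 2 2 5]
    e[of 3 3 5]
  note eqs' = eqs[simplified]
  show ?E
    unfolding vec_eq_iff forall_5 zero_index by (intro conjI; use eqs' in linarith)
next
  assume E: ?E
  show "W_form a b c d p q \<in> CC 4"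
    unfolding CC_4
    by (intro CollectI conjI allI; (rule W_form_CC_all | simp add: E W_form_eval inner_5; algebra?))
qed

text \<open>One parameter remains, and \<open>contr_phi A xi0\<close> is \<open>- 4 * d$3\<close>,
  in accordance with the factor 1/4. The system is that of \<open>W_form_WW_3\<close>.\<close>

lemma W_form_CC_5:
  "W_form a b c d p q \<in> CC 5 \<longleftrightarrow>
    a$1 = 0 \<and> a$3 = 0 \<and> a$4 = 0 \<and> a$5 = 0 \<and> b$2 = 0 \<and> b$3 = 0 \<and>
    b$4 = 0 \<and> b$5 = 0 \<and> c$1 = 0 \<and> c$2 = 0 \<and> c$3 = 0 \<and> c$5 = 0 \<and>
    d$1 = 0 \<and> d$2 = 0 \<and> d$4 = 0 \<and> d$5 = 0 \<and> p = 0 \<and> q = 0 \<and>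
    a$2 = - d$3 \<and> b$1 = d$3 \<and> c$4 = - d$3"
    (is "_ \<longleftrightarrow> ?E")
proof
  assume m: "W_form a b c d p q \<in> CC 5"
  note e = basis_instance3[OF m[unfolded CC_5 mem_Collect_eq, THEN conjunct2]]
  note [simp] = W_form_eval
  note eqs = e[of 1 1 3] e[of 1 1 4] e[of 1 1 5] e[of 1 3 5] e[of 1 4 5] e[of 2 1 3] e[of 2 1 4] e[of 2 2 5]
    e[of 2 3 5] e[of 2 4 5] e[of 3 1 3] e[of 3 1 4] e[of 3 1 5] e[of 3 2 5] e[of 3 3 5] e[of 4 1 3]
    e[of 4 1 4] e[of 4 1 5] e[of 4 2 5] e[of 4 4 5] e[of 5 1 3] e[of 5 1 4] e[of 5 1 5] e[of 5 2 5]
    e[of 5 3 5] e[of 5 4 5] e[of 1 2 5] e[of 2 1 5] e[of 3 4 5] e[of 4 3 5]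
  note eqs' = eqs[simplified]
  show ?E
    unfolding vec_eq_iff forall_5 zero_index by (intro conjI; use eqs' in linarith)
next
  assume E: ?E
  show "W_form a b c d p q \<in> CC 5"
    unfolding CC_5
    by (intro CollectI conjI allI; (rule W_form_CC_all | simp add: E W_form_eval inner_5; algebra?))
qed

text \<open>Here \<open>contr A xi0\<close> is \<open>4 * d$4\<close>. The system is that of
  \<open>W_form_WW_1\<close>.\<close>

lemma W_form_CC_6:
  "W_form a b c d p q \<in> CC 6 \<longleftrightarrow>
    a$2 = 0 \<and> a$3 = 0 \<and> a$4 = 0 \<and> a$5 = 0 \<and> b$1 = 0 \<and> b$3 = 0 \<and>
    b$4 = 0 \<and> b$5 = 0 \<and> c$1 = 0 \<and> c$2 = 0 \<and> c$4 = 0 \<and> c$5 = 0 \<and>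
    d$1 = 0 \<and> d$2 = 0 \<and> d$3 = 0 \<and> d$5 = 0 \<and> p = 0 \<and> q = 0 \<and>
    a$1 = d$4 \<and> b$2 = d$4 \<and> c$3 = d$4"
    (is "_ \<longleftrightarrow> ?E")
proof
  assume m: "W_form a b c d p q \<in> CC 6"
  note e = basis_instance3[OF m[unfolded CC_6 mem_Collect_eq, THEN conjunct2]]
  note [simp] = W_form_eval
  note eqs = e[of 1 1 3] e[of 1 1 4] e[of 1 2 5] e[of 1 3 5] e[of 1 4 5] e[of 2 1 3] e[of 2 1 4] e[of 2 1 5]
    e[of 2 3 5] e[of 2 4 5] e[of 3 1 3] e[of 3 1 4] e[of 3 1 5] e[of 3 2 5] e[of 3 4 5] e[of 4 1 3]
    e[of 4 1 4] e[of 4 1 5] e[of 4 2 5] e[of 4 3 5] e[of 5 1 3] e[of 5 1 4] e[of 5 1 5] e[of 5 2 5]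
    e[of 5 3 5] e[of 5 4 5] e[of 1 1 5] e[of 2 2 5] e[of 3 3 5]
  note eqs' = eqs[simplified]
  show ?E
    unfolding vec_eq_iff forall_5 zero_index by (intro conjI; use eqs' in linarith)
next
  assume E: ?E
  show "W_form a b c d p q \<in> CC 6"
    unfolding CC_6
    by (intro CollectI conjI allI; (rule W_form_CC_all | simp add: E W_form_eval inner_5; algebra?))
qed

text \<open>For the classes 7 to 10 consider B(X, Y) = A(X, Y, \<xi>) on horizontal vectors. The
  identity at Z = \<xi> makes B symmetric (7, 9) or skew (8, 10); at Y = \<xi> it makes B invariant
  (7, 8) or anti-invariant (9, 10) under \<phi>. In 7 and 8 the contraction removes one more
  dimension, so the dimensions are 3, 3, 6 and 2.\<close>

lemma W_form_CC_7:
  "W_form a b c d p q \<in> CC 7 \<longleftrightarrow>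
    a$2 = 0 \<and> a$5 = 0 \<and> b$1 = 0 \<and> b$5 = 0 \<and> c$4 = 0 \<and> c$5 = 0 \<and>
    d$3 = 0 \<and> d$5 = 0 \<and> p = 0 \<and> q = 0 \<and> a$1 = - d$4 \<and> a$3 = d$2 \<and>
    a$4 = d$1 \<and> b$2 = - d$4 \<and> b$3 = - d$1 \<and> b$4 = d$2 \<and> c$1 = d$2 \<and>
    c$2 = - d$1 \<and> c$3 = d$4"
    (is "_ \<longleftrightarrow> ?E")
proof
  assume m: "W_form a b c d p q \<in> CC 7"
  note e = basis_instance3[OF m[unfolded CC_7 mem_Collect_eq, THEN conjunct2, THEN conjunct1]]
  note f = m[unfolded CC_7 mem_Collect_eq, THEN conjunct2, THEN conjunct2]
  note [simp] = W_form_eval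
  note eqs = e[of 1 1 3] e[of 1 1 4] e[of 1 5 5] e[of 2 1 3] e[of 2 1 4] e[of 2 5 5] e[of 3 1 3] e[of 3 1 4]
    e[of 3 5 5] e[of 4 1 3] e[of 4 1 4] e[of 4 5 5] e[of 5 1 3] e[of 5 1 4] e[of 1 2 5] e[of 1 3 5]
    e[of 1 4 5] e[of 1 5 1] e[of 1 5 2] e[of 1 5 3] e[of 1 5 4] e[of 2 3 5] e[of 2 4 5] e[of 3 4 5]
    e[of 3 5 3] e[of 3 5 4] f
  note eqs' = eqs[simplified]
  show ?E
    unfolding vec_eq_iff forall_5 zero_index by (intro conjI; use eqs' in linarith)
next
  assume E: ?E
  show "W_form a b c d p q \<in> CC 7"
    unfolding CC_7
    by (intro CollectI conjI allI; (rule W_form_CC_all | simp add: E W_form_eval inner_5; algebra?))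
qed

lemma W_form_CC_8:
  "W_form a b c d p q \<in> CC 8 \<longleftrightarrow>
    a$1 = 0 \<and> a$5 = 0 \<and> b$2 = 0 \<and> b$5 = 0 \<and> c$3 = 0 \<and> c$5 = 0 \<and>
    d$4 = 0 \<and> d$5 = 0 \<and> p = 0 \<and> q = 0 \<and> a$2 = d$3 \<and> a$3 = - d$2 \<and>
    a$4 = - d$1 \<and> b$1 = - d$3 \<and> b$3 = d$1 \<and> b$4 = - d$2 \<and> c$1 = d$2 \<and>
    c$2 = - d$1 \<and> c$4 = - d$3"
    (is "_ \<longleftrightarrow> ?E")
proof
  assume m: "W_form a b c d p q \<in> CC 8"
  note e = basis_instance3[OF m[unfolded CC_8 mem_Collect_eq, THEN conjunct2, THEN conjunct1]]
  note f = m[unfolded CC_8 mem_Collect_eq, THEN conjunct2, THEN conjunct2]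
  note [simp] = W_form_eval
  note eqs = e[of 1 1 3] e[of 1 1 4] e[of 1 1 5] e[of 1 5 5] e[of 2 1 3] e[of 2 1 4] e[of 2 2 5] e[of 2 5 5]
    e[of 3 1 3] e[of 3 1 4] e[of 3 3 5] e[of 3 5 5] e[of 4 1 3] e[of 4 1 4] e[of 4 4 5] e[of 4 5 5]
    e[of 5 1 3] e[of 5 1 4] e[of 1 2 5] e[of 1 3 5] e[of 1 4 5] e[of 1 5 3] e[of 1 5 4] e[of 2 3 5]
    e[of 2 4 5] e[of 3 4 5] f
  note eqs' = eqs[simplified]
  show ?E
    unfolding vec_eq_iff forall_5 zero_index by (intro conjI; use eqs' in linarith)
next
  assume E: ?E
  show "W_form a b c d p q \<in> CC 8"
    unfolding CC_8
    by (intro CollectI conjI allI; (rule W_form_CC_all | simp add: E W_form_eval inner_5; algebra?))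
qed

lemma W_form_CC_9:
  "W_form a b c d p q \<in> CC 9 \<longleftrightarrow>
    a$5 = 0 \<and> b$5 = 0 \<and> c$5 = 0 \<and> d$5 = 0 \<and> p = 0 \<and> q = 0 \<and>
    a$1 = - b$2 \<and> a$2 = b$1 \<and> a$3 = - d$2 \<and> a$4 = d$1 \<and> b$3 = d$1 \<and>
    b$4 = d$2 \<and> c$1 = - d$2 \<and> c$2 = d$1 \<and> c$3 = - d$4 \<and> c$4 = d$3"
    (is "_ \<longleftrightarrow> ?E")
proof
  assume m: "W_form a b c d p q \<in> CC 9"
  note e = basis_instance3[OF m[unfolded CC_9 mem_Collect_eq, THEN conjunct2]]
  note [simp] = W_form_eval
  note eqs = e[of 1 1 3] e[of 1 1 4] e[of 1 5 5] e[of 2 1 3] e[of 2 1 4] e[of 2 5 5] e[of 3 1 3] e[of 3 1 4]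
    e[of 3 5 5] e[of 4 1 3] e[of 4 1 4] e[of 4 5 5] e[of 5 1 3] e[of 5 1 4] e[of 1 2 5] e[of 1 3 5]
    e[of 1 4 5] e[of 1 5 1] e[of 1 5 3] e[of 1 5 4] e[of 2 3 5] e[of 2 4 5] e[of 3 4 5] e[of 3 5 3]
  note eqs' = eqs[simplified]
  show ?E
    unfolding vec_eq_iff forall_5 zero_index by (intro conjI; use eqs' in linarith)
next
  assume E: ?E
  show "W_form a b c d p q \<in> CC 9"
    unfolding CC_9
    by (intro CollectI conjI allI; (rule W_form_CC_all | simp add: E W_form_eval inner_5; algebra?))
qed

lemma W_form_CC_10:
  "W_form a b c d p q \<in> CC 10 \<longleftrightarrow>
    a$1 = 0 \<and> a$2 = 0 \<and> a$5 = 0 \<and> b$1 = 0 \<and> b$2 = 0 \<and> b$5 = 0 \<and>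
    c$3 = 0 \<and> c$4 = 0 \<and> c$5 = 0 \<and> d$3 = 0 \<and> d$4 = 0 \<and> d$5 = 0 \<and>
    p = 0 \<and> q = 0 \<and> a$3 = d$2 \<and> a$4 = - d$1 \<and> b$3 = - d$1 \<and> b$4 = - d$2 \<and>
    c$1 = - d$2 \<and> c$2 = d$1"
    (is "_ \<longleftrightarrow> ?E")
proof
  assume m: "W_form a b c d p q \<in> CC 10"
  note e = basis_instance3[OF m[unfolded CC_10 mem_Collect_eq, THEN conjunct2]]
  note [simp] = W_form_eval
  note eqs = e[of 1 1 3] e[of 1 1 4] e[of 1 1 5] e[of 1 5 5] e[of 2 1 3] e[of 2 1 4] e[of 2 2 5] e[of 2 5 5]
    e[of 3 1 3] e[of 3 1 4] e[of 3 3 5] e[of 3 5 5] e[of 4 1 3] e[of 4 1 4] e[of 4 4 5] e[of 4 5 5]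
    e[of 5 1 3] e[of 5 1 4] e[of 1 2 5] e[of 1 3 5] e[of 1 4 5] e[of 1 5 2] e[of 1 5 3] e[of 1 5 4]
    e[of 2 3 5] e[of 2 4 5] e[of 3 4 5] e[of 3 5 4]
  note eqs' = eqs[simplified]
  show ?E
    unfolding vec_eq_iff forall_5 zero_index by (intro conjI; use eqs' in linarith)
next
  assume E: ?E
  show "W_form a b c d p q \<in> CC 10"
    unfolding CC_10
    by (intro CollectI conjI allI; (rule W_form_CC_all | simp add: E W_form_eval inner_5; algebra?))
qed

lemma W_form_CC_11:
  "W_form a b c d p q \<in> CC 11 \<longleftrightarrow>
    a = 0 \<and> b = 0 \<and> c = 0 \<and> d = 0 \<and> p$1 = 0 \<and> p$2 = 0 \<and> p$3 = 0 \<and>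
    p$4 = 0 \<and> q$1 = 0 \<and> q$2 = 0 \<and> q$3 = 0 \<and> q$4 = 0"
    (is "_ \<longleftrightarrow> ?E")
proof
  assume m: "W_form a b c d p q \<in> CC 11"
  note e = basis_instance3[OF m[unfolded CC_11 mem_Collect_eq, THEN conjunct2]]
  note [simp] = W_form_eval
  note eqs = e[of 1 1 3] e[of 1 1 4] e[of 1 1 5] e[of 1 2 5] e[of 1 3 5] e[of 1 4 5] e[of 2 1 3] e[of 2 1 4]
    e[of 2 1 5] e[of 2 2 5] e[of 2 3 5] e[of 2 4 5] e[of 3 1 3] e[of 3 1 4] e[of 3 1 5] e[of 3 2 5]
    e[of 3 3 5] e[of 3 4 5] e[of 4 1 3] e[of 4 1 4] e[of 4 1 5] e[of 4 2 5] e[of 4 3 5] e[of 4 4 5]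
    e[of 5 1 5] e[of 5 2 5] e[of 5 3 5] e[of 5 4 5]
  note eqs' = eqs[simplified]
  show ?E
    unfolding vec_eq_iff forall_5 zero_index by (intro conjI; use eqs' in linarith)
next
  assume E: ?E
  show "W_form a b c d p q \<in> CC 11"
    unfolding CC_11
    by (intro CollectI conjI allI; (rule W_form_CC_all | simp add: E W_form_eval inner_5; algebra?))
qed

lemma W_form_CC_12:
  "W_form a b c d p q \<in> CC 12 \<longleftrightarrow>
    a$1 = 0 \<and> a$2 = 0 \<and> a$3 = 0 \<and> a$4 = 0 \<and> b$1 = 0 \<and> b$2 = 0 \<and>
    b$3 = 0 \<and> b$4 = 0 \<and> c$1 = 0 \<and> c$2 = 0 \<and> c$3 = 0 \<and> c$4 = 0 \<and>
    d$1 = 0 \<and> d$2 = 0 \<and> d$3 = 0 \<and> d$4 = 0 \<and> p = 0 \<and> q = 0"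
    (is "_ \<longleftrightarrow> ?E")
proof
  assume m: "W_form a b c d p q \<in> CC 12"
  note e = basis_instance3[OF m[unfolded CC_12 mem_Collect_eq, THEN conjunct2]]
  note [simp] = W_form_eval
  note eqs = e[of 1 1 3] e[of 1 1 4] e[of 1 1 5] e[of 1 2 5] e[of 1 3 5] e[of 1 4 5] e[of 2 1 3] e[of 2 1 4]
    e[of 2 1 5] e[of 2 2 5] e[of 2 3 5] e[of 2 4 5] e[of 3 1 3] e[of 3 1 4] e[of 3 1 5] e[of 3 2 5]
    e[of 3 3 5] e[of 3 4 5] e[of 4 1 3] e[of 4 1 4] e[of 4 1 5] e[of 4 2 5] e[of 4 3 5] e[of 4 4 5]
    e[of 5 1 3] e[of 5 1 4]
  note eqs' = eqs[simplified]
  show ?E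
    unfolding vec_eq_iff forall_5 zero_index by (intro conjI; use eqs' in linarith)
next
  assume E: ?E
  show "W_form a b c d p q \<in> CC 12"
    unfolding CC_12
    by (intro CollectI conjI allI; (rule W_form_CC_all | simp add: E W_form_eval inner_5; algebra?))
qed

section \<open>Linear systems for W_8, W_9 and W_10\<close>

lemma W_form_WW_8:
  "W_form a b c d p q \<in> WW 8 \<longleftrightarrow>
    a$2 = 0 \<and> a$5 = 0 \<and> b$1 = 0 \<and> b$5 = 0 \<and> c$4 = 0 \<and> c$5 = 0 \<and>
    d$3 = 0 \<and> d$5 = 0 \<and> p = 0 \<and> q = 0 \<and> a$1 = - d$4 \<and> a$3 = d$2 \<and>
    a$4 = d$1 \<and> b$2 = - d$4 \<and> b$3 = - d$1 \<and> b$4 = d$2 \<and> c$1 = d$2 \<and>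
    c$2 = - d$1 \<and> c$3 = d$4"
    (is "_ \<longleftrightarrow> ?E")
proof
  assume m: "W_form a b c d p q \<in> WW 8"
  note e = basis_instance3[OF m[unfolded WW_8 mem_Collect_eq, THEN conjunct2]]
  note cyc = basis_instance3[OF m[unfolded WW_8 AA3_def mem_Collect_eq, THEN conjunct1, THEN conjunct2, THEN conjunct1]]
  note con = m[unfolded WW_8 AA3_def mem_Collect_eq, THEN conjunct1, THEN conjunct2, THEN conjunct2, THEN spec, of "bas i" for i]
  note [simp] = W_form_eval
  \<comment> \<open>Since \<phi> \<xi> = 0, the identity at X = \<xi> kills A(\<xi>, ., .). Cyclic
    sums that involve \<xi> then make A(X, Y, \<xi>) symmetric in X and Y, and
    \<open>con[of 5]\<close> makes it trace-free.\<close>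
  note eqs = e[of 5 1 3] e[of 5 1 4] e[of 5 1 5] e[of 5 2 5] e[of 5 3 5] e[of 5 4 5] cyc[of 1 2 3] cyc[of 1 2 4]
    cyc[of 1 2 5] cyc[of 1 3 4] cyc[of 2 3 4] cyc[of 3 4 5] e[of 1 1 3] e[of 1 1 4] e[of 1 1 5]
    e[of 1 2 5] e[of 1 3 5] e[of 1 4 5] e[of 3 1 3] e[of 3 1 4] e[of 3 1 5] e[of 3 2 5] e[of 3 3 5]
    e[of 3 4 5] cyc[of 1 3 5] cyc[of 1 4 5] con[of 5]
  note eqs' = eqs[simplified]
  show ?E
    unfolding vec_eq_iff forall_5 zero_index by (intro conjI; use eqs' in linarith)
next
  assume E: ?E
  show "W_form a b c d p q \<in> WW 8"
    unfolding WW_8 AA3_def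
    by (intro CollectI conjI allI; (rule W_form_AA | simp add: E W_form_eval inner_5; algebra?))
qed

lemma W_form_WW_9:
  "W_form a b c d p q \<in> WW 9 \<longleftrightarrow>
    a = 0 \<and> b = 0 \<and> c = 0 \<and> d = 0 \<and> p$5 = 0 \<and> q$5 = 0 \<and> p$1 = - q$2 \<and>
    p$2 = q$1 \<and> p$3 = - q$4 \<and> p$4 = q$3"
    (is "_ \<longleftrightarrow> ?E")
proof
  assume m: "W_form a b c d p q \<in> WW 9"
  note e = basis_instance3[OF m[unfolded WW_9 mem_Collect_eq, THEN conjunct2]]
  note cyc = basis_instance3[OF m[unfolded WW_9 AA3_def mem_Collect_eq, THEN conjunct1, THEN conjunct2, THEN conjunct1]]
  note con = m[unfolded WW_9 AA3_def mem_Collect_eq, THEN conjunct1, THEN conjunct2, THEN conjunct2, THEN spec, of "bas i" for i]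
  note [simp] = W_form_eval
  note eqs = e[of 1 1 5] e[of 1 2 5] e[of 1 3 5] e[of 1 4 5] e[of 2 1 5] e[of 2 2 5] e[of 2 3 5] e[of 2 4 5]
    e[of 3 1 5] e[of 3 2 5] e[of 3 3 5] e[of 3 4 5] e[of 4 1 5] e[of 4 2 5] e[of 4 3 5] e[of 4 4 5]
    e[of 5 1 5] e[of 5 2 5] e[of 5 3 5] e[of 5 4 5] cyc[of 1 2 3] cyc[of 1 2 4] cyc[of 1 3 4]
    cyc[of 2 3 4] cyc[of 1 3 5] cyc[of 1 4 5]
  note eqs' = eqs[simplified]
  show ?E
    unfolding vec_eq_iff forall_5 zero_index by (intro conjI; use eqs' in linarith)
next
  assume E: ?E
  show "W_form a b c d p q \<in> WW 9"
    unfolding WW_9 AA3_def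
    by (intro CollectI conjI allI; (rule W_form_AA | simp add: E W_form_eval inner_5; algebra?))
qed

lemma W_form_WW_10:
  "W_form a b c d p q \<in> WW 10 \<longleftrightarrow>
    a$5 = 0 \<and> b$5 = 0 \<and> c$5 = 0 \<and> d$5 = 0 \<and> p = 0 \<and> q = 0 \<and>
    a$1 = - b$2 \<and> a$2 = b$1 \<and> a$3 = - d$2 \<and> a$4 = d$1 \<and> b$3 = d$1 \<and>
    b$4 = d$2 \<and> c$1 = - d$2 \<and> c$2 = d$1 \<and> c$3 = - d$4 \<and> c$4 = d$3"
    (is "_ \<longleftrightarrow> ?E")
proof
  assume m: "W_form a b c d p q \<in> WW 10"
  note e = basis_instance3[OF m[unfolded WW_10 mem_Collect_eq, THEN conjunct2]]
  note cyc = basis_instance3[OF m[unfolded WW_10 AA3_def mem_Collect_eq, THEN conjunct1, THEN conjunct2, THEN conjunct1]]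
  note con = m[unfolded WW_10 AA3_def mem_Collect_eq, THEN conjunct1, THEN conjunct2, THEN conjunct2, THEN spec, of "bas i" for i]
  note [simp] = W_form_eval
  note eqs = e[of 5 1 3] e[of 5 1 4] e[of 5 1 5] e[of 5 2 5] e[of 5 3 5] e[of 5 4 5] cyc[of 1 2 3] cyc[of 1 2 4]
    cyc[of 1 2 5] cyc[of 1 3 4] cyc[of 2 3 4] cyc[of 3 4 5] e[of 1 1 3] e[of 1 1 4] e[of 1 1 5]
    e[of 1 3 5] e[of 1 4 5] e[of 3 1 3] e[of 3 1 4] e[of 3 1 5] e[of 3 2 5] e[of 3 3 5] cyc[of 1 3 5]
    cyc[of 1 4 5]
  note eqs' = eqs[simplified]
  show ?E
    unfolding vec_eq_iff forall_5 zero_index by (intro conjI; use eqs' in linarith)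
next
  assume E: ?E
  show "W_form a b c d p q \<in> WW 10"
    unfolding WW_10 AA3_def
    by (intro CollectI conjI allI; (rule W_form_AA | simp add: E W_form_eval inner_5; algebra?))
qed

section \<open>Parametrizations of W_1 to W_7\<close>

lemma theta2_AA:
  assumes "\<omega> \<in> AA"
  shows "theta2 \<omega> = \<omega>"
proof (intro ext)
  fix X Y Z
  show "theta2 \<omega> X Y Z = \<omega> X Y Z"
    using linear_expand[OF AA_linear[OF assms], of X Y Z] by (simp add: theta2_def interior_def sum_5)
qed

lemma Lam1_2_eq: "Lam1_2 = {\<lambda>X. v \<bullet> X |v. (v :: vec5) $ 5 = 0}"
proof (intro set_eqI iffI)
  fix \<alpha> assume a: "\<alpha> \<in> Lam1_2"
  then have l: "linear \<alpha>" and z: "\<alpha> (bas 5) = 0" by (simp_all add: Lam1_2_def Lam1_def xi0_def)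
  have "\<alpha> X = (\<chi> i. \<alpha> (bas i)) \<bullet> X" for X
    using linear_expand[OF l, of X] by (simp add: inner_5 mult.commute)
  then have "\<alpha> = (\<lambda>X. (\<chi> i. \<alpha> (bas i)) \<bullet> X)" by (rule ext)
  moreover have "(\<chi> i. \<alpha> (bas i)) $ 5 = 0" by (simp add: z)
  ultimately show "\<alpha> \<in> {\<lambda>X. v \<bullet> X |v. (v :: vec5) $ 5 = 0}" by blast
next
  fix \<alpha> assume "\<alpha> \<in> {\<lambda>X. v \<bullet> X |v. (v :: vec5) $ 5 = 0}"
  then show "\<alpha> \<in> Lam1_2"
    by (auto simp: Lam1_2_def Lam1_def xi0_def intro!: linearI inner_right_distrib)
qed

lemma theta1_AA: "theta1 (\<lambda>X. v \<bullet> X) \<in> AA"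
  by (intro AAI Lam2I linearI) (simp_all add: theta1_def algebra_simps)

lemma WW_1_eq: "WW 1 = {W_form (t *\<^sub>R bas 1) (t *\<^sub>R bas 2) (t *\<^sub>R bas 3) (t *\<^sub>R bas 4) 0 0 |t. True}"
proof -
  have "theta1 (\<lambda>X. t * eta0 X) = W_form (t *\<^sub>R bas 1) (t *\<^sub>R bas 2) (t *\<^sub>R bas 3) (t *\<^sub>R bas 4) 0 0" for t
    by (intro ext) (simp add: theta1_def W_form_def m_form_def eta0_nth inner_5 algebra_simps)
  moreover have "WW 1 = {theta1 (\<lambda>X. t * eta0 X) |t. True}" unfolding WW_1 Lam1_1_def by blast
  ultimately show ?thesis by simp
qed

text \<open>The vector \<open>v\<close> is dual to the 1-form. The halves come from the projection
  to \<open>mm\<close>, which replaces e1 \<and> e3 by half of e1 \<and> e3 - e2 \<and> e4, and so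
  on.\<close>

lemma WW_2_eq:
  "WW 2 = {W_form (- v$1 *\<^sub>R bas 5) (- v$2 *\<^sub>R bas 5) (- v$3 *\<^sub>R bas 5) (- v$4 *\<^sub>R bas 5)
     ((1/2) *\<^sub>R vector [v$3, - v$4, - v$1, v$2, 0]) ((1/2) *\<^sub>R vector [v$4, v$3, - v$2, - v$1, 0]) |v. (v :: vec5) $ 5 = 0}"
proof -
  have *: "pr_W (theta1 (\<lambda>X. v \<bullet> X)) =
    W_form (- v$1 *\<^sub>R bas 5) (- v$2 *\<^sub>R bas 5) (- v$3 *\<^sub>R bas 5) (- v$4 *\<^sub>R bas 5)
     ((1/2) *\<^sub>R vector [v$3, - v$4, - v$1, v$2, 0]) ((1/2) *\<^sub>R vector [v$4, v$3, - v$2, - v$1, 0])"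
    if "v $ 5 = 0" for v
    using that unfolding pr_W_eq[OF theta1_AA] W_form_eq_iff by (simp add: vec_eq_iff forall_5 vector_5 theta1_def)
  have **: "WW 2 = {pr_W (theta1 (\<lambda>X. v \<bullet> X)) |v. v $ 5 = 0}" unfolding WW_2 Lam1_2_eq by blast
  show ?thesis unfolding ** by (intro Collect_cong ex_cong1 rev_conj_cong refl) (simp add: *)
qed

text \<open>One evaluation for an arbitrary 2-form serves three classes: its restrictions to
  \<open>Lam2_1\<close>, \<open>Lam2_3\<close> and \<open>Lam2_4\<close> give \<open>WW 3\<close>,
  \<open>WW 5\<close> and \<open>WW 6\<close>.\<close>

lemma pr_W_theta2_hodge2:
  assumes "\<alpha> \<in> Lam2"
  defines "h \<equiv> \<lambda>i j. \<alpha> (bas i) (bas j)"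
  shows "pr_W (theta2 (hodge2 \<alpha>)) =
    W_form (vector [0, - h 3 4, h 2 4, - h 2 3, 0]) (vector [h 3 4, 0, - h 1 4, h 1 3, 0])
      (vector [- h 2 4, h 1 4, 0, - h 1 2, 0]) (vector [h 2 3, - h 1 3, h 1 2, 0, 0])
      ((1/2) *\<^sub>R vector [h 3 5, - h 4 5, - h 1 5, h 2 5, h 1 3 - h 2 4])
      ((1/2) *\<^sub>R vector [h 4 5, h 3 5, - h 2 5, - h 1 5, h 1 4 + h 2 3])"
proof -
  have z: "hodge2 \<alpha> X X Z = 0" "hodge2 \<alpha> X Z Z = 0" "hodge2 \<alpha> X Z X = 0" for X Z
    using hodge2_swap(1)[of \<alpha> X X Z] hodge2_swap(2)[of \<alpha> X Z Z] hodge2_swap(1)[of \<alpha> X Z X]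
      hodge2_swap(2)[of \<alpha> Z X X] by simp_all
  have s: "hodge2 \<alpha> (bas j) (bas i) (bas k) = - hodge2 \<alpha> (bas i) (bas j) (bas k)"
    "hodge2 \<alpha> (bas k) (bas i) (bas j) = hodge2 \<alpha> (bas i) (bas j) (bas k)" for i j k
    using hodge2_swap(1)[of \<alpha> "bas j" "bas i" "bas k"] hodge2_swap(1)[of \<alpha> "bas k" "bas i" "bas j"]
      hodge2_swap(2)[of \<alpha> "bas i" "bas k" "bas j"] by simp_all
  have w: "hodge2 \<alpha> (bas 2) (bas 1) (bas i) = - hodge2 \<alpha> (bas 1) (bas 2) (bas i)"
    "hodge2 \<alpha> (bas 3) (bas 1) (bas i) = - hodge2 \<alpha> (bas 1) (bas 3) (bas i)"
    "hodge2 \<alpha> (bas 4) (bas 1) (bas 5) = - hodge2 \<alpha> (bas 1) (bas 4) (bas 5)"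
    "hodge2 \<alpha> (bas 3) (bas 2) (bas i) = - hodge2 \<alpha> (bas 2) (bas 3) (bas i)"
    "hodge2 \<alpha> (bas 4) (bas 2) (bas 5) = - hodge2 \<alpha> (bas 2) (bas 4) (bas 5)"
    "hodge2 \<alpha> (bas 4) (bas 3) (bas 5) = - hodge2 \<alpha> (bas 3) (bas 4) (bas 5)"
    "hodge2 \<alpha> (bas 4) (bas 1) (bas 3) = hodge2 \<alpha> (bas 1) (bas 3) (bas 4)"
    "hodge2 \<alpha> (bas 4) (bas 2) (bas 3) = hodge2 \<alpha> (bas 2) (bas 3) (bas 4)"
    "hodge2 \<alpha> (bas 5) (bas 1) (bas 3) = hodge2 \<alpha> (bas 1) (bas 3) (bas 5)"
    "hodge2 \<alpha> (bas 5) (bas 1) (bas 4) = hodge2 \<alpha> (bas 1) (bas 4) (bas 5)"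
    "hodge2 \<alpha> (bas 5) (bas 2) (bas 3) = hodge2 \<alpha> (bas 2) (bas 3) (bas 5)"
    "hodge2 \<alpha> (bas 5) (bas 2) (bas 4) = hodge2 \<alpha> (bas 2) (bas 4) (bas 5)" for i
    by (rule s)+
  show ?thesis
    unfolding theta2_AA[OF hodge2_AA] pr_W_eq[OF hodge2_AA] W_form_eq_iff
    by (simp add: vec_eq_iff forall_5 vector_5 z w hodge2_bas[OF assms(1)] h_def)
qed

lemma Phi0_Lam2: "(\<lambda>X Y. t * Phi0 X Y) \<in> Lam2"
  by (rule Lam2I) (simp_all add: Phi0_def inner_5 algebra_simps)

lemma WW_3_eq: "WW 3 = {W_form (- t *\<^sub>R bas 2) (t *\<^sub>R bas 1) (- t *\<^sub>R bas 4) (t *\<^sub>R bas 3) 0 0 |t. True}"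
proof -
  have "pr_W (theta2 (hodge2 (\<lambda>X Y. t * Phi0 X Y))) = W_form (- t *\<^sub>R bas 2) (t *\<^sub>R bas 1) (- t *\<^sub>R bas 4) (t *\<^sub>R bas 3) 0 0" for t
    unfolding pr_W_theta2_hodge2[OF Phi0_Lam2] W_form_eq_iff
    by (simp add: vec_eq_iff forall_5 vector_5 Phi0_def)
  moreover have "WW 3 = {pr_W (theta2 (hodge2 (\<lambda>X Y. t * Phi0 X Y))) |t. True}"
    unfolding WW_3 Lam3_1_def Lam2_1_def by blast
  ultimately show ?thesis by simp
qed

lemma wedge12_m_form:
  "wedge12 eta0 (m_form 0 0 0 0 p q) =
    W_form (vector [0, 0, - p, - q, 0]) (vector [0, 0, - q, p, 0]) (vector [p, q, 0, 0, 0])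
      (vector [q, - p, 0, 0, 0]) (p *\<^sub>R bas 5) (q *\<^sub>R bas 5)"
  by (intro ext) (simp add: wedge12_def m_form_def W_form_def inner_5 vector_5 eta0_nth algebra_simps)

text \<open>On \<open>Lam2_2\<close> the Hodge operator is \<alpha> \<mapsto> \<eta> \<and> \<alpha>
  by definition and \<open>theta2\<close> fixes 3-forms, so \<open>WW 4\<close> consists of the
  forms \<eta> \<and> \<alpha>.\<close>

lemma WW_4_eq: "WW 4 = {W_form (vector [0, 0, - p, - q, 0]) (vector [0, 0, - q, p, 0]) (vector [p, q, 0, 0, 0])
      (vector [q, - p, 0, 0, 0]) (p *\<^sub>R bas 5) (q *\<^sub>R bas 5) |p q. True}"
proof -
  have "hodge2 \<alpha> = wedge12 eta0 \<alpha>" if "\<alpha> \<in> Lam2_2" for \<alpha> using that by (simp add: Lam2_2_def)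
  then have "WW 4 = wedge12 eta0 ` Lam2_2"
    unfolding WW_4 Lam3_2_def image_image theta2_AA[OF hodge2_AA] by (rule image_cong[OF refl])
  moreover have "wedge12 eta0 ` Lam2_2 = {wedge12 eta0 (m_form 0 0 0 0 p q) |p q. True}" unfolding Lam2_2_eq by blast
  ultimately show ?thesis by (simp add: wedge12_m_form)
qed

text \<open>In 3 \<eta> \<otimes> \<alpha> - \<eta> \<and> \<alpha> the part \<eta> \<otimes>
  \<alpha> keeps the factor 3 - 1 = 2, while the rest of \<eta> \<and> \<alpha> changes its
  sign.\<close>

lemma WW_7_eq: "WW 7 = {W_form (vector [0, 0, p, q, 0]) (vector [0, 0, q, - p, 0]) (vector [- p, - q, 0, 0, 0])
      (vector [- q, p, 0, 0, 0]) ((2 * p) *\<^sub>R bas 5) ((2 * q) *\<^sub>R bas 5) |p q. True}"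
proof -
  have "theta3 (m_form 0 0 0 0 p q) = W_form (vector [0, 0, p, q, 0]) (vector [0, 0, q, - p, 0])
      (vector [- p, - q, 0, 0, 0]) (vector [- q, p, 0, 0, 0]) ((2 * p) *\<^sub>R bas 5) ((2 * q) *\<^sub>R bas 5)" for p q
    by (intro ext) (simp add: theta3_def wedge12_m_form theta2_AA[OF W_form_AA] m_form_def W_form_def
        inner_5 vector_5 eta0_nth algebra_simps)
  moreover have "WW 7 = {theta3 (m_form 0 0 0 0 p q) |p q. True}" unfolding WW_7 Lam2_2_eq by blast
  ultimately show ?thesis by simp
qed

lemma WW_6_eq: "WW 6 = {W_form 0 0 0 0 ((1/2) *\<^sub>R vector [c, - d, - a, b, 0]) ((1/2) *\<^sub>R vector [d, c, - b, - a, 0])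
    |a b c d. True}"
proof -
  have "pr_W (theta2 (hodge2 (m_form a b c d 0 0))) =
    W_form 0 0 0 0 ((1/2) *\<^sub>R vector [c, - d, - a, b, 0]) ((1/2) *\<^sub>R vector [d, c, - b, - a, 0])" for a b c d
    unfolding pr_W_theta2_hodge2[OF m_form_Lam2] W_form_eq_iff by (simp add: vec_eq_iff forall_5 vector_5)
  moreover have "WW 6 = {pr_W (theta2 (hodge2 (m_form a b c d 0 0))) |a b c d. True}"
    unfolding WW_6 Lam3_4_def Lam2_4_eq by blast
  ultimately show ?thesis by simp
qed

lemma Lam2_3_eq:
  "Lam2_3 = {\<alpha> \<in> Lam2. \<alpha> (bas 3) (bas 4) = - \<alpha> (bas 1) (bas 2) \<and> \<alpha> (bas 2) (bas 4) = \<alpha> (bas 1) (bas 3) \<and>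
    \<alpha> (bas 2) (bas 3) = - \<alpha> (bas 1) (bas 4) \<and> \<alpha> (bas 1) (bas 5) = 0 \<and> \<alpha> (bas 2) (bas 5) = 0 \<and>
    \<alpha> (bas 3) (bas 5) = 0 \<and> \<alpha> (bas 4) (bas 5) = 0}" (is "_ = {\<alpha> \<in> Lam2. ?P \<alpha>}")
proof -
  have "hodge2 \<alpha> = - wedge12 eta0 \<alpha> \<longleftrightarrow> ?P \<alpha>" if a: "\<alpha> \<in> Lam2" for \<alpha>
  proof
    assume "hodge2 \<alpha> = - wedge12 eta0 \<alpha>"
    then have h: "hodge2 \<alpha> (bas i) (bas j) (bas k) = - wedge12 eta0 \<alpha> (bas i) (bas j) (bas k)" for i j k
      by simp
    show "?P \<alpha>"
      using h[of 1 2 3] h[of 1 2 4] h[of 1 2 5] h[of 1 3 4] h[of 1 3 5] h[of 1 4 5] h[of 2 3 4]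
      by (simp add: hodge2_bas[OF a] wedge12_bas[OF a])
  next
    have l: "linear (\<lambda>X. (- wedge12 eta0 \<alpha>) X Y Z)" for Y Z
      using linear_compose_neg[OF wedge12_linear[OF a]] by simp
    have s: "(- wedge12 eta0 \<alpha>) Y X Z = - (- wedge12 eta0 \<alpha>) X Y Z"
      "(- wedge12 eta0 \<alpha>) X Z Y = - (- wedge12 eta0 \<alpha>) X Y Z" for X Y Z
      using wedge12_swap[OF a, of eta0 Y X Z] wedge12_swap[OF a, of eta0 X Z Y] by simp_all
    assume "?P \<alpha>"
    then show "hodge2 \<alpha> = - wedge12 eta0 \<alpha>"
      by (intro alternating3_eqI[OF hodge2_linear hodge2_swap l s])
        (simp_all add: hodge2_bas[OF a] wedge12_bas[OF a])
  qed
  then show ?thesis unfolding Lam2_3_def by blast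
qed

lemma WW_5_eq: "WW 5 = {W_form (vector [0, r, s, t, 0]) (vector [- r, 0, - t, s, 0]) (vector [- s, t, 0, - r, 0])
      (vector [- t, - s, r, 0, 0]) 0 0 |r s t. True}"
proof -
  have *: "pr_W (theta2 (hodge2 \<alpha>)) =
    W_form (vector [0, r, s, t, 0]) (vector [- r, 0, - t, s, 0]) (vector [- s, t, 0, - r, 0])
      (vector [- t, - s, r, 0, 0]) 0 0"
    if "\<alpha> \<in> Lam2_3" "r = \<alpha> (bas 1) (bas 2)" "s = \<alpha> (bas 1) (bas 3)" "t = \<alpha> (bas 1) (bas 4)" for \<alpha> r s t
  proof -
    have a: "\<alpha> \<in> Lam2" and e: "\<alpha> (bas 3) (bas 4) = - \<alpha> (bas 1) (bas 2)" "\<alpha> (bas 2) (bas 4) = \<alpha> (bas 1) (bas 3)"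
      "\<alpha> (bas 2) (bas 3) = - \<alpha> (bas 1) (bas 4)" "\<alpha> (bas 1) (bas 5) = 0" "\<alpha> (bas 2) (bas 5) = 0"
      "\<alpha> (bas 3) (bas 5) = 0" "\<alpha> (bas 4) (bas 5) = 0"
      using that(1) by (simp_all add: Lam2_3_eq)
    show ?thesis
      unfolding pr_W_theta2_hodge2[OF a] that(2-4) W_form_eq_iff by (simp add: e vec_eq_iff forall_5 vector_5)
  qed
  \<comment> \<open>This is the anti-self-dual horizontal form with coefficients r, s, t at e1
    \<and> e2, e1 \<and> e3, e1 \<and> e4. It shows that every triple of parameters occurs in
    \<open>WW 5\<close>.\<close>
  define \<beta> :: "real \<Rightarrow> real \<Rightarrow> real \<Rightarrow> form2" where
    "\<beta> r s t Y Z = r * (Y$1 * Z$2 - Y$2 * Z$1 - Y$3 * Z$4 + Y$4 * Z$3) + s * (Y$1 * Z$3 - Y$3 * Z$1 + Y$2 * Z$4 - Y$4 * Z$2)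
      + t * (Y$1 * Z$4 - Y$4 * Z$1 - Y$2 * Z$3 + Y$3 * Z$2)" for r s t Y Z
  have b: "\<beta> r s t \<in> Lam2_3" for r s t
    unfolding Lam2_3_eq by (auto intro!: Lam2I simp: \<beta>_def algebra_simps)
  have "W_form (vector [0, r, s, t, 0]) (vector [- r, 0, - t, s, 0]) (vector [- s, t, 0, - r, 0])
      (vector [- t, - s, r, 0, 0]) 0 0 \<in> WW 5" for r s t
  proof -
    have "pr_W (theta2 (hodge2 (\<beta> r s t))) \<in> WW 5" unfolding WW_5 Lam3_3_def using b by blast
    then show ?thesis by (subst (asm) *[OF b, of r r s t s t]) (simp_all add: \<beta>_def)
  qed
  moreover have "\<exists>r s t. A = W_form (vector [0, r, s, t, 0]) (vector [- r, 0, - t, s, 0]) (vector [- s, t, 0, - r, 0])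
      (vector [- t, - s, r, 0, 0]) 0 0" if "A \<in> WW 5" for A
    using that *[OF _ refl refl refl] unfolding WW_5 Lam3_3_def by blast
  ultimately show ?thesis by blast
qed

section \<open>Linear systems for W_1 to W_7\<close>

lemma W_form_WW_1:
  "W_form a b c d p q \<in> WW 1 \<longleftrightarrow>
    a$2 = 0 \<and> a$3 = 0 \<and> a$4 = 0 \<and> a$5 = 0 \<and> b$1 = 0 \<and> b$3 = 0 \<and> b$4 = 0 \<and> b$5 = 0 \<and> c$1 = 0 \<and>
    c$2 = 0 \<and> c$4 = 0 \<and> c$5 = 0 \<and> d$1 = 0 \<and> d$2 = 0 \<and> d$3 = 0 \<and> d$5 = 0 \<and> p = 0 \<and> q = 0 \<and>
    a$1 = d$4 \<and> b$2 = d$4 \<and> c$3 = d$4"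
  unfolding WW_1_eq by (auto simp: W_form_eq_iff vec_eq_iff forall_5 intro!: exI[of _ "d$4"])

lemma W_form_WW_2:
  "W_form a b c d p q \<in> WW 2 \<longleftrightarrow>
    a$1 = 0 \<and> a$2 = 0 \<and> a$3 = 0 \<and> a$4 = 0 \<and> b$1 = 0 \<and> b$2 = 0 \<and>
    b$3 = 0 \<and> b$4 = 0 \<and> c$1 = 0 \<and> c$2 = 0 \<and> c$3 = 0 \<and> c$4 = 0 \<and>
    d$1 = 0 \<and> d$2 = 0 \<and> d$3 = 0 \<and> d$4 = 0 \<and> p$5 = 0 \<and> q$5 = 0 \<and>
    a$5 = 2 * q$4 \<and> b$5 = 2 * q$3 \<and> c$5 = -2 * q$2 \<and> d$5 = -2 * q$1 \<and>
    p$1 = q$2 \<and> p$2 = - q$1 \<and> p$3 = q$4 \<and> p$4 = - q$3"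
    (is "_ \<longleftrightarrow> ?E")
proof
  assume "W_form a b c d p q \<in> WW 2"
  then show ?E
    unfolding WW_2_eq mem_Collect_eq W_form_eq_iff by (elim exE conjE) (simp add: vector_5)
next
  assume ?E
  then show "W_form a b c d p q \<in> WW 2"
    unfolding WW_2_eq mem_Collect_eq W_form_eq_iff vec_eq_iff forall_5
    by (intro exI[of _ "vector [- a$5, - b$5, - c$5, - d$5, 0]"]) (simp add: vector_5)
qed

lemma W_form_WW_3:
  "W_form a b c d p q \<in> WW 3 \<longleftrightarrow>
    a$1 = 0 \<and> a$3 = 0 \<and> a$4 = 0 \<and> a$5 = 0 \<and> b$2 = 0 \<and> b$3 = 0 \<and>
    b$4 = 0 \<and> b$5 = 0 \<and> c$1 = 0 \<and> c$2 = 0 \<and> c$3 = 0 \<and> c$5 = 0 \<and>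
    d$1 = 0 \<and> d$2 = 0 \<and> d$4 = 0 \<and> d$5 = 0 \<and> p = 0 \<and> q = 0 \<and>
    a$2 = - d$3 \<and> b$1 = d$3 \<and> c$4 = - d$3"
    (is "_ \<longleftrightarrow> ?E")
proof
  assume "W_form a b c d p q \<in> WW 3"
  then show ?E
    unfolding WW_3_eq mem_Collect_eq W_form_eq_iff by (elim exE conjE) (simp add: vector_5)
next
  assume ?E
  then show "W_form a b c d p q \<in> WW 3"
    unfolding WW_3_eq mem_Collect_eq W_form_eq_iff vec_eq_iff forall_5
    by (intro exI[of _ "b$1"]) (simp add: vector_5)
qed

lemma W_form_WW_4:
  "W_form a b c d p q \<in> WW 4 \<longleftrightarrow>
    a$1 = 0 \<and> a$2 = 0 \<and> a$5 = 0 \<and> b$1 = 0 \<and> b$2 = 0 \<and> b$5 = 0 \<and>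
    c$3 = 0 \<and> c$4 = 0 \<and> c$5 = 0 \<and> d$3 = 0 \<and> d$4 = 0 \<and> d$5 = 0 \<and>
    p$1 = 0 \<and> p$2 = 0 \<and> p$3 = 0 \<and> p$4 = 0 \<and> q$1 = 0 \<and> q$2 = 0 \<and>
    q$3 = 0 \<and> q$4 = 0 \<and> a$3 = - p$5 \<and> a$4 = - q$5 \<and> b$3 = - q$5 \<and>
    b$4 = p$5 \<and> c$1 = p$5 \<and> c$2 = q$5 \<and> d$1 = q$5 \<and> d$2 = - p$5"
    (is "_ \<longleftrightarrow> ?E")
proof
  assume "W_form a b c d p q \<in> WW 4"
  then show ?E
    unfolding WW_4_eq mem_Collect_eq W_form_eq_iff by (elim exE conjE) (simp add: vector_5)
next
  assume ?E
  then show "W_form a b c d p q \<in> WW 4"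
    unfolding WW_4_eq mem_Collect_eq W_form_eq_iff vec_eq_iff forall_5
    by (intro exI[of _ "p$5"] exI[of _ "q$5"]) (simp add: vector_5)
qed

lemma W_form_WW_5:
  "W_form a b c d p q \<in> WW 5 \<longleftrightarrow>
    a$1 = 0 \<and> a$5 = 0 \<and> b$2 = 0 \<and> b$5 = 0 \<and> c$3 = 0 \<and> c$5 = 0 \<and>
    d$4 = 0 \<and> d$5 = 0 \<and> p = 0 \<and> q = 0 \<and> a$2 = d$3 \<and> a$3 = - d$2 \<and>
    a$4 = - d$1 \<and> b$1 = - d$3 \<and> b$3 = d$1 \<and> b$4 = - d$2 \<and> c$1 = d$2 \<and>
    c$2 = - d$1 \<and> c$4 = - d$3"
    (is "_ \<longleftrightarrow> ?E")
proof
  assume "W_form a b c d p q \<in> WW 5"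
  then show ?E
    unfolding WW_5_eq mem_Collect_eq W_form_eq_iff by (elim exE conjE) (simp add: vector_5)
next
  assume ?E
  then show "W_form a b c d p q \<in> WW 5"
    unfolding WW_5_eq mem_Collect_eq W_form_eq_iff vec_eq_iff forall_5
    by (intro exI[of _ "a$2"] exI[of _ "a$3"] exI[of _ "a$4"]) (simp add: vector_5)
qed

lemma W_form_WW_6:
  "W_form a b c d p q \<in> WW 6 \<longleftrightarrow>
    a = 0 \<and> b = 0 \<and> c = 0 \<and> d = 0 \<and> p$5 = 0 \<and> q$5 = 0 \<and> p$1 = q$2 \<and>
    p$2 = - q$1 \<and> p$3 = q$4 \<and> p$4 = - q$3"
    (is "_ \<longleftrightarrow> ?E")
proof
  assume "W_form a b c d p q \<in> WW 6"
  then show ?E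
    unfolding WW_6_eq mem_Collect_eq W_form_eq_iff by (elim exE conjE) (simp add: vector_5)
next
  assume ?E
  then show "W_form a b c d p q \<in> WW 6"
    unfolding WW_6_eq mem_Collect_eq W_form_eq_iff vec_eq_iff forall_5
    \<comment> \<open>The four parameters of \<open>WW_6_eq\<close> are solved from the entries of
      \<open>q\<close>.\<close>
    by (intro exI[of _ "- 2 * q$4"] exI[of _ "- 2 * q$3"] exI[of _ "2 * q$2"] exI[of _ "2 * q$1"]) (simp add: vector_5)
qed

lemma W_form_WW_7:
  "W_form a b c d p q \<in> WW 7 \<longleftrightarrow>
    a$1 = 0 \<and> a$2 = 0 \<and> a$5 = 0 \<and> b$1 = 0 \<and> b$2 = 0 \<and> b$5 = 0 \<and>
    c$3 = 0 \<and> c$4 = 0 \<and> c$5 = 0 \<and> d$3 = 0 \<and> d$4 = 0 \<and> d$5 = 0 \<and>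
    p$1 = 0 \<and> p$2 = 0 \<and> p$3 = 0 \<and> p$4 = 0 \<and> q$1 = 0 \<and> q$2 = 0 \<and>
    q$3 = 0 \<and> q$4 = 0 \<and> a$3 = 1/2 * p$5 \<and> a$4 = 1/2 * q$5 \<and> b$3 = 1/2 * q$5 \<and>
    b$4 = -1/2 * p$5 \<and> c$1 = -1/2 * p$5 \<and> c$2 = -1/2 * q$5 \<and> d$1 = -1/2 * q$5 \<and>
    d$2 = 1/2 * p$5"
    (is "_ \<longleftrightarrow> ?E")
proof
  assume "W_form a b c d p q \<in> WW 7"
  then show ?E
    unfolding WW_7_eq mem_Collect_eq W_form_eq_iff by (elim exE conjE) (simp add: vector_5)
next
  assume ?E
  then show "W_form a b c d p q \<in> WW 7"
    unfolding WW_7_eq mem_Collect_eq W_form_eq_iff vec_eq_iff forall_5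
    by (intro exI[of _ "a$3"] exI[of _ "a$4"]) (simp add: vector_5)
qed

section \<open>Containment of all classes in the space of the tensors \<open>W_form\<close>\<close>

lemma horizontal_W_form:
  assumes A: "A \<in> AA" and h: "\<And>X Y Z. Y $ 5 = 0 \<Longrightarrow> Z $ 5 = 0 \<Longrightarrow> A X (phi0 Y) (phi0 Z) = - A X Y Z"
  shows "\<exists>a b c d p q. A = W_form a b c d p q"
proof -
  \<comment> \<open>The algebra u(2) consists of \<phi>-invariant horizontal 2-forms.
    Anti-invariance on horizontal vectors leaves no such part, so the projection fixes
    \<open>A X\<close>.\<close>
  have "pr_m (A X) = A X" for X
  proof (rule sym, rule Lam2_eqI[OF AA_Lam2[OF A]])
    note L = AA_Lam2[OF A, of X]
    show "pr_m (A X) \<in> Lam2" unfolding pr_m_eq[OF L] by (rule m_form_Lam2)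
    note n = linear_neg[OF Lam2D(1)[OF L]] linear_neg[OF Lam2D(2)[OF L]]
    have "A X (bas 1) (bas 2) = 0" "A X (bas 3) (bas 4) = 0"
      using h[of "bas 1" "bas 2" X] h[of "bas 3" "bas 4" X] Lam2D(3)[OF L, of "bas 2" "bas 1"]
        Lam2D(3)[OF L, of "bas 4" "bas 3"] by (simp_all add: n)
    moreover have "A X (bas 2) (bas 4) = - A X (bas 1) (bas 3)" "A X (bas 2) (bas 3) = A X (bas 1) (bas 4)"
      using h[of "bas 1" "bas 3" X] h[of "bas 1" "bas 4" X] by (simp_all add: n)
    ultimately show "A X (bas 1) (bas 2) = pr_m (A X) (bas 1) (bas 2)" "A X (bas 1) (bas 3) = pr_m (A X) (bas 1) (bas 3)"
      "A X (bas 1) (bas 4) = pr_m (A X) (bas 1) (bas 4)" "A X (bas 1) (bas 5) = pr_m (A X) (bas 1) (bas 5)"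
      "A X (bas 2) (bas 3) = pr_m (A X) (bas 2) (bas 3)" "A X (bas 2) (bas 4) = pr_m (A X) (bas 2) (bas 4)"
      "A X (bas 2) (bas 5) = pr_m (A X) (bas 2) (bas 5)" "A X (bas 3) (bas 4) = pr_m (A X) (bas 3) (bas 4)"
      "A X (bas 3) (bas 5) = pr_m (A X) (bas 3) (bas 5)" "A X (bas 4) (bas 5) = pr_m (A X) (bas 4) (bas 5)"
      by (simp_all add: pr_m_eq[OF L])
  qed
  then have "pr_W A = A" by (simp add: pr_W_def)
  then show ?thesis using pr_W_eq[OF A] by (intro exI) (rule trans[OF sym])
qed

lemma phi0_phi0: "Y $ 5 = 0 \<Longrightarrow> phi0 (phi0 Y) = - Y"
  by (simp add: vec_eq_iff forall_5)

lemma CC_all_eq: "CC_all = {W_form a b c d p q |a b c d p q. True}"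
proof -
  have "\<exists>a b c d p q. A = W_form a b c d p q" if "A \<in> CC_all" for A
  proof (rule horizontal_W_form)
    show "A \<in> AA" using that by (simp add: CC_all_def)
    fix X Y Z :: vec5 assume "Y $ 5 = 0" "Z $ 5 = 0"
    moreover have "A X Y Z = - A X (phi0 Y) (phi0 Z) + eta0 Y * A X xi0 Z + eta0 Z * A X Y xi0"
      using that unfolding CC_all_def by blast
    ultimately show "A X (phi0 Y) (phi0 Z) = - A X Y Z" by (simp add: eta0_nth)
  qed
  then show ?thesis using W_form_CC_all by blast
qed

lemma zero_CC_all: "0 \<in> CC_all"
  using W_form_CC_all[of 0 0 0 0 0 0] by (simp add: W_form_0)

lemma CC_subset: "CC n \<subseteq> CC_all"
  by (simp add: CC_def Collect_restrict zero_CC_all)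

text \<open>The value \<open>s = 1\<close> serves \<open>WW 8\<close>, \<open>s = - 1\<close> serves
  \<open>WW 10\<close>. If Y and Z are replaced by \<phi> Y and \<phi> Z, then \<phi> \<circ> \<phi>
  = -1 on horizontal vectors exchanges the two terms on the right and changes their signs, hence the
  last two slots are \<phi>-anti-invariant there.\<close>

lemma WW_8_10_CC_all:
  assumes A: "A \<in> AA" and s: "\<And>X Y Z. A X Y Z = s * (A (phi0 X) Y (phi0 Z) + A (phi0 X) (phi0 Y) Z)"
  shows "A \<in> CC_all"
proof -
  have "A X (phi0 Y) (phi0 Z) = - A X Y Z" if "Y $ 5 = 0" "Z $ 5 = 0" for X Y Z
  proof -
    have n: "A X (- Y) Z = - A X Y Z" "A X Y (- Z) = - A X Y Z" for X Y Z
      using linear_neg[OF Lam2D(1)[OF AA_Lam2[OF A]]] linear_neg[OF Lam2D(2)[OF AA_Lam2[OF A]]] by auto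
    have "A X (phi0 Y) (phi0 Z) = s * (- A (phi0 X) (phi0 Y) Z - A (phi0 X) Y (phi0 Z))"
      using s[of X "phi0 Y" "phi0 Z"] that by (simp add: phi0_phi0 n)
    also have "\<dots> = - A X Y Z" using s[of X Y Z] by (simp add: algebra_simps)
    finally show ?thesis .
  qed
  then show ?thesis using horizontal_W_form[OF A] unfolding CC_all_eq by blast
qed

lemma WW_subset: "WW n \<subseteq> CC_all"
proof -
  have w8: "WW 8 \<subseteq> CC_all"
  proof
    fix A assume m: "A \<in> WW 8"
    note A = m[unfolded WW_8 AA3_def mem_Collect_eq, THEN conjunct1, THEN conjunct1]
      m[unfolded WW_8 mem_Collect_eq, THEN conjunct2, rule_format]
    show "A \<in> CC_all"
      by (rule WW_8_10_CC_all[OF A(1), of 1]) (subst A(2), simp)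
  qed
  have w10: "WW 10 \<subseteq> CC_all"
  proof
    fix A assume m: "A \<in> WW 10"
    note A = m[unfolded WW_10 AA3_def mem_Collect_eq, THEN conjunct1, THEN conjunct1]
      m[unfolded WW_10 mem_Collect_eq, THEN conjunct2, rule_format]
    show "A \<in> CC_all"
      by (rule WW_8_10_CC_all[OF A(1), of "- 1"]) (subst A(2), simp)
  qed
  have w9: "WW 9 \<subseteq> CC_all"
  proof
    fix A assume m: "A \<in> WW 9"
    note A = m[unfolded WW_9 AA3_def mem_Collect_eq, THEN conjunct1, THEN conjunct1]
      m[unfolded WW_9 mem_Collect_eq, THEN conjunct2, rule_format]
    have "A X (phi0 Y) (phi0 Z) = - A X Y Z" for X Y Z using A(2)[of X Y Z] by simp
    then show "A \<in> CC_all" using horizontal_W_form[OF A(1)] unfolding CC_all_eq by blast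
  qed
  have w: "WW 1 \<subseteq> CC_all" "WW 2 \<subseteq> CC_all" "WW 3 \<subseteq> CC_all" "WW 4 \<subseteq> CC_all" "WW 5 \<subseteq> CC_all"
    "WW 6 \<subseteq> CC_all" "WW 7 \<subseteq> CC_all"
    unfolding WW_1_eq WW_2_eq WW_3_eq WW_4_eq WW_5_eq WW_6_eq WW_7_eq CC_all_eq by blast+
  show ?thesis
  proof (cases "n \<in> {1, 2, 3, 4, 5, 6, 7, 8, 9, 10}")
    case True
    then show ?thesis by (elim insertE emptyE) (simp_all only: w w8 w9 w10)
  next
    \<comment> \<open>For all other indices \<open>WW\<close> has the default value
      \<open>{0}\<close>.\<close>
    case False
    then show ?thesis by (simp add: WW_def zero_CC_all)
  qed
qed

section \<open>Sums of two classes\<close>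

lemma W_form_plus_iff:
  assumes "S \<subseteq> CC_all"
  shows "W_form a b c d p q \<in> S + T \<longleftrightarrow> (\<exists>a' b' c' d' p' q'. W_form a' b' c' d' p' q' \<in> S \<and>
    W_form (a - a') (b - b') (c - c') (d - d') (p - p') (q - q') \<in> T)"
proof
  assume "W_form a b c d p q \<in> S + T"
  then obtain A B where AB: "A \<in> S" "B \<in> T" "W_form a b c d p q = A + B" by (auto elim: set_plus_elim)
  then obtain a' b' c' d' p' q' where A: "A = W_form a' b' c' d' p' q'" using assms unfolding CC_all_eq by blast
  have "W_form a b c d p q = A + W_form (a - a') (b - b') (c - c') (d - d') (p - p') (q - q')"
    unfolding A W_form_add by simp
  then have "B = W_form (a - a') (b - b') (c - c') (d - d') (p - p') (q - q')" using AB(3) by simp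
  then show "\<exists>a' b' c' d' p' q'. W_form a' b' c' d' p' q' \<in> S \<and>
    W_form (a - a') (b - b') (c - c') (d - d') (p - p') (q - q') \<in> T" using AB A by blast
next
  assume "\<exists>a' b' c' d' p' q'. W_form a' b' c' d' p' q' \<in> S \<and>
    W_form (a - a') (b - b') (c - c') (d - d') (p - p') (q - q') \<in> T"
  then obtain a' b' c' d' p' q' where 1: "W_form a' b' c' d' p' q' \<in> S"
    and 2: "W_form (a - a') (b - b') (c - c') (d - d') (p - p') (q - q') \<in> T" by blast
  have "W_form a b c d p q = W_form a' b' c' d' p' q' + W_form (a - a') (b - b') (c - c') (d - d') (p - p') (q - q')"
    unfolding W_form_add by simp
  then show "W_form a b c d p q \<in> S + T" using 1 2 by (metis set_plus_intro)
qed

lemma W_form_CC_10_11: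
  "W_form a b c d p q \<in> CC 10 + CC 11 \<longleftrightarrow>
    a$1 = 0 \<and> a$2 = 0 \<and> a$5 = 0 \<and> b$1 = 0 \<and> b$2 = 0 \<and> b$5 = 0 \<and>
    c$3 = 0 \<and> c$4 = 0 \<and> c$5 = 0 \<and> d$3 = 0 \<and> d$4 = 0 \<and> d$5 = 0 \<and>
    p$1 = 0 \<and> p$2 = 0 \<and> p$3 = 0 \<and> p$4 = 0 \<and> q$1 = 0 \<and> q$2 = 0 \<and>
    q$3 = 0 \<and> q$4 = 0 \<and> a$3 = d$2 \<and> a$4 = - d$1 \<and> b$3 = - d$1 \<and>
    b$4 = - d$2 \<and> c$1 = - d$2 \<and> c$2 = d$1"
    (is "_ \<longleftrightarrow> ?E")
proof
  assume "W_form a b c d p q \<in> CC 10 + CC 11"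
  then show ?E
    unfolding W_form_plus_iff[OF CC_subset] W_form_CC_10 W_form_CC_11 vec_eq_iff forall_5 zero_index vector_minus_component
    by (elim exE conjE, intro conjI; linarith)
next
  assume ?E
  then show "W_form a b c d p q \<in> CC 10 + CC 11"
    unfolding W_form_plus_iff[OF CC_subset] W_form_CC_10 W_form_CC_11
    by (intro exI[of _ a] exI[of _ b] exI[of _ c] exI[of _ d] exI[of _ 0]) simp
qed

lemma W_form_CC_4_12:
  "W_form a b c d p q \<in> CC 4 + CC 12 \<longleftrightarrow>
    a$1 = 0 \<and> a$2 = 0 \<and> a$3 = 0 \<and> a$4 = 0 \<and> b$1 = 0 \<and> b$2 = 0 \<and>
    b$3 = 0 \<and> b$4 = 0 \<and> c$1 = 0 \<and> c$2 = 0 \<and> c$3 = 0 \<and> c$4 = 0 \<and>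
    d$1 = 0 \<and> d$2 = 0 \<and> d$3 = 0 \<and> d$4 = 0 \<and> p$5 = 0 \<and> q$5 = 0 \<and>
    p$1 = q$2 \<and> p$2 = - q$1 \<and> p$3 = q$4 \<and> p$4 = - q$3"
    (is "_ \<longleftrightarrow> ?E")
proof
  assume "W_form a b c d p q \<in> CC 4 + CC 12"
  then show ?E
    unfolding W_form_plus_iff[OF CC_subset] W_form_CC_4 W_form_CC_12 vec_eq_iff forall_5 zero_index vector_minus_component
    by (elim exE conjE, intro conjI; linarith)
next
  assume ?E
  then show "W_form a b c d p q \<in> CC 4 + CC 12"
    unfolding W_form_plus_iff[OF CC_subset] W_form_CC_4 W_form_CC_12
    by (intro exI[of _ 0] exI[of _ p] exI[of _ q]) simp
qed

lemma W_form_WW_4_7: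
  "W_form a b c d p q \<in> WW 4 + WW 7 \<longleftrightarrow>
    a$1 = 0 \<and> a$2 = 0 \<and> a$5 = 0 \<and> b$1 = 0 \<and> b$2 = 0 \<and> b$5 = 0 \<and>
    c$3 = 0 \<and> c$4 = 0 \<and> c$5 = 0 \<and> d$3 = 0 \<and> d$4 = 0 \<and> d$5 = 0 \<and>
    p$1 = 0 \<and> p$2 = 0 \<and> p$3 = 0 \<and> p$4 = 0 \<and> q$1 = 0 \<and> q$2 = 0 \<and>
    q$3 = 0 \<and> q$4 = 0 \<and> a$3 = d$2 \<and> a$4 = - d$1 \<and> b$3 = - d$1 \<and>
    b$4 = - d$2 \<and> c$1 = - d$2 \<and> c$2 = d$1"
    (is "_ \<longleftrightarrow> ?E")
proof
  assume "W_form a b c d p q \<in> WW 4 + WW 7"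
  then show ?E
    unfolding W_form_plus_iff[OF WW_subset] W_form_WW_4 W_form_WW_7 vec_eq_iff forall_5 zero_index vector_minus_component
    by (elim exE conjE, intro conjI; linarith)
next
  assume E: ?E
  \<comment> \<open>If x, y are the parameters of the \<open>WW 4\<close> part and r, t those of the
    \<open>WW 7\<close> part, then \<open>r - x = d$2\<close>, \<open>x + 2 * r = p$5\<close>,
    \<open>t - y = - d$1\<close> and \<open>y + 2 * t = q$5\<close>. Eliminating r and t gives these
    values.\<close>
  define x y where "x = (p$5 - 2 * d$2) / 3" and "y = (q$5 + 2 * d$1) / 3"
  have "W_form (vector [0, 0, - x, - y, 0]) (vector [0, 0, - y, x, 0]) (vector [x, y, 0, 0, 0])
      (vector [y, - x, 0, 0, 0]) (x *\<^sub>R bas 5) (y *\<^sub>R bas 5) \<in> WW 4"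
    unfolding WW_4_eq by blast
  then show "W_form a b c d p q \<in> WW 4 + WW 7"
    unfolding W_form_plus_iff[OF WW_subset]
  proof (intro exI conjI)
    show "W_form (a - vector [0, 0, - x, - y, 0]) (b - vector [0, 0, - y, x, 0]) (c - vector [x, y, 0, 0, 0])
      (d - vector [y, - x, 0, 0, 0]) (p - x *\<^sub>R bas 5) (q - y *\<^sub>R bas 5) \<in> WW 7"
      unfolding W_form_WW_7 using E by (simp add: vector_5 x_def y_def field_simps)
  qed
qed

lemma W_form_WW_2_6:
  "W_form a b c d p q \<in> WW 2 + WW 6 \<longleftrightarrow>
    a$1 = 0 \<and> a$2 = 0 \<and> a$3 = 0 \<and> a$4 = 0 \<and> b$1 = 0 \<and> b$2 = 0 \<and>
    b$3 = 0 \<and> b$4 = 0 \<and> c$1 = 0 \<and> c$2 = 0 \<and> c$3 = 0 \<and> c$4 = 0 \<and>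
    d$1 = 0 \<and> d$2 = 0 \<and> d$3 = 0 \<and> d$4 = 0 \<and> p$5 = 0 \<and> q$5 = 0 \<and>
    p$1 = q$2 \<and> p$2 = - q$1 \<and> p$3 = q$4 \<and> p$4 = - q$3"
    (is "_ \<longleftrightarrow> ?E")
proof
  assume "W_form a b c d p q \<in> WW 2 + WW 6"
  then show ?E
    unfolding W_form_plus_iff[OF WW_subset] W_form_WW_2 W_form_WW_6 vec_eq_iff forall_5 zero_index vector_minus_component
    by (elim exE conjE, intro conjI; linarith)
next
  assume E: ?E
  \<comment> \<open>On \<open>WW 6\<close> the vectors \<open>a, b, c, d\<close> vanish, so they
    belong to the \<open>WW 2\<close> part entirely; \<open>?p\<close> and \<open>?q\<close> are the
    entries that they force there.\<close>
  let ?p = "(1/2) *\<^sub>R vector [- c$5, d$5, a$5, - b$5, 0] :: vec5"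
  let ?q = "(1/2) *\<^sub>R vector [- d$5, - c$5, b$5, a$5, 0] :: vec5"
  have "W_form a b c d ?p ?q \<in> WW 2"
    unfolding W_form_WW_2 using E by (simp add: vector_5)
  moreover have "W_form (a - a) (b - b) (c - c) (d - d) (p - ?p) (q - ?q) \<in> WW 6"
    unfolding W_form_WW_6 using E by (simp add: vector_5)
  ultimately show "W_form a b c d p q \<in> WW 2 + WW 6"
    unfolding W_form_plus_iff[OF WW_subset] by blast
qed

section \<open>Components of the torsion\<close>

lemma zero_WW: "0 \<in> WW n"
proof (cases "n \<in> {1, 2, 3, 4, 5, 6, 7, 8, 9, 10}")
  case True
  then have "W_form 0 0 0 0 0 0 \<in> WW n"
    by (elim insertE emptyE)
      (simp_all only: W_form_WW_1 W_form_WW_2 W_form_WW_3 W_form_WW_4 W_form_WW_5 W_form_WW_6 W_form_WW_7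
        W_form_WW_8 W_form_WW_9 W_form_WW_10, simp_all)
  then show ?thesis by (simp add: W_form_0)
qed (simp add: WW_def)

lemma additive_sum:
  fixes f :: "form3 \<Rightarrow> real"
  assumes "\<And>A B. f (A + B) = f A + f B"
  shows "f (sum F S) = (\<Sum>j\<in>S. f (F j))"
proof -
  have "f 0 = 0" using assms[of 0 0] by simp
  then show ?thesis by (induction S rule: infinite_finite_induct) (simp_all add: assms)
qed

lemma additive_sum_pair:
  fixes f :: "form3 \<Rightarrow> real"
  assumes "\<And>A B. f (A + B) = f A + f B"
    and "\<And>j. j \<in> {1..10} \<Longrightarrow> j \<noteq> i \<Longrightarrow> j \<noteq> k \<Longrightarrow> f (F j) = 0"
    and "i \<in> {1..10::nat}" "k \<in> {1..10}" "i \<noteq> k"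
  shows "f (\<Sum>j=1..10. F j) = f (F i) + f (F k)"
proof -
  have "f (\<Sum>j=1..10. F j) = (\<Sum>j\<in>{i, k}. f (F j))"
    unfolding additive_sum[of f, OF assms(1)]
    by (rule sum.mono_neutral_right) (use assms in auto)
  then show ?thesis using assms(5) by simp
qed

text \<open>Padding with zeros gives a decomposition with the value B at \<open>i\<close>. The last
  premise is the uniqueness that \<open>THE\<close> asks for; it is verified below for the pairs (4,
  7) and (2, 6).\<close>

lemma W_comp_pair:
  assumes "B \<in> WW i" "C \<in> WW k" "i \<in> {1..10}" "k \<in> {1..10}" "i \<noteq> k"
    and "\<And>F. (\<And>j. j \<in> {1..10} \<Longrightarrow> F j \<in> WW j) \<Longrightarrow> B + C = (\<Sum>j=1..10. F j) \<Longrightarrow> F i = B"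
  shows "W_comp i (B + C) = B"
  unfolding W_comp_def
proof (rule the_equality)
  define F where "F = (\<lambda>j. if j = i then B else if j = k then C else 0)"
  have "(\<Sum>j=1..10. F j) = (\<Sum>j\<in>{i, k}. F j)"
    by (rule sum.mono_neutral_right) (use assms(3,4) in \<open>auto simp: F_def\<close>)
  also have "\<dots> = B + C" using assms(5) by (simp add: F_def)
  finally have "B + C = (\<Sum>j=1..10. F j)" by simp
  moreover have "\<forall>j\<in>{1..10}. F j \<in> WW j" using assms(1,2) zero_WW by (simp add: F_def)
  moreover have "B = F i" by (simp add: F_def)
  ultimately show "\<exists>F. (\<forall>j\<in>{1..10}. F j \<in> WW j) \<and> B + C = (\<Sum>j=1..10. F j) \<and> B = F i" by blast
qed (use assms(6) in blast)

lemma WW_W_formE: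
  assumes "A \<in> WW n"
  obtains a b c d p q where "A = W_form a b c d p q" "W_form a b c d p q \<in> WW n"
  using assms WW_subset[of n] unfolding CC_all_eq by blast

lemma atLeastAtMost_1_10: "{1..10::nat} = {1, 2, 3, 4, 5, 6, 7, 8, 9, 10}"
  by (rule set_eqI, simp, presburger)

text \<open>The functionals are coordinates on \<open>CC 10 + CC 11\<close>: the first two read
  \<open>p$5\<close> and \<open>q$5\<close>, the last two the skew \<phi>-anti-invariant part of
  A(X, Y, \<xi>). In the other classes this matrix has only symmetric or \<phi>-invariant parts in
  its horizontal block.\<close>

lemma WW_4_7_vanish:
  shows "\<forall>j\<in>{1..10} - {4, 7}. \<forall>A\<in>WW j. A (bas 5) (bas 1) (bas 3) = 0"
    "\<forall>j\<in>{1..10} - {4, 7}. \<forall>A\<in>WW j. A (bas 5) (bas 1) (bas 4) = 0"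
    "\<forall>j\<in>{1..10} - {4, 7}. \<forall>A\<in>WW j. A (bas 1) (bas 3) (bas 5) - A (bas 3) (bas 1) (bas 5) + A (bas 4) (bas 2) (bas 5) - A (bas 2) (bas 4) (bas 5) = 0"
    "\<forall>j\<in>{1..10} - {4, 7}. \<forall>A\<in>WW j. A (bas 1) (bas 4) (bas 5) - A (bas 4) (bas 1) (bas 5) + A (bas 2) (bas 3) (bas 5) - A (bas 3) (bas 2) (bas 5) = 0"
proof -
  have "A (bas 5) (bas 1) (bas 3) = 0 \<and>
    A (bas 5) (bas 1) (bas 4) = 0 \<and>
    A (bas 1) (bas 3) (bas 5) - A (bas 3) (bas 1) (bas 5) + A (bas 4) (bas 2) (bas 5) - A (bas 2) (bas 4) (bas 5) = 0 \<and>
    A (bas 1) (bas 4) (bas 5) - A (bas 4) (bas 1) (bas 5) + A (bas 2) (bas 3) (bas 5) - A (bas 3) (bas 2) (bas 5) = 0"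
    if j: "j \<in> {1..10} - {4, 7}" and AW: "A \<in> WW j" for j A
  proof -
    obtain a b c d p q where A: "A = W_form a b c d p q" and m: "W_form a b c d p q \<in> WW j"
      using AW by (rule WW_W_formE)
    have "j \<in> {1, 2, 3, 5, 6, 8, 9, 10}" using j unfolding atLeastAtMost_1_10 by blast
    then have "p$5 = 0 \<and> q$5 = 0 \<and> c$1 - a$3 + (b$4 - d$2) = 0 \<and> d$1 - a$4 + (c$2 - b$3) = 0"
      using m by (elim insertE emptyE)
        (simp_all only: W_form_WW_1 W_form_WW_2 W_form_WW_3 W_form_WW_5 W_form_WW_6 W_form_WW_8 W_form_WW_9 W_form_WW_10, simp_all)
    then show ?thesis by (simp add: A W_form_eval)
  qed
  then show "\<forall>j\<in>{1..10} - {4, 7}. \<forall>A\<in>WW j. A (bas 5) (bas 1) (bas 3) = 0"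
    "\<forall>j\<in>{1..10} - {4, 7}. \<forall>A\<in>WW j. A (bas 5) (bas 1) (bas 4) = 0"
    "\<forall>j\<in>{1..10} - {4, 7}. \<forall>A\<in>WW j. A (bas 1) (bas 3) (bas 5) - A (bas 3) (bas 1) (bas 5) + A (bas 4) (bas 2) (bas 5) - A (bas 2) (bas 4) (bas 5) = 0"
    "\<forall>j\<in>{1..10} - {4, 7}. \<forall>A\<in>WW j. A (bas 1) (bas 4) (bas 5) - A (bas 4) (bas 1) (bas 5) + A (bas 2) (bas 3) (bas 5) - A (bas 3) (bas 2) (bas 5) = 0"
    by blast+
qed

text \<open>These are the shapes of functionals that read off components; each equation unifies with
  the additivity premise \<open>f (A + B) = f A + f B\<close>.\<close>

lemma form3_add:
  fixes A B :: form3
  shows "(A + B) X Y Z = A X Y Z + B X Y Z"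
    "(A + B) X Y Z + (A + B) X' Y' Z' = A X Y Z + A X' Y' Z' + (B X Y Z + B X' Y' Z')"
    "(A + B) X Y Z - (A + B) X' Y' Z' = A X Y Z - A X' Y' Z' + (B X Y Z - B X' Y' Z')"
    "(A + B) X Y Z - (A + B) X' Y' Z' + (A + B) U V W - (A + B) U' V' W' =
      A X Y Z - A X' Y' Z' + A U V W - A U' V' W' + (B X Y Z - B X' Y' Z' + B U V W - B U' V' W')"
  by simp_all

lemma WW_4_7_unique:
  assumes F: "\<And>j. j \<in> {1..10} \<Longrightarrow> F j \<in> WW j" and "B \<in> WW 4" "C \<in> WW 7" and s: "B + C = (\<Sum>j=1..10. F j)"
  shows "F 4 = B" "F 7 = C"
proof -
  have f: "f B + f C = f (F 4) + f (F 7)" if add: "\<And>A B. f (A + B) = f A + f B"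
    and van: "\<forall>j\<in>{1..10} - {4, 7}. \<forall>A\<in>WW j. f A = 0" for f :: "form3 \<Rightarrow> real"
    unfolding add[symmetric, of B C] s
  proof (rule additive_sum_pair)
    show "f (F j) = 0" if "j \<in> {1..10}" "j \<noteq> 4" "j \<noteq> 7" for j using van F that by blast
  qed (rule add | simp)+
  let ?V = "\<lambda>p q. W_form (vector [0, 0, - p, - q, 0]) (vector [0, 0, - q, p, 0]) (vector [p, q, 0, 0, 0])
      (vector [q, - p, 0, 0, 0]) (p *\<^sub>R bas 5) (q *\<^sub>R bas 5)"
  let ?U = "\<lambda>p q. W_form (vector [0, 0, p, q, 0]) (vector [0, 0, q, - p, 0]) (vector [- p, - q, 0, 0, 0])
      (vector [- q, p, 0, 0, 0]) ((2 * p) *\<^sub>R bas 5) ((2 * q) *\<^sub>R bas 5)"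
  obtain x y where B: "B = ?V x y" using assms(2) unfolding WW_4_eq by blast
  obtain r t where C: "C = ?U r t" using assms(3) unfolding WW_7_eq by blast
  obtain x' y' where F4: "F 4 = ?V x' y'" using F[of 4] unfolding WW_4_eq by auto
  obtain r' t' where F7: "F 7 = ?U r' t'" using F[of 7] unfolding WW_7_eq by auto
  note ev = B C F4 F7 W_form_eval vector_5
  \<comment> \<open>On the pair (x, r) the functionals give x + 2 r and 4 x - 4 r, which are
    independent because of the different ratios in \<open>WW 4\<close> and \<open>WW 7\<close>;
    likewise for (y, t).\<close>
  have "x + 2 * r = x' + 2 * r'"
    using f[of "\<lambda>A. A (bas 5) (bas 1) (bas 3)", OF form3_add(1) WW_4_7_vanish(1)] by (simp add: ev)
  moreover have "y + 2 * t = y' + 2 * t'"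
    using f[of "\<lambda>A. A (bas 5) (bas 1) (bas 4)", OF form3_add(1) WW_4_7_vanish(2)] by (simp add: ev)
  moreover have "4 * x - 4 * r = 4 * x' - 4 * r'"
    using f[of "\<lambda>A. A (bas 1) (bas 3) (bas 5) - A (bas 3) (bas 1) (bas 5) + A (bas 4) (bas 2) (bas 5) - A (bas 2) (bas 4) (bas 5)",
        OF form3_add(4) WW_4_7_vanish(3)] by (simp add: ev)
  moreover have "4 * y - 4 * t = 4 * y' - 4 * t'"
    using f[of "\<lambda>A. A (bas 1) (bas 4) (bas 5) - A (bas 4) (bas 1) (bas 5) + A (bas 2) (bas 3) (bas 5) - A (bas 3) (bas 2) (bas 5)",
        OF form3_add(4) WW_4_7_vanish(4)] by (simp add: ev)
  ultimately have "x' = x" "y' = y" "r' = r" "t' = t" by linarith+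
  then show "F 4 = B" "F 7 = C" by (simp_all add: B C F4 F7)
qed

text \<open>These are coordinates on \<open>CC 12 + CC 4\<close>: the first four read A(\<xi>, .,
  \<xi>), the last four are \<open>p$1 + q$2\<close>, \<open>p$2 - q$1\<close>,
  \<open>p$3 + q$4\<close> and \<open>p$4 - q$3\<close>, which vanish by the equations of
  \<open>WW 9\<close>.\<close>

lemma WW_2_6_vanish:
  shows "\<forall>j\<in>{1..10} - {2, 6}. \<forall>A\<in>WW j. A (bas 5) (bas 1) (bas 5) = 0"
    "\<forall>j\<in>{1..10} - {2, 6}. \<forall>A\<in>WW j. A (bas 5) (bas 2) (bas 5) = 0"
    "\<forall>j\<in>{1..10} - {2, 6}. \<forall>A\<in>WW j. A (bas 5) (bas 3) (bas 5) = 0"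
    "\<forall>j\<in>{1..10} - {2, 6}. \<forall>A\<in>WW j. A (bas 5) (bas 4) (bas 5) = 0"
    "\<forall>j\<in>{1..10} - {2, 6}. \<forall>A\<in>WW j. A (bas 1) (bas 1) (bas 3) + A (bas 2) (bas 1) (bas 4) = 0"
    "\<forall>j\<in>{1..10} - {2, 6}. \<forall>A\<in>WW j. A (bas 2) (bas 1) (bas 3) - A (bas 1) (bas 1) (bas 4) = 0"
    "\<forall>j\<in>{1..10} - {2, 6}. \<forall>A\<in>WW j. A (bas 3) (bas 1) (bas 3) + A (bas 4) (bas 1) (bas 4) = 0"
    "\<forall>j\<in>{1..10} - {2, 6}. \<forall>A\<in>WW j. A (bas 4) (bas 1) (bas 3) - A (bas 3) (bas 1) (bas 4) = 0"
proof -
  have "A (bas 5) (bas 1) (bas 5) = 0 \<and>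
    A (bas 5) (bas 2) (bas 5) = 0 \<and>
    A (bas 5) (bas 3) (bas 5) = 0 \<and>
    A (bas 5) (bas 4) (bas 5) = 0 \<and>
    A (bas 1) (bas 1) (bas 3) + A (bas 2) (bas 1) (bas 4) = 0 \<and>
    A (bas 2) (bas 1) (bas 3) - A (bas 1) (bas 1) (bas 4) = 0 \<and>
    A (bas 3) (bas 1) (bas 3) + A (bas 4) (bas 1) (bas 4) = 0 \<and>
    A (bas 4) (bas 1) (bas 3) - A (bas 3) (bas 1) (bas 4) = 0"
    if j: "j \<in> {1..10} - {2, 6}" and AW: "A \<in> WW j" for j A
  proof -
    obtain a b c d p q where A: "A = W_form a b c d p q" and m: "W_form a b c d p q \<in> WW j"
      using AW by (rule WW_W_formE)
    have "j \<in> {1, 3, 4, 5, 7, 8, 9, 10}" using j unfolding atLeastAtMost_1_10 by blast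
    then have "a$5 = 0 \<and> b$5 = 0 \<and> c$5 = 0 \<and> d$5 = 0 \<and> p$1 = - q$2 \<and> p$2 = q$1 \<and> p$3 = - q$4 \<and> p$4 = q$3"
      using m by (elim insertE emptyE)
        (simp_all only: W_form_WW_1 W_form_WW_3 W_form_WW_4 W_form_WW_5 W_form_WW_7 W_form_WW_8 W_form_WW_9 W_form_WW_10, simp_all)
    then show ?thesis by (simp add: A W_form_eval)
  qed
  then show "\<forall>j\<in>{1..10} - {2, 6}. \<forall>A\<in>WW j. A (bas 5) (bas 1) (bas 5) = 0"
    "\<forall>j\<in>{1..10} - {2, 6}. \<forall>A\<in>WW j. A (bas 5) (bas 2) (bas 5) = 0"
    "\<forall>j\<in>{1..10} - {2, 6}. \<forall>A\<in>WW j. A (bas 5) (bas 3) (bas 5) = 0"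
    "\<forall>j\<in>{1..10} - {2, 6}. \<forall>A\<in>WW j. A (bas 5) (bas 4) (bas 5) = 0"
    "\<forall>j\<in>{1..10} - {2, 6}. \<forall>A\<in>WW j. A (bas 1) (bas 1) (bas 3) + A (bas 2) (bas 1) (bas 4) = 0"
    "\<forall>j\<in>{1..10} - {2, 6}. \<forall>A\<in>WW j. A (bas 2) (bas 1) (bas 3) - A (bas 1) (bas 1) (bas 4) = 0"
    "\<forall>j\<in>{1..10} - {2, 6}. \<forall>A\<in>WW j. A (bas 3) (bas 1) (bas 3) + A (bas 4) (bas 1) (bas 4) = 0"
    "\<forall>j\<in>{1..10} - {2, 6}. \<forall>A\<in>WW j. A (bas 4) (bas 1) (bas 3) - A (bas 3) (bas 1) (bas 4) = 0"
    by blast+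
qed

lemma WW_2_6_unique:
  assumes F: "\<And>j. j \<in> {1..10} \<Longrightarrow> F j \<in> WW j" and "B \<in> WW 2" "C \<in> WW 6" and s: "B + C = (\<Sum>j=1..10. F j)"
  shows "F 2 = B" "F 6 = C"
proof -
  have f: "f B + f C = f (F 2) + f (F 6)" if add: "\<And>A B. f (A + B) = f A + f B"
    and van: "\<forall>j\<in>{1..10} - {2, 6}. \<forall>A\<in>WW j. f A = 0" for f :: "form3 \<Rightarrow> real"
    unfolding add[symmetric, of B C] s
  proof (rule additive_sum_pair)
    show "f (F j) = 0" if "j \<in> {1..10}" "j \<noteq> 2" "j \<noteq> 6" for j using van F that by blast
  qed (rule add | simp)+
  let ?V = "\<lambda>v. W_form (- v$1 *\<^sub>R bas 5) (- v$2 *\<^sub>R bas 5) (- v$3 *\<^sub>R bas 5) (- v$4 *\<^sub>R bas 5)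
     ((1/2) *\<^sub>R vector [v$3, - v$4, - v$1, v$2, 0]) ((1/2) *\<^sub>R vector [v$4, v$3, - v$2, - v$1, 0])"
  let ?U = "\<lambda>a b c d. W_form 0 0 0 0 ((1/2) *\<^sub>R vector [c, - d, - a, b, 0]) ((1/2) *\<^sub>R vector [d, c, - b, - a, 0])"
  obtain v :: vec5 where B: "B = ?V v" using assms(2) unfolding WW_2_eq by blast
  obtain a b c d where C: "C = ?U a b c d" using assms(3) unfolding WW_6_eq by blast
  obtain v' :: vec5 where F2: "F 2 = ?V v'" using F[of 2] unfolding WW_2_eq by auto
  obtain a' b' c' d' where F6: "F 6 = ?U a' b' c' d'" using F[of 6] unfolding WW_6_eq by auto
  note ev = B C F2 F6 W_form_eval vector_5
  \<comment> \<open>Within the pair only \<open>WW 2\<close> contributes to A(\<xi>, ., \<xi>), so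
    its part is determined first; the other functionals then determine the \<open>WW 6\<close>
    part.\<close>
  have v: "v'$1 = v$1" "v'$2 = v$2" "v'$3 = v$3" "v'$4 = v$4"
    using f[of "\<lambda>A. A (bas 5) (bas 1) (bas 5)", OF form3_add(1) WW_2_6_vanish(1)]
      f[of "\<lambda>A. A (bas 5) (bas 2) (bas 5)", OF form3_add(1) WW_2_6_vanish(2)]
      f[of "\<lambda>A. A (bas 5) (bas 3) (bas 5)", OF form3_add(1) WW_2_6_vanish(3)]
      f[of "\<lambda>A. A (bas 5) (bas 4) (bas 5)", OF form3_add(1) WW_2_6_vanish(4)]
    by (simp_all add: ev)
  have "c' = c"
    using f[of "\<lambda>A. A (bas 1) (bas 1) (bas 3) + A (bas 2) (bas 1) (bas 4)", OF form3_add(2) WW_2_6_vanish(5)] v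
    by (simp add: ev)
  moreover have "d' = d"
    using f[of "\<lambda>A. A (bas 2) (bas 1) (bas 3) - A (bas 1) (bas 1) (bas 4)", OF form3_add(3) WW_2_6_vanish(6)] v
    by (simp add: ev)
  moreover have "a' = a"
    using f[of "\<lambda>A. A (bas 3) (bas 1) (bas 3) + A (bas 4) (bas 1) (bas 4)", OF form3_add(2) WW_2_6_vanish(7)] v
    by (simp add: ev)
  moreover have "b' = b"
    using f[of "\<lambda>A. A (bas 4) (bas 1) (bas 3) - A (bas 3) (bas 1) (bas 4)", OF form3_add(3) WW_2_6_vanish(8)] v
    by (simp add: ev)
  ultimately show "F 2 = B" "F 6 = C" using v by (simp_all add: B C F2 F6)
qed

lemma W_comp_4_7:
  assumes "B \<in> WW 4" "C \<in> WW 7"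
  shows "W_comp 4 (B + C) = B" "W_comp 7 (B + C) = C"
proof -
  show "W_comp 4 (B + C) = B" by (rule W_comp_pair[OF assms]) (use WW_4_7_unique assms in auto)
  have "W_comp 7 (C + B) = C"
    by (rule W_comp_pair[OF assms(2,1)]) (use WW_4_7_unique(2) assms in \<open>auto simp: add.commute\<close>)
  then show "W_comp 7 (B + C) = C" by (simp add: add.commute)
qed

lemma W_comp_2_6:
  assumes "B \<in> WW 2" "C \<in> WW 6"
  shows "W_comp 2 (B + C) = B" "W_comp 6 (B + C) = C"
proof -
  show "W_comp 2 (B + C) = B" by (rule W_comp_pair[OF assms]) (use WW_2_6_unique assms in auto)
  have "W_comp 6 (C + B) = C"
    by (rule W_comp_pair[OF assms(2,1)]) (use WW_2_6_unique(2) assms in \<open>auto simp: add.commute\<close>)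
  then show "W_comp 6 (B + C) = C" by (simp add: add.commute)
qed

text \<open>A vanishing component leaves the tensor in \<open>WW 4\<close> alone or in
  \<open>WW 7\<close> alone. In either one the blocks \<open>(a, b, c, d)\<close> and
  \<open>(p, q)\<close> determine each other, so both vanish once one does.\<close>

lemma strict_4_7:
  assumes "W_form a b c d p q \<in> WW 4 + WW 7" "i \<in> {4, 7}" "W_comp i (W_form a b c d p q) = 0"
    and "p = 0 \<and> q = 0 \<or> a = 0 \<and> b = 0 \<and> c = 0 \<and> d = 0"
  shows "W_form a b c d p q = 0"
proof -
  obtain B C where BC: "B \<in> WW 4" "C \<in> WW 7" "W_form a b c d p q = B + C"
    using assms(1) by (auto elim: set_plus_elim)
  have "B = 0 \<or> C = 0" using W_comp_4_7[OF BC(1,2)] assms(2,3) BC(3) by auto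
  then have "W_form a b c d p q \<in> WW 4 \<or> W_form a b c d p q \<in> WW 7" using BC by auto
  then show ?thesis
    using assms(4) unfolding W_form_WW_4 W_form_WW_7 W_form_0[symmetric] W_form_eq_iff vec_eq_iff forall_5
    by auto
qed

text \<open>In \<open>WW 2\<close> the fifth entries of \<open>a, b, c, d\<close> are multiples of
  entries of \<open>p\<close> and \<open>q\<close>, here 0; in \<open>WW 6\<close> the four vectors
  vanish anyway.\<close>

lemma strict_2_6:
  assumes "W_form a b c d 0 0 \<in> WW 2 + WW 6" "i \<in> {2, 6}" "W_comp i (W_form a b c d 0 0) = 0"
  shows "W_form a b c d 0 0 = 0"
proof -
  obtain B C where BC: "B \<in> WW 2" "C \<in> WW 6" "W_form a b c d 0 0 = B + C"
    using assms(1) by (auto elim: set_plus_elim)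
  have "B = 0 \<or> C = 0" using W_comp_2_6[OF BC(1,2)] assms(2,3) BC(3) by auto
  then have "W_form a b c d 0 0 \<in> WW 2 \<or> W_form a b c d 0 0 \<in> WW 6" using BC by auto
  then show ?thesis
    unfolding W_form_WW_2 W_form_WW_6 W_form_0[symmetric] W_form_eq_iff vec_eq_iff forall_5 by auto
qed

text \<open>\<phi> acts on the last two slots as a derivation. On e_i \<and> e5 one slot
  contributes, because \<phi> \<xi> = 0; on the two horizontal basis forms both slots contribute
  equally, hence the factor 2. The coefficients at u(2) cancel.\<close>

lemma torsion_W_form:
  assumes A: "A \<in> AA" and T: "\<And>X Y Z. T X Y Z = - (A X Y (phi0 Z) + A X (phi0 Y) Z)"
  obtains a b c d p q where "pr_W A = W_form a b c d p q" "T = W_form b (- a) d (- c) (2 *\<^sub>R q) (- 2 *\<^sub>R p)"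
proof -
  let ?v = "\<lambda>j k. \<chi> i. A (bas i) (bas j) (bas k)"
  have "pr_W A = W_form (?v 1 5) (?v 2 5) (?v 3 5) (?v 4 5) ((1/2) *\<^sub>R (?v 1 3 - ?v 2 4)) ((1/2) *\<^sub>R (?v 1 4 + ?v 2 3))"
    unfolding pr_W_eq[OF A] W_form_eq_iff by (simp add: vec_eq_iff)
  moreover have "T X Y Z = W_form (?v 2 5) (- ?v 1 5) (?v 4 5) (- ?v 3 5) (?v 1 4 + ?v 2 3) (- (?v 1 3 - ?v 2 4)) X Y Z" for X Y Z
    unfolding T Lam2_expand[OF AA_Lam2[OF A], of X Y "phi0 Z"] Lam2_expand[OF AA_Lam2[OF A], of X "phi0 Y" Z]
      W_form_def m_form_def phi0_nth inner_minus_left inner_diff_left inner_add_left AA_vec[OF A, of X, symmetric]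
    by algebra
  ultimately show ?thesis by (intro that) (auto intro!: ext)
qed

section \<open>The Levi-Civita connection in a chart\<close>

lemma bounded_bilinear_matrix_vector_mult:
  "bounded_bilinear (\<lambda>(A :: real^'n^'m) v. A *v v)"
  by (rule bilinear_conv_bounded_bilinear[THEN iffD1])
    (auto simp: bilinear_def vec_eq_iff matrix_vector_mult_def sum.distrib distrib_left distrib_right
      sum_distrib_left mult.left_commute mult.assoc intro!: linearI)

lemma bounded_bilinear_matrix_matrix_mult:
  "bounded_bilinear (\<lambda>(A :: real^'n^'m) (B :: real^'k^'n). A ** B)"
  by (rule bilinear_conv_bounded_bilinear[THEN iffD1])
    (auto simp: bilinear_def vec_eq_iff matrix_matrix_mult_def sum.distrib distrib_left distrib_right
      sum_distrib_left mult.left_commute mult.assoc intro!: linearI)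

lemma chart_inv_apply: "is_chart c \<Longrightarrow> q \<in> fst c \<Longrightarrow> chart_inv c (snd c q) = q"
  unfolding is_chart_def by (meson homeomorphism_apply1)

lemma open_chart_image:
  assumes "is_chart c" "open W"
  shows "open (snd c ` (fst c \<inter> W))"
proof -
  have "openin (top_of_set (fst c)) (fst c \<inter> W)" using assms(2) by (simp add: openin_open_Int)
  then have "openin (top_of_set (snd c ` fst c)) (snd c ` (fst c \<inter> W))"
    using assms(1) unfolding is_chart_def by (meson homeomorphism_imp_open_map)
  then show ?thesis using assms(1) unfolding is_chart_def by (meson openin_open_trans)
qed

lemma chart_deriv_works:
  assumes "smooth_comps C W T" "c \<in> C" "p \<in> W \<inter> fst c"
  shows "(T c \<circ> chart_inv c has_derivative chart_deriv c (T c) p) (at (snd c p))"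
proof -
  have "Ck_on (Suc 0) (T c \<circ> chart_inv c) (snd c ` (fst c \<inter> W))"
    using assms unfolding smooth_comps_def smooth_on_def by blast
  then have "(T c \<circ> chart_inv c) differentiable (at (snd c p))" using assms(3) by auto
  then show ?thesis unfolding chart_deriv_def by (simp add: frechet_derivative_works)
qed

lemma chart_deriv_eqI: "(f \<circ> chart_inv c has_derivative D) (at (snd c p)) \<Longrightarrow> chart_deriv c f p = D"
  unfolding chart_deriv_def by (auto dest: frechet_derivative_at)

lemma chart_deriv_cong:
  assumes "is_chart c" "open W" "p \<in> W \<inter> fst c" "\<And>q. q \<in> W \<inter> fst c \<Longrightarrow> f q = g q"
    and "(f \<circ> chart_inv c has_derivative D) (at (snd c p))"
  shows "(g \<circ> chart_inv c has_derivative D) (at (snd c p))"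
  by (rule has_derivative_transform_within_open[OF assms(5) open_chart_image[OF assms(1,2)]])
    (use assms in \<open>auto simp: chart_inv_apply\<close>)

text \<open>Applied along an adapted frame to the metric, where \<open>k\<close> is a Kronecker
  delta, and to \<Phi>, where \<open>k\<close> is a coefficient of the model form.\<close>

lemma product_rule_constant:
  fixes f g :: "'a::topological_space \<Rightarrow> real^'n" and B :: "'a \<Rightarrow> real^'n^'n" and c :: "('a, 'n) chart"
  assumes c: "is_chart c" "open W" "p \<in> W \<inter> fst c"
    and f: "(f \<circ> chart_inv c has_derivative f') (at (snd c p))"
    and B: "(B \<circ> chart_inv c has_derivative B') (at (snd c p))"
    and g: "(g \<circ> chart_inv c has_derivative g') (at (snd c p))"
    and const: "\<And>q. q \<in> W \<inter> fst c \<Longrightarrow> f q \<bullet> (B q *v g q) = k"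
  shows "f' u \<bullet> (B p *v g p) + f p \<bullet> (B' u *v g p) + f p \<bullet> (B p *v g' u) = 0"
proof -
  have p: "chart_inv c (snd c p) = p" using c by (simp add: chart_inv_apply)
  have "((\<lambda>y. (f \<circ> chart_inv c) y \<bullet> ((B \<circ> chart_inv c) y *v (g \<circ> chart_inv c) y)) has_derivative
    (\<lambda>u. f p \<bullet> (B p *v g' u + B' u *v g p) + f' u \<bullet> (B p *v g p))) (at (snd c p))"
    using has_derivative_inner[OF f bounded_bilinear.FDERIV[OF bounded_bilinear_matrix_vector_mult B g]]
    by (simp add: p)
  then have 1: "((\<lambda>q. f q \<bullet> (B q *v g q)) \<circ> chart_inv c has_derivative
    (\<lambda>u. f p \<bullet> (B p *v g' u + B' u *v g p) + f' u \<bullet> (B p *v g p))) (at (snd c p))"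
    by (simp add: comp_def)
  have 2: "((\<lambda>q. f q \<bullet> (B q *v g q)) \<circ> chart_inv c has_derivative (\<lambda>u. 0)) (at (snd c p))"
    by (rule chart_deriv_cong[OF c, of "\<lambda>_. k"]) (simp_all add: const comp_def)
  have "(\<lambda>u. f p \<bullet> (B p *v g' u + B' u *v g p) + f' u \<bullet> (B p *v g p)) = (\<lambda>u. 0)"
    using has_derivative_unique[OF 1 2] .
  then have "f p \<bullet> (B p *v g' u + B' u *v g p) + f' u \<bullet> (B p *v g p) = 0" by (rule fun_cong)
  then show ?thesis by (simp add: inner_add_right)
qed

lemma symmetric_inner: "transpose G = G \<Longrightarrow> v \<bullet> (G *v w) = w \<bullet> (G *v (v :: real^'n))"
  by (metis dot_lmul_matrix inner_commute vector_transpose_matrix)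

lemma positive_definite_invertible:
  fixes G :: "real^'n^'n"
  assumes "\<And>v. v \<noteq> 0 \<Longrightarrow> v \<bullet> (G *v v) > 0"
  shows "G ** matrix_inv G = mat 1"
proof -
  have "inj ((*v) G)"
  proof (rule injI)
    fix v w assume "G *v v = G *v w"
    then have "(v - w) \<bullet> (G *v (v - w)) = 0" by (simp add: matrix_vector_mult_diff_distrib)
    then show "v = w" using assms[of "v - w"] by force
  qed
  then obtain B where "B ** G = mat 1" using matrix_left_invertible_injective by blast
  then have "G ** B = mat 1 \<and> B ** G = mat 1" using matrix_left_right_inverse by blast
  then show ?thesis unfolding matrix_inv_def by (metis (mono_tags, lifting) someI_ex)
qed

lemma riemannian_metricD:
  assumes "riemannian_metric C g" "c \<in> C" "p \<in> fst c"
  shows "transpose (g c p) = g c p" "v \<noteq> 0 \<Longrightarrow> v \<bullet> (g c p *v v) > 0"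
    "smooth_comps C (manifold C) g"
  using assms unfolding riemannian_metric_def bilinear_form_field_def by auto

lemma metric_entry_deriv:
  assumes g: "riemannian_metric C g" and c: "c \<in> C" "p \<in> fst c"
  shows "((\<lambda>q. g c q $ j $ l) \<circ> chart_inv c has_derivative (\<lambda>u. chart_deriv c (g c) p u $ j $ l)) (at (snd c p))"
    and "linear (chart_deriv c (g c) p)"
proof -
  have "p \<in> manifold C \<inter> fst c" using c by (auto simp: manifold_def)
  note d = chart_deriv_works[OF riemannian_metricD(3)[OF g c] c(1) this]
  show "((\<lambda>q. g c q $ j $ l) \<circ> chart_inv c has_derivative (\<lambda>u. chart_deriv c (g c) p u $ j $ l)) (at (snd c p))"
    using bounded_linear.has_derivative[OF bounded_linear_vec_nth bounded_linear.has_derivative[OF bounded_linear_vec_nth d]]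
    by (simp add: comp_def)
  show "linear (chart_deriv c (g c) p)" using d by (rule has_derivative_linear)
qed

text \<open>Lowering the index cancels \<open>matrix_inv\<close> against the metric and leaves the
  Christoffel symbols of the first kind. \<open>P i j l\<close> is the derivative of the entry (j,
  l) of the metric in the coordinate direction i.\<close>

lemma metric_christoffel_map:
  assumes g: "riemannian_metric C g" and c: "c \<in> C" "p \<in> fst c"
  defines "P \<equiv> \<lambda>i j l. chart_deriv c (g c) p (axis i 1) $ j $ l"
  shows "v \<bullet> (g c p *v christoffel_map g c p u w) =
    (\<Sum>l\<in>UNIV. \<Sum>i\<in>UNIV. \<Sum>j\<in>UNIV. v$l * u$i * w$j * (P i j l + P j i l - P l i j)) / 2"
proof -
  have P: "chart_deriv c (\<lambda>q. g c q $ j $ l) p (axis i 1) = P i j l" for i j l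
    by (simp add: P_def chart_deriv_eqI[OF metric_entry_deriv(1)[OF g c]])
  define w' where "w' = (\<chi> l. (\<Sum>i\<in>UNIV. \<Sum>j\<in>UNIV. u$i * w$j * (P i j l + P j i l - P l i j)) / 2)"
  have "christoffel_map g c p u w $ k = (matrix_inv (g c p) *v w') $ k" for k
  proof -
    have "christoffel_map g c p u w $ k = (\<Sum>i\<in>UNIV. \<Sum>j\<in>UNIV. \<Sum>l\<in>UNIV.
        matrix_inv (g c p) $ k $ l * (u$i * w$j * (P i j l + P j i l - P l i j) / 2))"
      by (simp add: christoffel_map_def christoffel_def P sum_distrib_left sum_distrib_right add_divide_distrib diff_divide_distrib algebra_simps)
    also have "\<dots> = (\<Sum>i\<in>UNIV. \<Sum>l\<in>UNIV. \<Sum>j\<in>UNIV.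
        matrix_inv (g c p) $ k $ l * (u$i * w$j * (P i j l + P j i l - P l i j) / 2))"
      by (rule sum.cong[OF refl], rule sum.swap)
    also have "\<dots> = (\<Sum>l\<in>UNIV. \<Sum>i\<in>UNIV. \<Sum>j\<in>UNIV.
        matrix_inv (g c p) $ k $ l * (u$i * w$j * (P i j l + P j i l - P l i j) / 2))"
      by (rule sum.swap)
    also have "\<dots> = (matrix_inv (g c p) *v w') $ k"
      by (simp add: matrix_vector_mult_def w'_def sum_distrib_left sum_divide_distrib)
    finally show ?thesis .
  qed
  then have "christoffel_map g c p u w = matrix_inv (g c p) *v w'" by (simp add: vec_eq_iff)
  moreover have "g c p ** matrix_inv (g c p) = mat 1"
    by (rule positive_definite_invertible) (rule riemannian_metricD(2)[OF g c])
  ultimately have "g c p *v christoffel_map g c p u w = w'"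
    by (simp add: matrix_vector_mul_assoc)
  then show ?thesis by (simp add: inner_vec_def w'_def sum_distrib_left sum_divide_distrib mult.assoc)
qed

text \<open>Of the two first-kind symbols with j and l exchanged, the terms \<open>P j i l\<close>
  and \<open>P l i j\<close> cancel in the sum, and the two halves of \<open>P i j l\<close> add up
  to the derivative of the metric.\<close>

lemma nabla_metric:
  assumes g: "riemannian_metric C g" and c: "c \<in> C" "p \<in> fst c" "is_chart c"
  shows "nabla_form g c p g u v w = 0"
proof -
  define P where "P = (\<lambda>i j l. chart_deriv c (g c) p (axis i 1) $ j $ l)"
  note dn = metric_entry_deriv(1)[OF g c(1,2)]
  note lin = metric_entry_deriv(2)[OF g c(1,2)]
  have s: "g c q $ j $ l = g c q $ l $ j" if "q \<in> fst c" for q j l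
    using riemannian_metricD(1)[OF g c(1) that] by (metis transpose_def vec_lambda_beta)
  have "((\<lambda>q. g c q $ l $ j) \<circ> chart_inv c has_derivative (\<lambda>u. chart_deriv c (g c) p u $ j $ l)) (at (snd c p))" for j l
    by (rule chart_deriv_cong[OF c(3) open_UNIV _ _ dn]) (use c s in auto)
  from has_derivative_unique[OF this dn]
  \<comment> \<open>The metric is symmetric throughout the chart, so uniqueness of the derivative
    makes its derivative symmetric.\<close>
  have P: "P i j l = P i l j" for i j l unfolding P_def by metis
  have mc: "v \<bullet> (g c p *v christoffel_map g c p u w) =
    (\<Sum>l\<in>UNIV. \<Sum>i\<in>UNIV. \<Sum>j\<in>UNIV. v$l * u$i * w$j * (P i j l + P j i l - P l i j)) / 2" for v w
    by (simp add: metric_christoffel_map[OF g c(1,2)] P_def)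
  have "v \<bullet> (chart_deriv c (g c) p u *v w) = (\<Sum>l\<in>UNIV. \<Sum>i\<in>UNIV. \<Sum>j\<in>UNIV. v$l * u$i * w$j * P i j l)"
  proof -
    have "chart_deriv c (g c) p u = (\<Sum>i\<in>UNIV. u$i *\<^sub>R chart_deriv c (g c) p (axis i 1))"
      by (subst basis_expansion[of u, symmetric])
        (simp add: linear_sum[OF lin] linear_cmul[OF lin] scalar_mult_eq_scaleR)
    then have "chart_deriv c (g c) p u $ l $ j = (\<Sum>i\<in>UNIV. u$i * P i j l)" for j l
      by (simp add: P_def P[of _ j l, unfolded P_def]) 
    then show ?thesis
      by (simp add: inner_vec_def matrix_vector_mult_def sum_distrib_left sum_distrib_right mult.assoc)
        (rule sum.cong[OF refl], subst sum.swap, simp add: ac_simps)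
  qed
  moreover have "christoffel_map g c p u v \<bullet> (g c p *v w) = w \<bullet> (g c p *v christoffel_map g c p u v)"
    by (rule symmetric_inner[OF riemannian_metricD(1)[OF g c(1,2)]])
  moreover have "w \<bullet> (g c p *v christoffel_map g c p u v) =
    (\<Sum>l\<in>UNIV. \<Sum>i\<in>UNIV. \<Sum>j\<in>UNIV. v$l * u$i * w$j * (P i j l + P l i j - P j i l)) / 2"
  proof -
    \<comment> \<open>The summation indices j and l are exchanged, so that both Christoffel terms
      carry the factor \<open>v$l * u$i * w$j\<close>.\<close>
    have "w \<bullet> (g c p *v christoffel_map g c p u v) =
      (\<Sum>j\<in>UNIV. \<Sum>i\<in>UNIV. \<Sum>l\<in>UNIV. v$l * u$i * w$j * (P i l j + P l i j - P j i l)) / 2"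
      unfolding mc by (simp add: ac_simps)
    also have "\<dots> = (\<Sum>i\<in>UNIV. \<Sum>j\<in>UNIV. \<Sum>l\<in>UNIV. v$l * u$i * w$j * (P i l j + P l i j - P j i l)) / 2"
      by (subst sum.swap) simp
    also have "\<dots> = (\<Sum>i\<in>UNIV. \<Sum>l\<in>UNIV. \<Sum>j\<in>UNIV. v$l * u$i * w$j * (P i l j + P l i j - P j i l)) / 2"
      by (rule arg_cong2[where f = "(/)", OF _ refl], rule sum.cong[OF refl], rule sum.swap)
    also have "\<dots> = (\<Sum>l\<in>UNIV. \<Sum>i\<in>UNIV. \<Sum>j\<in>UNIV. v$l * u$i * w$j * (P i j l + P l i j - P j i l)) / 2"
      by (subst sum.swap) (simp add: P[of _ _ l for l])
    finally show ?thesis .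
  qed
  moreover note mc[of v w]
  ultimately show ?thesis
    unfolding nabla_form_def
    by (simp add: sum.distrib sum_subtractf algebra_simps)
qed

section \<open>Adapted frames\<close>

context
  fixes M :: "'a::topological_space acm_structure" and W e c p
  assumes M: "almost_contact_metric M" and e: "adapted_frame M W e" and c: "c \<in> charts M" and p: "p \<in> W \<inter> fst c"
begin

lemma acm_chart: "is_chart c" and acm_metric: "riemannian_metric (charts M) (met M)" and p_fst: "p \<in> fst c"
  and p_manifold: "p \<in> manifold (charts M) \<inter> fst c" and open_W: "open W"
  using M e c p unfolding almost_contact_metric_def smooth_atlas_def adapted_frame_def manifold_def by auto

lemma frame_deriv: "(e i c \<circ> chart_inv c has_derivative chart_deriv c (e i c) p) (at (snd c p))"
proof (rule chart_deriv_works[OF _ c p])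
  show "smooth_comps (charts M) W (e i)"
    using e unfolding adapted_frame_def vector_field_def by blast
qed

lemma met_deriv: "(met M c \<circ> chart_inv c has_derivative chart_deriv c (met M c) p) (at (snd c p))"
  by (rule chart_deriv_works[OF riemannian_metricD(3)[OF acm_metric c p_fst] c p_manifold])

text \<open>Smoothness is given for the metric and for \<phi>; the product rule carries
  differentiability over to their matrix product \<Phi>.\<close>

lemma fund_form_deriv:
  "(fund_form M c \<circ> chart_inv c has_derivative chart_deriv c (fund_form M c) p) (at (snd c p))"
proof -
  have "smooth_comps (charts M) (manifold (charts M)) (phi M)"
    using M unfolding almost_contact_metric_def endomorphism_field_def by blast
  note d = chart_deriv_works[OF this c p_manifold]
  have "(fund_form M c \<circ> chart_inv c) differentiable (at (snd c p))"
    using bounded_bilinear.FDERIV[OF bounded_bilinear_matrix_matrix_mult met_deriv d]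
    unfolding differentiable_def by (auto simp: fund_form_def comp_def)
  then show ?thesis unfolding chart_deriv_def by (simp add: frechet_derivative_works)
qed

lemma frame_orthonormal: "q \<in> W \<inter> fst c \<Longrightarrow> e i c q \<bullet> (met M c q *v e j c q) = (if i = j then 1 else 0)"
  using e c unfolding adapted_frame_def by blast

lemma frame_fund_form: "q \<in> W \<inter> fst c \<Longrightarrow> e i c q \<bullet> (fund_form M c q *v e j c q) = bas i \<bullet> phi0 (bas j)"
proof -
  assume "q \<in> W \<inter> fst c"
  then have "e i c q \<bullet> (fund_form M c q *v e j c q) =
      (wedge11 (\<lambda>X. X$1) (\<lambda>X. X$2) + wedge11 (\<lambda>X. X$3) (\<lambda>X. X$4)) (bas i) (bas j)"
    using e c unfolding adapted_frame_def by blast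
  also have "\<dots> = bas i \<bullet> phi0 (bas j)" by (simp add: wedge11_def inner_5 algebra_simps)
  finally show ?thesis .
qed

text \<open>The inner products of the frame fields are constant and the metric is parallel, so the
  product rule becomes g(\<nabla> e_i, e_j) + g(e_i, \<nabla> e_j) = 0.\<close>

lemma conn_form_antisym: "conn_form M e c p i j X = - conn_form M e c p j i X"
proof -
  note m = symmetric_inner[OF riemannian_metricD(1)[OF acm_metric c p_fst]]
  define u where "u = frame_map e c p X"
  have "chart_deriv c (e i c) p u \<bullet> (met M c p *v e j c p) + e i c p \<bullet> (chart_deriv c (met M c) p u *v e j c p)
      + e i c p \<bullet> (met M c p *v chart_deriv c (e j c) p u) = 0"
    by (rule product_rule_constant[OF acm_chart open_W p frame_deriv met_deriv frame_deriv frame_orthonormal])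
  moreover have "nabla_form (met M) c p (met M) u (e i c p) (e j c p) = 0"
    by (rule nabla_metric[OF acm_metric c p_fst acm_chart])
  ultimately have "nabla_vec (met M) c p u (e i) \<bullet> (met M c p *v e j c p)
      + e i c p \<bullet> (met M c p *v nabla_vec (met M) c p u (e j)) = 0"
    by (simp add: nabla_vec_def nabla_form_def inner_add_left inner_add_right matrix_vector_right_distrib)
  then show ?thesis
    using m[of "e i c p" "nabla_vec (met M) c p u (e j)"] by (simp add: conn_form_def u_def)
qed

text \<open>With the frame as the rows of a square matrix E, orthonormality reads E g E^T = 1. A
  right inverse is a left inverse, so E^T E g = 1, which is the expansion.\<close>

lemma frame_expansion: "v = (\<Sum>k\<in>UNIV. (v \<bullet> (met M c p *v e k c p)) *\<^sub>R e k c p)"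
proof -
  note m = symmetric_inner[OF riemannian_metricD(1)[OF acm_metric c p_fst]]
  define E where "E = (\<chi> k. e k c p)"
  have "(E ** met M c p) ** transpose E = mat 1"
  proof -
    have "((E ** met M c p) ** transpose E) $ i $ j = e i c p \<bullet> (met M c p *v e j c p)" for i j
      unfolding matrix_mul_assoc[symmetric] matrix_mult_dot[of E]
      by (simp add: E_def row_def column_def inner_vec_def matrix_vector_mult_def matrix_matrix_mult_def transpose_def)
    then show ?thesis using frame_orthonormal[OF p] by (simp add: vec_eq_iff mat_def)
  qed
  then have "transpose E ** (E ** met M c p) = mat 1" using matrix_left_right_inverse by blast
  then have "v = transpose E *v (E *v (met M c p *v v))"
    by (simp add: matrix_vector_mul_assoc matrix_mul_assoc)
  also have "\<dots> = (\<Sum>k\<in>UNIV. (e k c p \<bullet> (met M c p *v v)) *\<^sub>R e k c p)"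
    by (simp add: E_def vec_eq_iff matrix_vector_mult_def transpose_def inner_vec_def mult.commute)
  finally show ?thesis using m[of v] by simp
qed

lemma nabla_frame:
  "nabla_vec (met M) c p (frame_map e c p X) (e i) = (\<Sum>k\<in>UNIV. conn_form M e c p i k X *\<^sub>R e k c p)"
  unfolding conn_form_def by (rule frame_expansion)

text \<open>As \<Phi>(e_i, e_j) is constant, its derivative drops out and -\<Phi>(\<nabla> e_i, e_j)
  - \<Phi>(e_i, \<nabla> e_j) remains, to be expanded by \<open>nabla_frame\<close>.\<close>

lemma nabla_Phi_frame:
  "nabla_Phi M e c p X (bas i) (bas j) =
    - (\<Sum>k\<in>UNIV. conn_form M e c p i k X * (bas k \<bullet> phi0 (bas j)))
    - (\<Sum>k\<in>UNIV. conn_form M e c p j k X * (bas i \<bullet> phi0 (bas k)))"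
proof -
  define u where "u = frame_map e c p X"
  have b: "frame_map e c p (bas i) = e i c p" for i
    unfolding frame_map_def by (simp add: if_distrib[of "\<lambda>t. t *\<^sub>R _"] cong: if_cong)
  have "chart_deriv c (e i c) p u \<bullet> (fund_form M c p *v e j c p) + e i c p \<bullet> (chart_deriv c (fund_form M c) p u *v e j c p)
      + e i c p \<bullet> (fund_form M c p *v chart_deriv c (e j c) p u) = 0"
    by (rule product_rule_constant[OF acm_chart open_W p frame_deriv fund_form_deriv frame_deriv frame_fund_form])
  then have "nabla_Phi M e c p X (bas i) (bas j) = - (nabla_vec (met M) c p u (e i) \<bullet> (fund_form M c p *v e j c p))
      - e i c p \<bullet> (fund_form M c p *v nabla_vec (met M) c p u (e j))"
    by (simp add: nabla_Phi_def b nabla_form_def nabla_vec_def u_def inner_add_left inner_add_right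
        matrix_vector_right_distrib)
  also have "\<dots> = - (\<Sum>k\<in>UNIV. conn_form M e c p i k X * (bas k \<bullet> phi0 (bas j)))
    - (\<Sum>k\<in>UNIV. conn_form M e c p j k X * (bas i \<bullet> phi0 (bas k)))"
    unfolding u_def nabla_frame
    by (simp add: inner_sum_left inner_sum_right linear_sum[OF matrix_vector_mul_linear]
        matrix_vector_mult_scaleR frame_fund_form[OF p])
  finally show ?thesis .
qed

text \<open>By antisymmetry both terms of the wedge product contribute the same double sum, which
  cancels the factor 1/2.\<close>

lemma conn_Omega_eq:
  "conn_Omega M e c p X Y Z = (\<Sum>i\<in>UNIV. \<Sum>j\<in>UNIV. conn_form M e c p i j X * Y$i * Z$j)"
proof -
  have "(\<Sum>i\<in>UNIV. \<Sum>j\<in>UNIV. conn_form M e c p i j X * (Z$i * Y$j)) =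
    (\<Sum>i\<in>UNIV. \<Sum>j\<in>UNIV. conn_form M e c p j i X * (Z$j * Y$i))"
    by (rule sum.swap)
  also have "\<dots> = - (\<Sum>i\<in>UNIV. \<Sum>j\<in>UNIV. conn_form M e c p i j X * (Y$i * Z$j))"
    by (subst conn_form_antisym) (simp add: sum_negf mult.commute[of "Z $ _"])
  finally show ?thesis
    by (simp add: conn_Omega_def wedge11_def right_diff_distrib sum_subtractf mult.assoc)
qed

lemma frame_map_linear: "linear (frame_map e c p)"
  by (rule linearI) (simp_all add: frame_map_def scaleR_add_left sum.distrib scaleR_sum_right)

lemma christoffel_map_linear: "linear (\<lambda>u. christoffel_map g c p u v)" "linear (christoffel_map g c p u)"
  by (auto intro!: linearI simp: vec_eq_iff christoffel_map_def distrib_left distrib_right sum.distrib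
      sum_distrib_left mult.assoc mult.left_commute)

lemma conn_form_linear: "linear (conn_form M e c p i j)"
proof -
  have "linear (\<lambda>u. nabla_vec (met M) c p u (e i))"
    unfolding nabla_vec_def
    by (intro linear_compose_add has_derivative_linear[OF frame_deriv] christoffel_map_linear)
  from linear_compose[OF frame_map_linear this]
  have N: "linear (\<lambda>X. nabla_vec (met M) c p (frame_map e c p X) (e i))" by (simp add: comp_def)
  show ?thesis
    unfolding conn_form_def by (rule linearI) (simp_all add: linear_add[OF N] linear_cmul[OF N] inner_add_left)
qed

lemma conn_Omega_AA: "conn_Omega M e c p \<in> AA"
proof (rule AAI)
  show "linear (\<lambda>X. conn_Omega M e c p X Y Z)" for Y Z
    unfolding conn_Omega_eq
    by (rule linearI) (simp_all add: linear_add[OF conn_form_linear] linear_cmul[OF conn_form_linear]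
        distrib_right sum.distrib sum_distrib_left mult.assoc)
  show "conn_Omega M e c p X \<in> Lam2" for X
  proof (rule Lam2I)
    show "conn_Omega M e c p X Y Z = - conn_Omega M e c p X Z Y" for Y Z
      by (simp add: conn_Omega_def wedge11_def sum_negf[symmetric] algebra_simps)
  qed (simp_all add: conn_Omega_eq distrib_left distrib_right sum.distrib sum_distrib_left mult.assoc
      mult.left_commute)
qed

lemma nabla_Phi_linear: "linear (\<lambda>Y. nabla_Phi M e c p X Y Z)" "linear (nabla_Phi M e c p X Y)"
  unfolding nabla_Phi_def nabla_form_def
  by (auto intro!: linearI simp: linear_add[OF frame_map_linear] linear_cmul[OF frame_map_linear]
      linear_add[OF christoffel_map_linear(2)] linear_cmul[OF christoffel_map_linear(2)]
      inner_add_left inner_add_right matrix_vector_right_distrib matrix_vector_mult_scaleR algebra_simps)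

lemma nabla_Phi_conn_Omega:
  "nabla_Phi M e c p X Y Z = - (conn_Omega M e c p X Y (phi0 Z) + conn_Omega M e c p X (phi0 Y) Z)"
proof -
  note L = AA_Lam2[OF conn_Omega_AA, of X]
  have phi_lin: "linear phi0" by (rule linearI) (simp_all add: vec_eq_iff forall_5)
  have basis: "nabla_Phi M e c p X (bas i) (bas j) =
    - (conn_Omega M e c p X (bas i) (phi0 (bas j)) + conn_Omega M e c p X (phi0 (bas i)) (bas j))" for i j
  proof -
    have O: "conn_Omega M e c p X (bas i) V = (\<Sum>k\<in>UNIV. conn_form M e c p i k X * V $ k)" for i V
    proof -
      have "(\<Sum>k\<in>UNIV. conn_form M e c p l k X * bas i $ l * V $ k) =
          (if l = i then \<Sum>k\<in>UNIV. conn_form M e c p i k X * V $ k else 0)" for l by simp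
      then show ?thesis unfolding conn_Omega_eq by simp
    qed
    have "conn_Omega M e c p X (phi0 (bas i)) (bas j) = - (\<Sum>k\<in>UNIV. conn_form M e c p j k X * phi0 (bas i) $ k)"
      using Lam2D(3)[OF L, of "phi0 (bas i)" "bas j"] O[of j] by simp
    \<comment> \<open>The matrix of \<phi> is skew. This turns the sum over the second slot into the
      corresponding term of \<open>nabla_Phi_frame\<close>.\<close>
    moreover have "phi0 (bas i) $ k = - (phi0 (bas k) $ i)" for k
      using exhaust_5[of i] exhaust_5[of k] by (elim disjE) simp_all
    ultimately show ?thesis unfolding nabla_Phi_frame O inner_bas by (simp add: sum_negf)
  qed
  have eqI: "f V = g V" if "linear f" "linear g" "\<And>i. f (bas i) = g (bas i)" for f g :: "vec5 \<Rightarrow> real" and V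
    using linear_expand[OF that(1), of V] linear_expand[OF that(2), of V] that(3) by simp
  have r2: "linear (\<lambda>Z. - (conn_Omega M e c p X Y (phi0 Z) + conn_Omega M e c p X (phi0 Y) Z))" for Y
    using linear_compose[OF phi_lin Lam2D(1)[OF L, of Y]] Lam2D(1)[OF L, of "phi0 Y"]
    by (intro linear_compose_neg linear_compose_add) (simp_all add: comp_def)
  have r1: "linear (\<lambda>Y. - (conn_Omega M e c p X Y (phi0 Z) + conn_Omega M e c p X (phi0 Y) Z))" for Z
    using linear_compose[OF phi_lin Lam2D(2)[OF L, of Z]] Lam2D(2)[OF L, of "phi0 Z"]
    by (intro linear_compose_neg linear_compose_add) (simp_all add: comp_def)
  show ?thesis
    by (rule eqI[OF nabla_Phi_linear(1) r1], rule eqI[OF nabla_Phi_linear(2) r2], rule basis)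
qed

lemma torsion_W_form_frame:
  obtains a b c' d r s where "intrinsic_torsion M e c p = W_form a b c' d r s"
    "nabla_Phi M e c p = W_form b (- a) d (- c') (2 *\<^sub>R s) (- 2 *\<^sub>R r)"
proof (rule torsion_W_form[of "conn_Omega M e c p" "nabla_Phi M e c p", OF conn_Omega_AA nabla_Phi_conn_Omega])
  fix a b c' d r s
  assume "pr_W (conn_Omega M e c p) = W_form a b c' d r s"
    "nabla_Phi M e c p = W_form b (- a) d (- c') (2 *\<^sub>R s) (- 2 *\<^sub>R r)"
  then show thesis using that by (simp add: intrinsic_torsion_def pr_W_def)
qed

end

section \<open>Comparison of the classes\<close>

text \<open>Both classes quantify over the same frames, charts and points, so an equivalence of
  linear systems in the local model suffices.\<close>

lemma of_class_C_iff_W: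
  assumes M: "almost_contact_metric M"
    and iff: "\<And>a b c d p q. W_form b (- a) d (- c) (2 *\<^sub>R q) (- 2 *\<^sub>R p) \<in> sum CC I \<longleftrightarrow> W_form a b c d p q \<in> sum WW J"
  shows "of_class_C M I \<longleftrightarrow> of_class_W M J"
proof -
  have "nabla_Phi M e c p \<in> sum CC I \<longleftrightarrow> intrinsic_torsion M e c p \<in> sum WW J"
    if f: "adapted_frame M W e" "c \<in> charts M" "p \<in> W \<inter> fst c" for W e c p
  proof -
    obtain a b c' d r s where "intrinsic_torsion M e c p = W_form a b c' d r s"
      "nabla_Phi M e c p = W_form b (- a) d (- c') (2 *\<^sub>R s) (- 2 *\<^sub>R r)"
      using M f by (rule torsion_W_form_frame)
    then show ?thesis by (simp only: iff)
  qed
  then show ?thesis unfolding of_class_C_def of_class_W_def everywhere_def by blast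
qed

text \<open>A frame and a point with nonzero torsion exist by non-integrability. By
  \<open>strict\<close> no component with index in \<open>I\<close> vanishes at that point, which
  serves all these indices at once.\<close>

lemma of_strict_class_WI:
  assumes M: "almost_contact_metric M" and "\<not> integrable_acm M" "of_class_C M K"
    and sub: "\<And>a b c d p q. W_form b (- a) d (- c) (2 *\<^sub>R q) (- 2 *\<^sub>R p) \<in> sum CC K \<Longrightarrow> W_form a b c d p q \<in> sum WW I"
    and strict: "\<And>a b c d p q i. W_form b (- a) d (- c) (2 *\<^sub>R q) (- 2 *\<^sub>R p) \<in> sum CC K \<Longrightarrow>
      W_form a b c d p q \<in> sum WW I \<Longrightarrow> i \<in> I \<Longrightarrow> W_comp i (W_form a b c d p q) = 0 \<Longrightarrow> W_form a b c d p q = 0"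
  shows "of_strict_class_W M I"
proof -
  have *: "intrinsic_torsion M e c p \<in> sum WW I \<and>
      (\<forall>i\<in>I. W_comp i (intrinsic_torsion M e c p) = 0 \<longrightarrow> intrinsic_torsion M e c p = 0)"
    if f: "adapted_frame M W e" "c \<in> charts M" "p \<in> W \<inter> fst c" for W e c p
  proof -
    obtain a b c' d r s where t: "intrinsic_torsion M e c p = W_form a b c' d r s"
      and n: "nabla_Phi M e c p = W_form b (- a) d (- c') (2 *\<^sub>R s) (- 2 *\<^sub>R r)"
      using M f by (rule torsion_W_form_frame)
    have "nabla_Phi M e c p \<in> sum CC K"
      using assms(3) f unfolding of_class_C_def everywhere_def by blast
    then show ?thesis using sub strict unfolding t n by blast
  qed
  obtain W e c p where f: "adapted_frame M W e" "c \<in> charts M" "p \<in> W \<inter> fst c" "intrinsic_torsion M e c p \<noteq> 0"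
    using assms(2) unfolding integrable_acm_def everywhere_def by blast
  have "\<not> everywhere M (\<lambda>e c p. W_comp i (intrinsic_torsion M e c p) = 0)" if "i \<in> I" for i
    using *[OF f(1-3)] f that unfolding everywhere_def by blast
  then show ?thesis using * unfolding of_strict_class_W_def of_class_W_def everywhere_def by blast
qed

theorem theorem3p1:
  fixes M :: "'a::{t2_space, second_countable_topology} acm_structure"
  assumes "almost_contact_metric M"
  shows "(of_class_C M {2} \<longleftrightarrow> of_class_W M {9}) \<and>
         (of_class_C M {4} \<longleftrightarrow> of_class_W M {6}) \<and>
         (of_class_C M {5} \<longleftrightarrow> of_class_W M {1}) \<and>
         (of_class_C M {6} \<longleftrightarrow> of_class_W M {3}) \<and>
         (of_class_C M {7} \<longleftrightarrow> of_class_W M {5}) \<and>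
         (of_class_C M {8} \<longleftrightarrow> of_class_W M {8}) \<and>
         (of_class_C M {9} \<longleftrightarrow> of_class_W M {10}) \<and>
         (of_class_C M {10, 11} \<longleftrightarrow> of_class_W M {4, 7}) \<and>
         (of_class_C M {4, 12} \<longleftrightarrow> of_class_W M {2, 6}) \<and>
         (\<not> integrable_acm M \<and> (of_class_C M {10} \<or> of_class_C M {11}) \<longrightarrow>
            of_strict_class_W M {4, 7}) \<and>
         (\<not> integrable_acm M \<and> of_class_C M {12} \<longrightarrow> of_strict_class_W M {2, 6})"
proof (intro conjI impI)
  \<comment> \<open>Vector equations are split into entries, so that the two systems become linear
    arithmetic for \<open>argo\<close>.\<close>
  note [simp] = vec_eq_iff forall_5
  have W47: "sum WW {4, 7} = WW 4 + WW 7" and W26: "sum WW {2, 6} = WW 2 + WW 6"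
    and C1011: "sum CC {10, 11} = CC 10 + CC 11" and C412: "sum CC {4, 12} = CC 4 + CC 12" by simp_all
  show "of_class_C M {2} \<longleftrightarrow> of_class_W M {9}"
    by (rule of_class_C_iff_W[OF assms]) (simp add: W_form_CC_2 W_form_WW_9, argo)
  show "of_class_C M {4} \<longleftrightarrow> of_class_W M {6}"
    by (rule of_class_C_iff_W[OF assms]) (simp add: W_form_CC_4 W_form_WW_6, argo)
  \<comment> \<open>Without \<open>del: One_nat_def\<close> the index in \<open>WW 1\<close> would
    become \<open>Suc 0\<close> and \<open>W_form_WW_1\<close> would not match.\<close>
  show "of_class_C M {5} \<longleftrightarrow> of_class_W M {1}"
    by (rule of_class_C_iff_W[OF assms]) (simp add: W_form_CC_5 W_form_WW_1 del: One_nat_def, argo)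
  show "of_class_C M {6} \<longleftrightarrow> of_class_W M {3}"
    by (rule of_class_C_iff_W[OF assms]) (simp add: W_form_CC_6 W_form_WW_3, argo)
  show "of_class_C M {7} \<longleftrightarrow> of_class_W M {5}"
    by (rule of_class_C_iff_W[OF assms]) (simp add: W_form_CC_7 W_form_WW_5, argo)
  show "of_class_C M {8} \<longleftrightarrow> of_class_W M {8}"
    by (rule of_class_C_iff_W[OF assms]) (simp add: W_form_CC_8 W_form_WW_8, argo)
  show "of_class_C M {9} \<longleftrightarrow> of_class_W M {10}"
    by (rule of_class_C_iff_W[OF assms]) (simp add: W_form_CC_9 W_form_WW_10, argo)
  show "of_class_C M {10, 11} \<longleftrightarrow> of_class_W M {4, 7}"
    by (rule of_class_C_iff_W[OF assms]) (simp add: C1011 W47 W_form_CC_10_11 W_form_WW_4_7, argo)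
  show "of_class_C M {4, 12} \<longleftrightarrow> of_class_W M {2, 6}"
    by (rule of_class_C_iff_W[OF assms]) (simp add: C412 W26 W_form_CC_4_12 W_form_WW_2_6, argo)
next
  assume a: "\<not> integrable_acm M \<and> (of_class_C M {10} \<or> of_class_C M {11})"
  note iff = W_form_CC_10 W_form_CC_11 W_form_WW_4_7 vec_eq_iff forall_5
  have W47: "sum WW {4, 7} = WW 4 + WW 7" by simp
  from a consider "of_class_C M {10}" | "of_class_C M {11}" by blast
  then show "of_strict_class_W M {4, 7}"
  proof cases
    case 1
    show ?thesis
    proof (rule of_strict_class_WI[OF assms _ 1, where I = "{4, 7}", unfolded W47])
      fix a b c d p q :: vec5
      assume m: "W_form b (- a) d (- c) (2 *\<^sub>R q) (- 2 *\<^sub>R p) \<in> sum CC {10}"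
      \<comment> \<open>The automorphism respects the two blocks, so the block missing in
        \<open>CC 10\<close> is missing in the torsion as well.\<close>
      then have "p = 0 \<and> q = 0" by (simp add: W_form_CC_10)
      then show "W_form a b c d p q = 0" if "W_form a b c d p q \<in> WW 4 + WW 7" "i \<in> {4, 7}"
        "W_comp i (W_form a b c d p q) = 0" for i using strict_4_7 that by blast
      show "W_form a b c d p q \<in> WW 4 + WW 7" using m by (simp add: iff)
    qed (use a in blast)
  next
    case 2
    show ?thesis
    proof (rule of_strict_class_WI[OF assms _ 2, where I = "{4, 7}", unfolded W47])
      fix a b c d p q :: vec5
      assume m: "W_form b (- a) d (- c) (2 *\<^sub>R q) (- 2 *\<^sub>R p) \<in> sum CC {11}"
      then have "a = 0 \<and> b = 0 \<and> c = 0 \<and> d = 0" by (simp add: W_form_CC_11)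
      then show "W_form a b c d p q = 0" if "W_form a b c d p q \<in> WW 4 + WW 7" "i \<in> {4, 7}"
        "W_comp i (W_form a b c d p q) = 0" for i using strict_4_7 that by blast
      show "W_form a b c d p q \<in> WW 4 + WW 7" using m by (simp add: iff)
    qed (use a in blast)
  qed
next
  assume a: "\<not> integrable_acm M \<and> of_class_C M {12}"
  have W26: "sum WW {2, 6} = WW 2 + WW 6" by simp
  show "of_strict_class_W M {2, 6}"
  proof (rule of_strict_class_WI[OF assms _ conjunct2[OF a], where I = "{2, 6}", unfolded W26])
    fix a b c d p q :: vec5
    assume m: "W_form b (- a) d (- c) (2 *\<^sub>R q) (- 2 *\<^sub>R p) \<in> sum CC {12}"
    then have pq: "p = 0" "q = 0" by (simp_all add: W_form_CC_12)
    show "W_form a b c d p q = 0" if "W_form a b c d p q \<in> WW 2 + WW 6" "i \<in> {2, 6}"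
      "W_comp i (W_form a b c d p q) = 0" for i using strict_2_6 that unfolding pq by blast
    show "W_form a b c d p q \<in> WW 2 + WW 6" using m by (simp add: W_form_CC_12 W_form_WW_2_6)
  qed (use a in blast)
qed

end
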